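(* Let $(\theta,\varphi)$ be a random dynamical system on $E_M=M\sqcup\{\partial\}$ with absorption at $\partial$ satisfying Hypothesis (H) (see context), with quasi-ergodic distribution $\nu$, and let $\Theta_t(\omega,x)=(\theta_t\omega,\varphi_t(\omega,x))$ be its skew product. Then the probability measure $$\mathbb Q_\nu(\cdot):=\int_M\mathbb Q_x(\cdot)\,\nu(\mathrm dx)$$ is invariant and ergodic for $(\Theta_t)_{t\in\mathbb T}$, and even strongly mixing, i.e. $\lim_{t\to\infty}\mathbb Q_\nu(A_1\cap\Theta_t^{-1}(A_2))=\mathbb Q_\nu(A_1)\,\mathbb Q_\nu(A_2)$ for all $A_1,A_2\in\mathcal F\otimes\mathcal B(M)$.
   Context: **Setting.** $\mathbb T$ is $\mathbb N_0=\{0,1,2,\dots\}$ or $\mathbb R_+=[0,\infty)$. $M$ is a $d$-dimensional Riemannian manifold (possibly with boundary) embedded in some $\mathbb R^n$; $E_M=M\sqcup\{\partial\}$, with $\partial$ an added isolated cemetery point; $\mathcal B(\cdot)$ denotes Borel $\sigma$-algebras. Noise space: if $\mathbb T=\mathbb R_+$, $\Omega$ is either the space $\mathcal D(\mathbb R_+,\mathbb R^m)$ of càdlàg functions or the space $\mathcal C_0(\mathbb R_+,\mathbb R^m)$ of continuous functions vanishing at $0$; if $\mathbb T=\mathbb N_0$, $\Omega=X^{\mathbb N_0}$ with $X$ Polish. With $\pi_t(\omega)=\omega(t)$, put $\mathcal F_t=\sigma(\pi_s:0\le s\le t)$ and $\mathcal F=\sigma(\pi_s:s\ge 0)$. $\mathbb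 P$ is a probability measure on $\mathcal F$ and $\theta_t:\Omega\to\Omega$ ($t\in\mathbb T$) satisfy: $(\omega,t)\mapsto\theta_t\omega$ is measurable, $\theta_0=\mathrm{id}$, $\theta_{s+t}=\theta_s\circ\theta_t$, $\mathbb P\circ\theta_t^{-1}=\mathbb P$, $\theta_t^{-1}\mathcal F_s\subset\mathcal F_{s+t}$, and (memorylessness) $\mathcal F_s$ and $\theta_s^{-1}\mathcal F_t$ are $\mathbb P$-independent for all $s,t\in\mathbb T$. A ($\mathcal C^1$) random dynamical system $(\theta,\varphi)$ on $E_M$ with absorption at $\partial$ is a jointly measurable map $\varphi:\mathbb T\times\Omega\times E_M\to E_M$, $(t,\omega,x)\mapsto\varphi_t(\omega,x)$, with $\varphi_t$ being $\mathcal F_t\otimes\mathcal B(E_M)$-measurable, $\varphi_0(\omega,\cdot)=\mathrm{id}$, $\varphi_{t+s}(\omega,x)=\varphi_t(\theta_s\omega,\varphi_s(\omega,x))$ for all $s,t,\omega,x$, such that $\varphi_s(\omega,x)=\partial$ implies $\varphi_t(\omega,x)=\partial$ for $t\ge s$, and such that for all $t,\omega$ the map $x\mapsto\varphi_t(\omega,x)$ is $\mathcal C^1$ from $\{x\in M:\tau(\omega,x)>t\}$ to $M$, where $\tau(\omega,x)=\inf\{t\in\mathbb T:\varphi_t(\omega,x)=\partial\}$. One has $\{\tau>t\}=\{\varphi_t\in M\}$. All random dynamical systems considered are of this kind. $\mathcal G_t=\mathcal F_t\otimes\mathcal B(E_M)$ (on $\Omega\times M$: $\mathcal F_t\otimes\mathcal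 B(M)$), $\mathbb P_x=\mathbb P\otimes\delta_x$, $\mathbb P_\mu=\int_M\mathbb P_x\,\mu(\mathrm dx)$. **Hypothesis (H).** A probability measure $\mu$ on $M$ is a quasi-stationary distribution if $\mathbb P_\mu(\varphi_t\in A\mid\tau>t)=\mu(A)$ for all $t\in\mathbb T$, $A\in\mathcal B(M)$. Hypothesis (H) requires: (H1) there is a unique quasi-stationary distribution $\mu$; (H2) there is $\alpha>0$ and, for every $x\in M$, a constant $C(x)$ with $\|\mathbb P_x(\varphi_t\in\cdot\mid\tau>t)-\mu\|_{TV}\le C(x)e^{-\alpha t}$ for all $t$; (H3) there are a positive bounded function $\eta$ on $M$ and $\beta>0$ with $\lim_{t\to\infty}\sup_{x\in M}|e^{\beta t}\mathbb P_x(\tau>t)-\eta(x)|=0$. **Quasi-ergodic distribution and $Q$-measures.** A probability measure $\nu$ on $M$ is a quasi-ergodic distribution if $\mathbb E_x[\frac1t\int_0^tf(\varphi_s)\,\mathrm ds\mid\tau>t]\to\int_Mf\,\mathrm d\nu$ as $t\to\infty$ for all $x\in M$ and bounded measurable $f:M\to\mathbb R$ (if $\mathbb T=\mathbb N_0$, with $\frac1n\sum_{i=0}^{n-1}f(\varphi_i)$). Under (H) it exists, is unique and equals $\nu(\mathrm dx)=\eta(x)\mu(\mathrm dx)$. Under (H), $\mathbb Q_x$ ($x\in M$) denotes the unique probability measure on $(\Omega\times M,\mathcal F\otimes\mathcal B(M))$ with $\mathbb Q_x(A)=\lim_{t\to\infty}\mathbb P_x(A\mid\tau>t)$ for every $s\in\mathbb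 T$ and $A\in\mathcal G_s$ (it exists). *)

theory Defs
  imports "HOL-Probability.Probability"
begin

subsection \<open>Regularity and embedded manifolds\<close>

primrec C_k_on :: "nat \<Rightarrow> ('a::real_normed_vector \<Rightarrow> 'b::real_normed_vector) \<Rightarrow> 'a set \<Rightarrow> bool" where
  "C_k_on 0 f U \<longleftrightarrow> continuous_on U f"
| "C_k_on (Suc k) f U \<longleftrightarrow>
     (\<forall>x\<in>U. f differentiable (at x)) \<and> (\<forall>v. C_k_on k (\<lambda>x. frechet_derivative f (at x) v) U)"

definition smooth_on :: "('a::real_normed_vector \<Rightarrow> 'b::real_normed_vector) \<Rightarrow> 'a set \<Rightarrow> bool" where
  "smooth_on f U \<longleftrightarrow> (\<forall>k. C_k_on k f U)"

definition model_space :: "nat \<Rightarrow> 'a::euclidean_space set \<Rightarrow> bool" where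
  "model_space d H \<longleftrightarrow>
     (\<exists>L. subspace L \<and> dim L = d \<and>
          (H = L \<or> (\<exists>e\<in>L. e \<noteq> 0 \<and> H = {y\<in>L. 0 \<le> inner y e})))"

text \<open>A \<open>d\<close>-dimensional smooth embedded submanifold, possibly with boundary, by slice charts. The
  Riemannian metric is the one induced by the ambient inner product; no notion below refers to it.\<close>

definition embedded_manifold :: "nat \<Rightarrow> 'a::euclidean_space set \<Rightarrow> bool" where
  "embedded_manifold d M \<longleftrightarrow>
     (\<forall>p\<in>M. \<exists>U V (\<psi> :: 'a \<Rightarrow> 'a) \<psi>' H. open U \<and> open V \<and> p \<in> U \<and> homeomorphism U V \<psi> \<psi>' \<and>
        smooth_on \<psi> U \<and> smooth_on \<psi>' V \<and> model_space d H \<and> \<psi> ` (U \<inter> M) = V \<inter> H)"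

text \<open>\<open>C\<^sup>1\<close> on an arbitrary subset of the ambient space means local extendability to \<open>C\<^sup>1\<close> maps on
  open sets; on relatively open subsets of an embedded manifold this agrees with being \<open>C\<^sup>1\<close> in
  charts.\<close>

definition C1_map_on :: "('a::real_normed_vector \<Rightarrow> 'b::real_normed_vector) \<Rightarrow> 'a set \<Rightarrow> bool" where
  "C1_map_on f D \<longleftrightarrow>
     (\<forall>p\<in>D. \<exists>U g. open U \<and> p \<in> U \<and> C_k_on 1 g U \<and> (\<forall>x\<in>D \<inter> U. g x = f x))"


subsection \<open>Random dynamical systems with absorption\<close>

text \<open>Time is a set of reals: \<open>\<nat>\<close> or \<open>{0..}\<close>. Noise paths are functions on \<open>real\<close> that are
  \<open>extensional\<close> on the time set. A point of \<open>E\<^sub>M\<close> is \<open>Some x\<close> with \<open>x\<close> in the phase space, or the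
  cemetery \<open>None\<close>.\<close>

record ('x, 'a) rds =
  time :: "real set"
  paths :: "(real \<Rightarrow> 'x) set"
  noise :: "(real \<Rightarrow> 'x) measure"
  shift :: "real \<Rightarrow> (real \<Rightarrow> 'x) \<Rightarrow> (real \<Rightarrow> 'x)"
  phase :: "'a set"
  flow :: "real \<Rightarrow> (real \<Rightarrow> 'x) \<Rightarrow> 'a option \<Rightarrow> 'a option"

definition cadlag_paths :: "(real \<Rightarrow> 'e::real_normed_vector) set" where
  "cadlag_paths =
     {\<omega> \<in> extensional {0..}. (\<forall>t\<ge>0. (\<omega> \<longlongrightarrow> \<omega> t) (at_right t)) \<and>
                              (\<forall>t>0. \<exists>l. (\<omega> \<longlongrightarrow> l) (at_left t))}"

definition C0_paths :: "(real \<Rightarrow> 'e::real_normed_vector) set" where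
  "C0_paths = {\<omega> \<in> extensional {0..}. continuous_on {0..} \<omega> \<and> \<omega> 0 = 0}"

definition discrete_noise :: "('x::polish_space, 'a) rds \<Rightarrow> bool" where
  "discrete_noise S \<longleftrightarrow> time S = \<nat> \<and> paths S = extensional \<nat>"

definition continuous_noise :: "('e::euclidean_space, 'a) rds \<Rightarrow> bool" where
  "continuous_noise S \<longleftrightarrow> time S = {0..} \<and> (paths S = cadlag_paths \<or> paths S = C0_paths)"

definition coordinate_algebra :: "(real \<Rightarrow> 'x::topological_space) set \<Rightarrow> real set \<Rightarrow> (real \<Rightarrow> 'x) measure" where
  "coordinate_algebra \<Omega> I = sigma \<Omega> {(\<lambda>\<omega>. \<omega> s) -` B \<inter> \<Omega> | s B. s \<in> I \<and> B \<in> sets borel}"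

definition full_algebra :: "('x::topological_space, 'a) rds \<Rightarrow> (real \<Rightarrow> 'x) measure" where
  "full_algebra S = coordinate_algebra (paths S) (time S)"

definition past_algebra :: "('x::topological_space, 'a) rds \<Rightarrow> real \<Rightarrow> (real \<Rightarrow> 'x) measure" where
  "past_algebra S t = coordinate_algebra (paths S) {s \<in> time S. s \<le> t}"

definition phase_borel :: "('x, 'a::topological_space) rds \<Rightarrow> 'a measure" where
  "phase_borel S = restrict_space borel (phase S)"

definition ext_phase :: "('x, 'a) rds \<Rightarrow> 'a option set" where
  "ext_phase S = insert None (Some ` phase S)"

text \<open>The generators are the open sets of the disjoint-union topology, in which \<open>None\<close> is isolated.\<close>

definition ext_borel :: "('x, 'a::topological_space) rds \<Rightarrow> 'a option measure" where
  "ext_borel S =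
     sigma (ext_phase S) {W. W \<subseteq> ext_phase S \<and> openin (top_of_set (phase S)) {x. Some x \<in> W}}"

definition absorption_time :: "('x, 'a) rds \<Rightarrow> (real \<Rightarrow> 'x) \<Rightarrow> 'a option \<Rightarrow> ereal" where
  "absorption_time S \<omega> x = (INF t\<in>{t \<in> time S. flow S t \<omega> x = None}. ereal t)"

locale absorbed_rds =
  fixes d :: nat and S :: "('x::topological_space, 'a::euclidean_space) rds"
  assumes phase_manifold: "embedded_manifold d (phase S)"
    and sets_noise: "sets (noise S) = sets (full_algebra S)"
    and prob_noise: "prob_space (noise S)"
    and shift_measurable:
      "(\<lambda>(\<omega>, t). shift S t \<omega>) \<in>
         full_algebra S \<Otimes>\<^sub>M restrict_space borel (time S) \<rightarrow>\<^sub>M full_algebra S"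
    and shift_zero: "\<And>\<omega>. \<omega> \<in> paths S \<Longrightarrow> shift S 0 \<omega> = \<omega>"
    and shift_add:
      "\<And>s t \<omega>. \<lbrakk>s \<in> time S; t \<in> time S; \<omega> \<in> paths S\<rbrakk> \<Longrightarrow> shift S (s + t) \<omega> = shift S s (shift S t \<omega>)"
    and shift_preserving: "\<And>t. t \<in> time S \<Longrightarrow> distr (noise S) (full_algebra S) (shift S t) = noise S"
    and shift_adapted:
      "\<And>s t A. \<lbrakk>s \<in> time S; t \<in> time S; A \<in> sets (past_algebra S s)\<rbrakk>
         \<Longrightarrow> shift S t -` A \<inter> paths S \<in> sets (past_algebra S (s + t))"
    and memoryless:
      "\<And>s t. \<lbrakk>s \<in> time S; t \<in> time S\<rbrakk> \<Longrightarrow>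
         prob_space.indep_set (noise S) (sets (past_algebra S s))
           {shift S s -` A \<inter> paths S | A. A \<in> sets (past_algebra S t)}"
    and flow_measurable:
      "(\<lambda>(t, \<omega>, x). flow S t \<omega> x) \<in>
         restrict_space borel (time S) \<Otimes>\<^sub>M (full_algebra S \<Otimes>\<^sub>M ext_borel S) \<rightarrow>\<^sub>M ext_borel S"
    and flow_adapted:
      "\<And>t. t \<in> time S \<Longrightarrow>
         (\<lambda>(\<omega>, x). flow S t \<omega> x) \<in> past_algebra S t \<Otimes>\<^sub>M ext_borel S \<rightarrow>\<^sub>M ext_borel S"
    and flow_zero: "\<And>\<omega> x. \<lbrakk>\<omega> \<in> paths S; x \<in> ext_phase S\<rbrakk> \<Longrightarrow> flow S 0 \<omega> x = x"
    and cocycle: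
      "\<And>s t \<omega> x. \<lbrakk>s \<in> time S; t \<in> time S; \<omega> \<in> paths S; x \<in> ext_phase S\<rbrakk> \<Longrightarrow>
         flow S (t + s) \<omega> x = flow S t (shift S s \<omega>) (flow S s \<omega> x)"
    and absorbing:
      "\<And>s t \<omega> x. \<lbrakk>s \<in> time S; t \<in> time S; s \<le> t; \<omega> \<in> paths S; x \<in> ext_phase S; flow S s \<omega> x = None\<rbrakk>
         \<Longrightarrow> flow S t \<omega> x = None"
    \<comment> \<open>Automatic in discrete time. In continuous time it says that the infimum defining the
        absorption time is attained, which does not follow from the other axioms.\<close>
    and survival:
      "\<And>t \<omega> x. \<lbrakk>t \<in> time S; \<omega> \<in> paths S; x \<in> ext_phase S\<rbrakk> \<Longrightarrow>
         ereal t < absorption_time S \<omega> x \<longleftrightarrow> flow S t \<omega> x \<in> Some ` phase S"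
    and flow_C1:
      "\<And>t \<omega>. \<lbrakk>t \<in> time S; \<omega> \<in> paths S\<rbrakk> \<Longrightarrow>
         C1_map_on (\<lambda>x. the (flow S t \<omega> (Some x)))
           {x \<in> phase S. ereal t < absorption_time S \<omega> (Some x)}"


subsection \<open>Quasi-stationary behaviour\<close>

definition time_at_top :: "('x, 'a) rds \<Rightarrow> real filter" where
  "time_at_top S = inf at_top (principal (time S))"

definition start_law :: "('x, 'a::topological_space) rds \<Rightarrow> 'a \<Rightarrow> ((real \<Rightarrow> 'x) \<times> 'a) measure" where
  "start_law S x = noise S \<Otimes>\<^sub>M return (phase_borel S) x"

text \<open>The law \<open>N\<close> on paths and starting points, conditioned on survival beyond time \<open>t\<close>.\<close>

definition survival_law ::
    "('x, 'a) rds \<Rightarrow> ((real \<Rightarrow> 'x) \<times> 'a) measure \<Rightarrow> real \<Rightarrow> ((real \<Rightarrow> 'x) \<times> 'a) measure" where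
  "survival_law S N t =
     uniform_measure N {(\<omega>, x) \<in> paths S \<times> phase S. ereal t < absorption_time S \<omega> (Some x)}"

definition position_event :: "('x, 'a) rds \<Rightarrow> real \<Rightarrow> 'a set \<Rightarrow> ((real \<Rightarrow> 'x) \<times> 'a) set" where
  "position_event S t A = {(\<omega>, x) \<in> paths S \<times> phase S. flow S t \<omega> (Some x) \<in> Some ` A}"

definition quasi_stationary :: "('x, 'a::topological_space) rds \<Rightarrow> 'a measure \<Rightarrow> bool" where
  "quasi_stationary S \<mu> \<longleftrightarrow>
     prob_space \<mu> \<and> sets \<mu> = sets (phase_borel S) \<and>
     (\<forall>t\<in>time S. \<forall>A\<in>sets (phase_borel S).
        measure (survival_law S (\<mu> \<bind> start_law S) t) (position_event S t A) = measure \<mu> A)"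

text \<open>Total variation distance of two probability measures, given as set functions on a
  \<open>\<sigma>\<close>-algebra \<open>\<A>\<close>. The other common normalisation is twice this one.\<close>

definition tv_dist :: "'b set set \<Rightarrow> ('b set \<Rightarrow> real) \<Rightarrow> ('b set \<Rightarrow> real) \<Rightarrow> real" where
  "tv_dist \<A> p q = (SUP A\<in>\<A>. \<bar>p A - q A\<bar>)"

definition hypothesis_H :: "('x, 'a::topological_space) rds \<Rightarrow> bool" where
  "hypothesis_H S \<longleftrightarrow>
     (\<exists>\<mu>. (\<forall>\<mu>'. quasi_stationary S \<mu>' \<longleftrightarrow> \<mu>' = \<mu>) \<and>
       (\<exists>\<alpha>>0. \<forall>x\<in>phase S. \<exists>C::real. \<forall>t\<in>time S.
          tv_dist (sets (phase_borel S))
            (\<lambda>A. measure (survival_law S (start_law S x) t) (position_event S t A)) (measure \<mu>)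
          \<le> C * exp (- \<alpha> * t))) \<and>
     (\<exists>\<eta> :: 'a \<Rightarrow> real. \<exists>\<beta>>0. (\<forall>x\<in>phase S. 0 < \<eta> x) \<and> bounded (\<eta> ` phase S) \<and>
       ((\<lambda>t. SUP x\<in>phase S. \<bar>exp (\<beta> * t) * measure (start_law S x)
            {(\<omega>, y) \<in> paths S \<times> phase S. ereal t < absorption_time S \<omega> (Some y)} - \<eta> x\<bar>)
        \<longlongrightarrow> 0) (time_at_top S))"

text \<open>\<open>f\<close> is extended by \<open>0\<close> to the cemetery; this value is irrelevant on survival beyond \<open>t\<close>.\<close>

definition time_average ::
    "('x, 'a) rds \<Rightarrow> ('a \<Rightarrow> real) \<Rightarrow> real \<Rightarrow> (real \<Rightarrow> 'x) \<times> 'a \<Rightarrow> real" where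
  "time_average S f t = (\<lambda>(\<omega>, x).
     (if time S = \<nat> then (\<Sum>s\<in>{s\<in>\<nat>. s < t}. case_option 0 f (flow S s \<omega> (Some x)))
      else (LINT s:{0..t}|lborel. case_option 0 f (flow S s \<omega> (Some x)))) / t)"

definition quasi_ergodic :: "('x, 'a::topological_space) rds \<Rightarrow> 'a measure \<Rightarrow> bool" where
  "quasi_ergodic S \<nu> \<longleftrightarrow>
     prob_space \<nu> \<and> sets \<nu> = sets (phase_borel S) \<and>
     (\<forall>x\<in>phase S. \<forall>f\<in>borel_measurable (phase_borel S). bounded (f ` phase S) \<longrightarrow>
        ((\<lambda>t. LINT z|survival_law S (start_law S x) t. time_average S f t z)
         \<longlongrightarrow> (LINT y|\<nu>. f y)) (time_at_top S))"

text \<open>This property determines \<open>Q\<close> uniquely, the algebras \<open>past_algebra S s\<close> generating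
  \<open>full_algebra S\<close>.\<close>

definition Q_measure ::
    "('x::topological_space, 'a::topological_space) rds \<Rightarrow> 'a \<Rightarrow> ((real \<Rightarrow> 'x) \<times> 'a) measure \<Rightarrow> bool" where
  "Q_measure S x Q \<longleftrightarrow>
     prob_space Q \<and> sets Q = sets (full_algebra S \<Otimes>\<^sub>M phase_borel S) \<and>
     (\<forall>s\<in>time S. \<forall>A\<in>sets (past_algebra S s \<Otimes>\<^sub>M phase_borel S).
        ((\<lambda>t. measure (survival_law S (start_law S x) t) A) \<longlongrightarrow> measure Q A) (time_at_top S))"


subsection \<open>Invariance, ergodicity and mixing of the skew product\<close>

definition skew_product ::
    "('x, 'a) rds \<Rightarrow> real \<Rightarrow> (real \<Rightarrow> 'x) \<times> 'a option \<Rightarrow> (real \<Rightarrow> 'x) \<times> 'a option" where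
  "skew_product S t = (\<lambda>(\<omega>, x). (shift S t \<omega>, flow S t \<omega> x))"

text \<open>The skew product may leave \<open>\<Omega> \<times> M\<close> through the cemetery. The preimage of a subset of \<open>\<Omega> \<times> M\<close>
  is again a subset of \<open>\<Omega> \<times> M\<close>, where \<open>\<Omega> \<times> M\<close> sits in \<open>\<Omega> \<times> E\<^sub>M\<close> via \<open>map_prod id Some\<close>.\<close>

definition skew_preimage ::
    "('x, 'a) rds \<Rightarrow> real \<Rightarrow> ((real \<Rightarrow> 'x) \<times> 'a) set \<Rightarrow> ((real \<Rightarrow> 'x) \<times> 'a) set" where
  "skew_preimage S t A =
     {z \<in> paths S \<times> phase S. skew_product S t (map_prod id Some z) \<in> map_prod id Some ` A}"

definition skew_invariant :: "('x, 'a) rds \<Rightarrow> ((real \<Rightarrow> 'x) \<times> 'a) measure \<Rightarrow> bool" where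
  "skew_invariant S Q \<longleftrightarrow>
     (\<forall>t\<in>time S. \<forall>A\<in>sets Q.
        skew_preimage S t A \<in> sets Q \<and> emeasure Q (skew_preimage S t A) = emeasure Q A)"

text \<open>Invariance of a set is meant modulo \<open>Q\<close>-null sets, the skew product being defined only
  almost everywhere on \<open>\<Omega> \<times> M\<close>.\<close>

definition skew_ergodic :: "('x, 'a) rds \<Rightarrow> ((real \<Rightarrow> 'x) \<times> 'a) measure \<Rightarrow> bool" where
  "skew_ergodic S Q \<longleftrightarrow>
     (\<forall>A\<in>sets Q. (\<forall>t\<in>time S. emeasure Q (sym_diff (skew_preimage S t A) A) = 0)
        \<longrightarrow> measure Q A = 0 \<or> measure Q A = 1)"

definition skew_strongly_mixing :: "('x, 'a) rds \<Rightarrow> ((real \<Rightarrow> 'x) \<times> 'a) measure \<Rightarrow> bool" where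
  "skew_strongly_mixing S Q \<longleftrightarrow>
     (\<forall>A\<^sub>1\<in>sets Q. \<forall>A\<^sub>2\<in>sets Q.
        ((\<lambda>t. measure Q (A\<^sub>1 \<inter> skew_preimage S t A\<^sub>2)) \<longlongrightarrow> measure Q A\<^sub>1 * measure Q A\<^sub>2)
        (time_at_top S))"

end

theory Submission
  imports Defs
begin

text \<open>
Let \<open>P\<^sub>t f (x)\<close> be the expectation of \<open>f\<close> at the position at time \<open>t\<close>, started from \<open>x\<close> and restricted to
survival. By the Markov property, a consequence of memorylessness (\<open>markov_property\<close>), these operators form a
semigroup. The hypothesis says that \<open>exp (\<beta> * t) * P\<^sub>t 1\<close> tends to \<open>\<eta>\<close> uniformly and that the conditioned
laws tend to \<open>\<mu>\<close>. Consequently \<open>exp (\<beta> * t) * P\<^sub>t f\<close> tends pointwise to \<open>\<eta>\<close> times the \<open>\<mu>\<close>-integral of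
\<open>f\<close> (\<open>transition_tendsto\<close>), \<open>\<eta>\<close> is fixed by the rescaled semigroup (\<open>eta_eigenfunction\<close>) and \<open>\<mu>\<close> by its dual
(\<open>mu_eigenmeasure\<close>).

The measures \<open>Q\<^sub>x\<close> are the Doob transform of the process by \<open>\<eta>\<close>: on events up to time \<open>s\<close> they have the density
\<open>exp (\<beta> * s) * \<eta> (\<phi>\<^sub>s) / \<eta> x\<close> on survival (\<open>Q_formula\<close>). Under \<open>Q\<^sub>x\<close> the position is therefore a Markov process
with transition operators \<open>f \<mapsto> exp (\<beta> * t) * P\<^sub>t (\<eta> f) / \<eta>\<close>. These preserve the probability measure \<open>\<eta> \<mu>\<close> and
converge to the integral against it, pointwise on bounded functions.

The measure \<open>\<eta> \<mu>\<close> is the given quasi-ergodic distribution (\<open>quasi_ergodic_eq\<close>): a time average conditioned on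
survival beyond \<open>t\<close> is, up to boundary layers at both ends, an average over times \<open>s\<close> with \<open>s\<close> and \<open>t - s\<close> large,
and at such times the conditioned position has approximately the law \<open>\<eta> \<mu>\<close>.

An event \<open>B\<close> shifted by \<open>t\<close> has, given the past up to \<open>t\<close>, the \<open>Q\<close>-probability \<open>Q\<^sub>y B\<close> with \<open>y\<close> the position at
time \<open>t\<close> (\<open>Q_markov\<close>). Invariance of the averaged \<open>Q\<close>-measure is thus invariance of \<open>\<eta> \<mu>\<close>, and mixing with an event of
the past is the convergence of the transition operators applied to \<open>y \<mapsto> Q\<^sub>y B\<close> (\<open>mixing_past_events\<close>). A Dynkin argument
(\<open>dominated_setwise_limit\<close>) extends mixing to all events, and ergodicity follows, since an invariant event has a
probability equal to its own square.
\<close>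

section \<open>Setwise limits of measures\<close>

text \<open>Mixing is checked on a generator and carried over to the \<open>\<sigma>\<close>-algebra by Dynkin's argument. The only
point beyond complements and finite unions is that limits in \<open>t\<close> need not commute with countable
unions; domination by the fixed measure \<open>M\<close> makes the tails of a disjoint union small uniformly
in \<open>t\<close>. This is why finite additivity is the right condition on the set functions \<open>n t\<close>.\<close>

lemma dominated_setwise_limit:
  fixes n :: "'i \<Rightarrow> 'b set \<Rightarrow> real" and c :: real
  assumes M: "finite_measure M" "sets M = sigma_sets \<Omega> E" "Int_stable E" "E \<subseteq> Pow \<Omega>" "\<Omega> \<in> E"
    and additive: "\<forall>\<^sub>F t in F. \<forall>A\<in>sets M. \<forall>B\<in>sets M. A \<inter> B = {} \<longrightarrow> n t (A \<union> B) = n t A + n t B"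
    and dominated: "\<forall>\<^sub>F t in F. \<forall>A\<in>sets M. 0 \<le> n t A \<and> n t A \<le> measure M A"
    and generator: "\<And>A. A \<in> E \<Longrightarrow> ((\<lambda>t. n t A) \<longlongrightarrow> c * measure M A) F"
    and A: "A \<in> sets M"
  shows "((\<lambda>t. n t A) \<longlongrightarrow> c * measure M A) F"
proof -
  interpret finite_measure M by fact
  have sp: "space M = \<Omega>"
    using M(2,4) by (metis sets.sets_into_space sets.top sigma_sets_into_sp sigma_sets_top subset_antisym)
  have empty: "\<forall>\<^sub>F t in F. n t {} = 0"
    using dominated by eventually_elim (auto dest: bspec[of _ _ "{}"])
  from A have "A \<in> sigma_sets \<Omega> E" using M by simp
  from M(3,4) this show ?thesis
  proof (induction rule: sigma_sets_induct_disjoint)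
    case (basic A)
    then show ?case by (rule generator)
  next
    case empty
    show ?case
      using tendsto_cong[THEN iffD2, OF \<open>\<forall>\<^sub>F t in F. n t {} = 0\<close> tendsto_const] by simp
  next
    case (compl A)
    then have A: "A \<in> sets M" using M(2) by simp
    have "\<forall>\<^sub>F t in F. n t (\<Omega> - A) = n t \<Omega> - n t A"
      using additive
    proof eventually_elim
      case (elim t)
      have "\<Omega> \<in> sets M" using sp by auto
      then have "n t (A \<union> (\<Omega> - A)) = n t A + n t (\<Omega> - A)"
        using A by (intro elim[rule_format]) auto
      moreover have "A \<union> (\<Omega> - A) = \<Omega>" using A sets.sets_into_space[OF A] sp by auto
      ultimately show ?case by simp
    qed
    moreover have "((\<lambda>t. n t \<Omega> - n t A) \<longlongrightarrow> c * measure M \<Omega> - c * measure M A) F"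
      by (intro tendsto_diff generator compl M)
    moreover have "c * measure M (\<Omega> - A) = c * measure M \<Omega> - c * measure M A"
      using finite_measure_compl[OF A] sp by (simp add: right_diff_distrib)
    ultimately show ?case using tendsto_cong by fastforce
  next
    case (union A)
    have A: "A i \<in> sets M" for i using union(2) M(2) by auto
    have sums: "(\<lambda>i. measure M (A i)) sums measure M (\<Union>i. A i)"
      using A union(1) by (intro finite_measure_UNION) auto
    \<comment> \<open>the mass of the tail \<open>tl k\<close>, a bound for \<open>n t (tl k)\<close> that does not depend on \<open>t\<close>\<close>
    define R where "R k = measure M (\<Union>i. A i) - (\<Sum>i<k. measure M (A i))" for k
    have R0: "R \<longlonglongrightarrow> 0"
      unfolding R_def using tendsto_diff[OF tendsto_const sums[unfolded sums_def], of "measure M (\<Union>i. A i)"] by simp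
    have dis: "A i \<inter> A j = {}" if "i \<noteq> j" for i j using union(1) that by (auto simp: disjoint_family_on_def)
    have mfin: "measure M (\<Union>i<k. A i) = (\<Sum>i<k. measure M (A i))" for k
      using A dis by (intro finite_measure_finite_Union) (auto simp: disjoint_family_on_def)
    define tl where "tl k = (\<Union>i. A i) - (\<Union>i<k. A i)" for k
    have tl[measurable]: "tl k \<in> sets M" for k unfolding tl_def using A by auto
    have mtl: "measure M (tl k) = R k" for k
      unfolding tl_def R_def using A mfin[of k] by (subst finite_measure_Diff) auto
    have split: "\<forall>\<^sub>F t in F. n t (\<Union>i. A i) = (\<Sum>i<k. n t (A i)) + n t (tl k)" for k
      using additive empty
    proof eventually_elim
      case (elim t)
      have fin: "n t (\<Union>i<k. A i) = (\<Sum>i<k. n t (A i))" for k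
      proof (induction k)
        case 0 then show ?case using elim by simp
      next
        case (Suc k)
        have "n t ((\<Union>i<k. A i) \<union> A k) = n t (\<Union>i<k. A i) + n t (A k)"
          using A dis by (intro elim(1)[rule_format]) (auto, metis IntI empty_iff nat_neq_iff)
        moreover have "(\<Union>i<Suc k. A i) = (\<Union>i<k. A i) \<union> A k" by (auto simp: less_Suc_eq)
        ultimately show ?case using Suc by simp
      qed
      have "n t ((\<Union>i<k. A i) \<union> tl k) = n t (\<Union>i<k. A i) + n t (tl k)"
        using A tl by (intro elim(1)[rule_format]) (auto simp: tl_def)
      moreover have "(\<Union>i<k. A i) \<union> tl k = (\<Union>i. A i)" by (auto simp: tl_def)
      ultimately show ?case using fin by simp
    qed
    have "((\<lambda>t. n t (\<Union>i. A i)) \<longlongrightarrow> c * measure M (\<Union>i. A i)) F"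
    proof (rule tendstoI)
      fix e :: real assume e: "0 < e"
      have "(\<lambda>k. (1 + \<bar>c\<bar>) * R k) \<longlonglongrightarrow> (1 + \<bar>c\<bar>) * 0" by (intro tendsto_mult R0 tendsto_const)
      then have "\<forall>\<^sub>F k in sequentially. (1 + \<bar>c\<bar>) * R k < e / 2"
        using e by (intro order_tendstoD(2)[where a = "e/2" and y = "(1 + \<bar>c\<bar>) * 0"]) auto
      then obtain k where k: "(1 + \<bar>c\<bar>) * R k < e / 2" by (auto simp: eventually_sequentially)
      have "((\<lambda>t. \<Sum>i<k. n t (A i)) \<longlongrightarrow> (\<Sum>i<k. c * measure M (A i))) F"
        by (intro tendsto_sum union)
      then have "\<forall>\<^sub>F t in F. dist (\<Sum>i<k. n t (A i)) (\<Sum>i<k. c * measure M (A i)) < e / 2"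
        using e by (intro tendstoD) auto
      then show "\<forall>\<^sub>F t in F. dist (n t (\<Union>i. A i)) (c * measure M (\<Union>i. A i)) < e"
        using split[of k] dominated
      proof eventually_elim
        case (elim t)
        have n: "0 \<le> n t (tl k)" "n t (tl k) \<le> R k"
          using elim(3)[rule_format, OF tl[of k]] unfolding mtl by auto
        have cm: "c * measure M (\<Union>i. A i) = (\<Sum>i<k. c * measure M (A i)) + c * R k"
          by (simp add: R_def sum_distrib_left algebra_simps)
        have "\<bar>c * R k\<bar> = \<bar>c\<bar> * R k" using n by (simp add: abs_mult)
        moreover have "(1 + \<bar>c\<bar>) * R k = R k + \<bar>c\<bar> * R k" by (simp add: distrib_right)
        ultimately show ?case using elim(1) n k unfolding dist_real_def cm elim(2) by linarith
      qed
    qed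
    then show ?case .
  qed
qed

text \<open>A function with values in \<open>{0..K}\<close> is a uniform limit of step functions, and for a step function the
convergence is that of finitely many measures of sets.\<close>

lemma integral_tendsto_of_setwise:
  fixes f :: "'b \<Rightarrow> real" and p :: "'i \<Rightarrow> 'b measure"
  assumes p: "\<forall>\<^sub>F t in F. prob_space (p t) \<and> sets (p t) = sets q" and q: "prob_space q"
    and setwise: "\<And>A. A \<in> sets q \<Longrightarrow> ((\<lambda>t. measure (p t) A) \<longlongrightarrow> measure q A) F"
    and f: "f \<in> borel_measurable q" "\<And>x. x \<in> space q \<Longrightarrow> 0 \<le> f x" "\<And>x. x \<in> space q \<Longrightarrow> f x \<le> K"
  shows "((\<lambda>t. LINT x|p t. f x) \<longlongrightarrow> (LINT x|q. f x)) F"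
proof (rule tendstoI)
  fix e :: real assume e: "0 < e"
  obtain n :: nat where n: "n > 0" "1 / real n < e / 3"
    using real_arch_invD[of "e/3"] e by (auto simp: inverse_eq_divide)
  define N where "N = nat \<lceil>real n * K\<rceil>"
  define L where "L k = {x\<in>space q. real k \<le> real n * f x}" for k :: nat
  have L: "L k \<in> sets q" for k unfolding L_def using f(1) by measurable
  \<comment> \<open>\<open>g\<close> is \<open>f\<close> rounded down to a multiple of \<open>1 / n\<close>\<close>
  define g where "g x = (\<Sum>k=1..N. indicator (L k) x) / real n" for x
  have g: "g x \<le> f x \<and> f x \<le> g x + 1 / real n" if x: "x \<in> space q" for x
  proof -
    define j where "j = nat \<lfloor>real n * f x\<rfloor>"
    have nn: "0 \<le> real n * f x" using f(2)[OF x] by simp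
    then have jr: "real j \<le> real n * f x" "real n * f x < real j + 1" unfolding j_def by linarith+
    have "real n * f x \<le> real n * K" using f(3)[OF x] by (intro mult_left_mono) auto
    then have "real n * f x \<le> real N" unfolding N_def by linarith
    then have jN: "j \<le> N" using jr by linarith
    have iff: "(real k \<le> real n * f x) = (k \<le> j)" for k :: nat using jr by linarith
    have "(\<Sum>k=1..N. indicator (L k) x :: real) = (\<Sum>k=1..N. if k \<in> {1..j} then 1 else 0)"
      by (intro sum.cong) (auto simp: L_def x iff indicator_def)
    also have "\<dots> = real j" using jN by (subst sum.inter_restrict[symmetric]) (auto simp: min_def)
    finally have "g x = real j / real n" by (simp add: g_def)
    then have "real n * g x = real j" using n(1) by simp
    then have "real n * g x \<le> real n * f x" "real n * f x \<le> real n * (g x + 1 / real n)"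
      using jr n(1) by (auto simp: distrib_left)
    then show ?thesis using n(1) by simp
  qed
  have int: "\<bar>(LINT x|r. f x) - (\<Sum>k=1..N. measure r (L k)) / real n\<bar> \<le> 1 / real n"
    if r: "prob_space r" "sets r = sets q" for r
  proof -
    interpret r: prob_space r by fact
    have sp: "space r = space q" using r sets_eq_imp_space_eq by blast
    have L': "L k \<in> sets r" for k using L r by simp
    have fr: "f \<in> borel_measurable r" using f(1) measurable_cong_sets[OF r(2) refl] by blast
    have intf: "integrable r f"
      using f sp by (intro r.integrable_const_bound[OF _ fr, of K]) auto
    have intg: "integrable r g" unfolding g_def using L'
      by (intro integrable_divide Bochner_Integration.integrable_sum)
        (auto intro!: integrable_real_indicator simp: less_top[symmetric])
    have "(LINT x|r. g x) = (\<Sum>k=1..N. measure r (L k)) / real n"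
      unfolding g_def using L' by (subst integral_divide_zero, subst Bochner_Integration.integral_sum)
        (auto intro!: integrable_real_indicator simp: less_top[symmetric])
    moreover have "(LINT x|r. g x) \<le> (LINT x|r. f x)"
      using g sp by (intro integral_mono intf intg) auto
    moreover have "(LINT x|r. f x) \<le> (LINT x|r. g x + 1 / real n)"
      using g sp by (intro integral_mono intf intg Bochner_Integration.integrable_add) auto
    moreover have "(LINT x|r. g x + 1 / real n) = (LINT x|r. g x) + 1 / real n"
      using intg by (subst Bochner_Integration.integral_add) (auto simp: r.prob_space)
    ultimately show ?thesis by linarith
  qed
  have "((\<lambda>t. (\<Sum>k=1..N. measure (p t) (L k)) / real n) \<longlongrightarrow> (\<Sum>k=1..N. measure q (L k)) / real n) F"
    using n(1) by (intro tendsto_divide tendsto_sum setwise L tendsto_const) auto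
  then have "\<forall>\<^sub>F t in F. dist ((\<Sum>k=1..N. measure (p t) (L k)) / real n) ((\<Sum>k=1..N. measure q (L k)) / real n) < e / 3"
    using e by (intro tendstoD) auto
  then show "\<forall>\<^sub>F t in F. dist (LINT x|p t. f x) (LINT x|q. f x) < e"
    using p
  proof eventually_elim
    case (elim t)
    have "\<bar>(LINT x|p t. f x) - (\<Sum>k=1..N. measure (p t) (L k)) / real n\<bar> \<le> 1 / real n"
      using elim(2) by (intro int) auto
    then show ?case using int[OF q refl] elim(1) n(2) unfolding dist_real_def by linarith
  qed
qed

section \<open>Time, noise and the extended phase space\<close>

text \<open>Discrete and continuous time are treated together, through the properties shared by the two time sets:
they are closed under sums and nonnegative differences, and unbounded.\<close>

locale timed_rds = absorbed_rds d S
  for d and S :: "('x::topological_space, 'a::euclidean_space) rds" +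
  assumes time_cases: "time S = \<nat> \<or> time S = {0..}"
begin

abbreviation "T \<equiv> time S"
abbreviation "\<Omega> \<equiv> paths S"
abbreviation "M \<equiv> phase S"
abbreviation "P \<equiv> noise S"
abbreviation "\<F> \<equiv> full_algebra S"
abbreviation "\<P> t \<equiv> past_algebra S t"
abbreviation "\<B> \<equiv> phase_borel S"
abbreviation "\<E> \<equiv> ext_borel S"
abbreviation "\<phi> \<equiv> flow S"
abbreviation "\<theta> \<equiv> shift S"

lemma time_nonneg: "t \<in> T \<Longrightarrow> 0 \<le> t"
proof -
  assume t: "t \<in> T"
  from time_cases show ?thesis
  proof
    assume "T = \<nat>"
    with t obtain n where "t = real n" by (metis Nats_cases)
    then show ?thesis by simp
  next
    assume "T = {0..}"
    with t show ?thesis by simp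
  qed
qed

lemma time_zero: "0 \<in> T"
  using time_cases by (elim disjE) simp_all

lemma time_add: "s \<in> T \<Longrightarrow> t \<in> T \<Longrightarrow> s + t \<in> T"
  using time_cases by (elim disjE) simp_all

lemma time_diff: "s \<in> T \<Longrightarrow> t \<in> T \<Longrightarrow> s \<le> t \<Longrightarrow> t - s \<in> T"
proof -
  assume st: "s \<in> T" "t \<in> T" "s \<le> t"
  from time_cases show ?thesis
  proof
    assume T: "T = \<nat>"
    with st obtain m n where "s = real m" "t = real n" by (metis Nats_cases)
    then have "t - s = real (n - m)" using st(3) by (simp add: of_nat_diff)
    then show ?thesis unfolding T by simp
  next
    assume "T = {0..}"
    with st show ?thesis by simp
  qed
qed

lemma time_of_nat: "real n \<in> T"
  using time_cases by (elim disjE) simp_all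

lemma eventually_time_at_top:
  "eventually R (time_at_top S) \<longleftrightarrow> (\<exists>t0. \<forall>t\<in>T. t0 \<le> t \<longrightarrow> R t)"
  by (auto simp: time_at_top_def eventually_inf_principal eventually_at_top_linorder)

lemma eventually_in_time: "\<forall>\<^sub>F t in time_at_top S. t \<in> T"
  unfolding eventually_time_at_top by auto

lemma time_at_top_neq_bot: "time_at_top S \<noteq> bot"
proof
  assume "time_at_top S = bot"
  then have "\<forall>\<^sub>F t in time_at_top S. False" by simp
  then obtain t0 where t0: "t \<in> T \<Longrightarrow> t0 \<le> t \<Longrightarrow> False" for t by (auto simp: eventually_time_at_top)
  show False using t0[OF time_of_nat, of "nat \<lceil>t0\<rceil>"] by linarith
qed

lemma filterlim_real_time: "filterlim real (time_at_top S) sequentially"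
  unfolding time_at_top_def filterlim_inf filterlim_principal
  using time_of_nat filterlim_real_sequentially by auto

lemma filterlim_time_shift: "s \<in> T \<Longrightarrow> filterlim (\<lambda>t. t + s) (time_at_top S) (time_at_top S)"
  unfolding filterlim_iff
proof safe
  fix R assume s: "s \<in> T" and "eventually R (time_at_top S)"
  then obtain t0 where t0: "\<And>t. t \<in> T \<Longrightarrow> t0 \<le> t \<Longrightarrow> R t" by (auto simp: eventually_time_at_top)
  show "\<forall>\<^sub>F t in time_at_top S. R (t + s)"
    unfolding eventually_time_at_top
    using t0 time_add[OF _ s] time_nonneg[OF s] by (intro exI[of _ t0]) (auto simp: add_increasing2)
qed

lemma tendsto_time_shiftD:
  assumes s: "s \<in> T" and "((\<lambda>t. f (t + s)) \<longlongrightarrow> l) (time_at_top S)"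
  shows "(f \<longlongrightarrow> l) (time_at_top S)"
  unfolding filterlim_iff
proof safe
  fix R assume "eventually R (nhds l)"
  then have "\<forall>\<^sub>F t in time_at_top S. R (f (t + s))"
    using assms(2) by (auto simp: filterlim_iff)
  then obtain t0 where t0: "\<And>t. t \<in> T \<Longrightarrow> t0 \<le> t \<Longrightarrow> R (f (t + s))" by (auto simp: eventually_time_at_top)
  show "\<forall>\<^sub>F t in time_at_top S. R (f t)"
    unfolding eventually_time_at_top
  proof (intro exI[of _ "max (t0 + s) s"] ballI impI)
    fix t assume "t \<in> T" "max (t0 + s) s \<le> t"
    then show "R (f t)" using t0[OF time_diff[OF s]] by auto
  qed
qed

text \<open>The filter of large times has a countable basis. This makes the dominated convergence theorem,
which is about sequences, available for limits in time.\<close>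

lemma tendsto_time_sequentially:
  fixes f :: "real \<Rightarrow> real"
  assumes "\<And>u. (\<And>n. u n \<in> T) \<Longrightarrow> filterlim u (time_at_top S) sequentially \<Longrightarrow> (\<lambda>n. f (u n)) \<longlonglongrightarrow> l"
  shows "(f \<longlongrightarrow> l) (time_at_top S)"
proof (rule ccontr)
  assume "\<not> ?thesis"
  then obtain R where R: "eventually R (nhds l)" "\<not> (\<forall>\<^sub>F t in time_at_top S. R (f t))"
    by (auto simp: filterlim_iff)
  then have "\<exists>t. t \<in> T \<and> real n \<le> t \<and> \<not> R (f t)" for n
    by (auto simp: eventually_time_at_top)
  then obtain u where u: "\<And>n. u n \<in> T \<and> real n \<le> u n \<and> \<not> R (f (u n))" by metis
  have "filterlim u (time_at_top S) sequentially"
    unfolding time_at_top_def filterlim_inf filterlim_principal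
    using u by (auto intro: filterlim_at_top_mono[OF filterlim_real_sequentially])
  with assms u have "(\<lambda>n. f (u n)) \<longlonglongrightarrow> l" by blast
  then have "\<forall>\<^sub>F n in sequentially. R (f (u n))" using R(1) by (auto simp: filterlim_iff)
  then show False using u by (auto simp: eventually_sequentially)
qed

lemma tendsto_integral_dominated_time:
  fixes f :: "real \<Rightarrow> 'b \<Rightarrow> real"
  assumes N: "prob_space N" and f: "\<And>t. t \<in> T \<Longrightarrow> f t \<in> borel_measurable N"
    and g: "g \<in> borel_measurable N"
    and lim: "\<And>z. z \<in> space N \<Longrightarrow> ((\<lambda>t. f t z) \<longlongrightarrow> g z) (time_at_top S)"
    and bound: "\<And>t z. t \<in> T \<Longrightarrow> z \<in> space N \<Longrightarrow> \<bar>f t z\<bar> \<le> B"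
  shows "((\<lambda>t. LINT z|N. f t z) \<longlongrightarrow> (LINT z|N. g z)) (time_at_top S)"
proof (rule tendsto_time_sequentially)
  interpret prob_space N by fact
  fix u assume u: "\<And>n. u n \<in> T" "filterlim u (time_at_top S) sequentially"
  show "(\<lambda>n. LINT z|N. f (u n) z) \<longlonglongrightarrow> (LINT z|N. g z)"
  proof (rule integral_dominated_convergence[where w = "\<lambda>_. B"])
    show "AE z in N. (\<lambda>n. f (u n) z) \<longlonglongrightarrow> g z"
      using lim by (intro AE_I2) (rule filterlim_compose[OF _ u(2)])
    show "AE z in N. norm (f (u n) z) \<le> B" for n using bound u by (intro AE_I2) auto
  qed (use f g u in auto)
qed

lemma sets_coordinate_algebra:
  "sets (coordinate_algebra \<Omega> I) = sigma_sets \<Omega> {(\<lambda>\<omega>. \<omega> s) -` B \<inter> \<Omega> | s B. s \<in> I \<and> B \<in> sets borel}"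
  unfolding coordinate_algebra_def by (rule sets_measure_of) auto

lemma space_coordinate_algebra[simp]: "space (coordinate_algebra \<Omega> I) = \<Omega>"
  unfolding coordinate_algebra_def by (rule space_measure_of) auto

lemma space_full[simp]: "space \<F> = \<Omega>" and space_past[simp]: "space (\<P> t) = \<Omega>"
  by (simp_all add: full_algebra_def past_algebra_def)

lemma sets_coordinate_mono: "I \<subseteq> J \<Longrightarrow> sets (coordinate_algebra \<Omega> I) \<subseteq> sets (coordinate_algebra \<Omega> J)"
  unfolding sets_coordinate_algebra by (intro sigma_sets_mono') auto

lemma past_mono: "s \<le> t \<Longrightarrow> sets (\<P> s) \<subseteq> sets (\<P> t)"
  unfolding past_algebra_def by (intro sets_coordinate_mono) auto

lemma past_le_full: "sets (\<P> s) \<subseteq> sets \<F>"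
  unfolding past_algebra_def full_algebra_def by (intro sets_coordinate_mono) auto

lemma space_noise[simp]: "space P = \<Omega>"
  using sets_eq_imp_space_eq[OF sets_noise] by simp

lemma space_phase[simp]: "space \<B> = M"
  by (simp add: phase_borel_def space_restrict_space)

lemma sets_ext:
  "sets \<E> = sigma_sets (ext_phase S) {W. W \<subseteq> ext_phase S \<and> openin (top_of_set M) {x. Some x \<in> W}}"
  unfolding ext_borel_def by (rule sets_measure_of) auto

lemma space_ext[simp]: "space \<E> = ext_phase S"
  unfolding ext_borel_def by (rule space_measure_of) auto

lemma None_in_ext[simp]: "None \<in> ext_phase S" and Some_in_ext[simp]: "Some x \<in> ext_phase S \<longleftrightarrow> x \<in> M"
  by (auto simp: ext_phase_def)

lemma measurable_past_full: "f \<in> \<P> s \<rightarrow>\<^sub>M N \<Longrightarrow> f \<in> \<F> \<rightarrow>\<^sub>M N"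
  using past_le_full[of s] by (auto simp: measurable_def)

lemma measurable_noise: "f \<in> P \<rightarrow>\<^sub>M N \<longleftrightarrow> f \<in> \<F> \<rightarrow>\<^sub>M N"
  using measurable_cong_sets[OF sets_noise refl] by blast

lemma id_noise_past: "(\<lambda>\<omega>. \<omega>) \<in> P \<rightarrow>\<^sub>M \<P> t"
  unfolding measurable_noise using past_le_full[of t] by (auto simp: measurable_def)

lemma id_past_past: "s \<le> t \<Longrightarrow> (\<lambda>\<omega>. \<omega>) \<in> \<P> t \<rightarrow>\<^sub>M \<P> s"
  using past_mono[of s t] by (auto simp: measurable_def)

lemma singleton_None_sets: "{None} \<in> sets \<E>"
  unfolding sets_ext by (intro sigma_sets.Basic) (auto simp: ext_phase_def)

lemma Some_measurable[measurable]: "Some \<in> \<B> \<rightarrow>\<^sub>M \<E>"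
  unfolding ext_borel_def
proof (rule measurable_measure_of)
  fix W assume "W \<in> {W. W \<subseteq> ext_phase S \<and> openin (top_of_set M) {x. Some x \<in> W}}"
  then have W: "W \<subseteq> ext_phase S" "openin (top_of_set M) {x. Some x \<in> W}" by auto
  then obtain U where U: "open U" "{x. Some x \<in> W} = M \<inter> U" by (auto simp: openin_open)
  have "Some -` W \<inter> space \<B> = M \<inter> U" using U W(1) by auto
  then show "Some -` W \<inter> space \<B> \<in> sets \<B>"
    using U(1) by (auto simp: phase_borel_def sets_restrict_space)
qed (auto)

text \<open>A measurable left inverse of \<open>Some\<close>. The value \<open>x0\<close> at the cemetery is arbitrary, but it must be a point
of the phase space for the map to take values there.\<close>

definition retract :: "'a \<Rightarrow> 'a option \<Rightarrow> 'a" where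
  "retract x0 y = (case y of None \<Rightarrow> x0 | Some x \<Rightarrow> x)"

lemma retract_measurable:
  assumes x0: "x0 \<in> M" shows "retract x0 \<in> \<E> \<rightarrow>\<^sub>M \<B>"
  unfolding phase_borel_def
proof (rule measurable_restrict_space2)
  show "retract x0 \<in> space \<E> \<rightarrow> M"
    using x0 by (auto simp: retract_def ext_phase_def)
  show "retract x0 \<in> \<E> \<rightarrow>\<^sub>M borel"
  proof (rule borel_measurableI)
    fix U :: "'a set" assume "open U"
    then have "retract x0 -` U \<inter> ext_phase S \<in> {W. W \<subseteq> ext_phase S \<and> openin (top_of_set M) {x. Some x \<in> W}}"
      by (auto simp: retract_def openin_open)
    then show "retract x0 -` U \<inter> space \<E> \<in> sets \<E>"
      unfolding sets_ext space_ext by (rule sigma_sets.Basic)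
  qed
qed

text \<open>Extending functions by \<open>0\<close> to the cemetery turns absorption into the condition that functions vanish
at \<open>None\<close>. Integrals over surviving paths then become integrals over all paths, and the semigroup and
Markov properties hold without restriction to the event of survival.\<close>

lemma ext_measurable_lift:
  fixes f :: "'b \<Rightarrow> 'a \<Rightarrow> real"
  assumes f: "(\<lambda>(\<omega>, x). f \<omega> x) \<in> borel_measurable (N \<Otimes>\<^sub>M \<B>)"
  shows "(\<lambda>(\<omega>, y). case_option 0 (f \<omega>) y) \<in> borel_measurable (N \<Otimes>\<^sub>M \<E>)"
proof (cases "M = {}")
  case True
  then have "(\<lambda>(\<omega>, y). case_option 0 (f \<omega>) y) \<in> borel_measurable (N \<Otimes>\<^sub>M \<E>) \<longleftrightarrow>
    (\<lambda>_. 0 :: real) \<in> borel_measurable (N \<Otimes>\<^sub>M \<E>)"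
    by (intro measurable_cong) (auto simp: space_pair_measure ext_phase_def)
  then show ?thesis by simp
next
  case False
  then obtain x0 where "x0 \<in> M" by auto
  note [measurable] = retract_measurable[OF this] singleton_None_sets f
  have "(\<lambda>z. (case (fst z, retract x0 (snd z)) of (\<omega>, x) \<Rightarrow> f \<omega> x)) \<in> borel_measurable (N \<Otimes>\<^sub>M \<E>)"
    by (rule measurable_compose[OF _ f]) measurable
  then have [measurable]: "(\<lambda>z. f (fst z) (retract x0 (snd z))) \<in> borel_measurable (N \<Otimes>\<^sub>M \<E>)" by simp
  have "(\<lambda>z. if snd z \<in> {None} then 0 else f (fst z) (retract x0 (snd z))) \<in> borel_measurable (N \<Otimes>\<^sub>M \<E>)"
    by measurable
  also have "(\<lambda>z. if snd z \<in> {None} then 0 else f (fst z) (retract x0 (snd z))) = (\<lambda>(\<omega>, y). case_option 0 (f \<omega>) y)"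
    by (auto simp: fun_eq_iff retract_def split: option.splits)
  finally show ?thesis .
qed

lemma ext_measurable_lift1:
  fixes f :: "'a \<Rightarrow> real"
  assumes f: "f \<in> borel_measurable \<B>"
  shows "case_option 0 f \<in> borel_measurable \<E>"
proof -
  have "(\<lambda>(\<omega>::unit, y). case_option 0 f y) \<in> borel_measurable (count_space UNIV \<Otimes>\<^sub>M \<E>)"
    using f by (intro ext_measurable_lift) simp
  from measurable_compose[OF measurable_Pair1'[of "()"] this] show ?thesis by simp
qed

lemma flow_measurable_past:
  assumes "t \<in> T" shows "(\<lambda>(\<omega>, y). \<phi> t \<omega> y) \<in> \<P> t \<Otimes>\<^sub>M \<E> \<rightarrow>\<^sub>M \<E>"
  using flow_adapted[OF assms] .

lemma flow_in_ext: "t \<in> T \<Longrightarrow> \<omega> \<in> \<Omega> \<Longrightarrow> y \<in> ext_phase S \<Longrightarrow> \<phi> t \<omega> y \<in> ext_phase S"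
  using measurable_space[OF flow_measurable_past, of t "(\<omega>, y)"] by (auto simp: space_pair_measure)

lemma flow_measurable_at:
  assumes "t \<in> T" "y \<in> ext_phase S" shows "(\<lambda>\<omega>. \<phi> t \<omega> y) \<in> \<P> t \<rightarrow>\<^sub>M \<E>"
  using measurable_compose[OF measurable_Pair2'[of y \<E> "\<P> t"] flow_measurable_past[OF assms(1)]] assms(2)
  by simp

lemma flow_None: "t \<in> T \<Longrightarrow> \<omega> \<in> \<Omega> \<Longrightarrow> \<phi> t \<omega> None = None"
  using absorbing[OF time_zero, of t \<omega> None] flow_zero[of \<omega> None] time_nonneg by auto

lemma shift_in_paths:
  assumes "t \<in> T" "\<omega> \<in> \<Omega>" shows "\<theta> t \<omega> \<in> \<Omega>"
  using measurable_space[OF shift_measurable, of "(\<omega>, t)"] assms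
  by (auto simp: space_pair_measure space_restrict_space)

lemma shift_measurable_full:
  assumes "t \<in> T" shows "\<theta> t \<in> \<F> \<rightarrow>\<^sub>M \<F>"
  using measurable_compose[OF measurable_Pair2'[of t "restrict_space borel T" \<F>] shift_measurable] assms
  by (simp add: space_restrict_space)

lemma shift_measurable_past:
  assumes "s \<in> T" "t \<in> T" shows "\<theta> t \<in> \<P> (s + t) \<rightarrow>\<^sub>M \<P> s"
  using shift_adapted[OF assms] shift_in_paths assms by (auto simp: measurable_def)

section \<open>The Markov property\<close>

sublocale noise: prob_space P
  by (rule prob_noise)

lemma prob_paths[simp]: "measure P \<Omega> = 1"
  using noise.prob_space by simp

text \<open>This is memorylessness in the form in which it is used: the past up to \<open>t\<close> and the noise shifted by
\<open>t\<close> are two independent random variables with values in path spaces.\<close>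

lemma joint_law_past_shifted:
  assumes s: "s \<in> T" and t: "t \<in> T"
  shows "distr P (\<P> t) (\<lambda>\<omega>. \<omega>) \<Otimes>\<^sub>M distr P (\<P> s) (\<theta> t) = distr P (\<P> t \<Otimes>\<^sub>M \<P> s) (\<lambda>\<omega>. (\<omega>, \<theta> t \<omega>))"
proof -
  have sh: "\<theta> t \<in> P \<rightarrow>\<^sub>M \<P> s"
    unfolding measurable_noise
    using shift_measurable_full[OF t] past_le_full[of s] by (auto simp: measurable_def)
  have 1: "{(\<lambda>\<omega>. \<omega>) -` A \<inter> space P |A. A \<in> sets (\<P> t)} = sets (\<P> t)"
    using sets.sets_into_space[of _ "\<P> t"] by (auto simp: Int_absorb2)
  have 2: "{\<theta> t -` A \<inter> space P |A. A \<in> sets (\<P> s)} = {\<theta> t -` A \<inter> \<Omega> |A. A \<in> sets (\<P> s)}" by simp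
  have stable: "Int_stable {\<theta> t -` A \<inter> \<Omega> |A. A \<in> sets (\<P> s)}"
  proof (rule Int_stableI, safe)
    fix A B assume "A \<in> sets (\<P> s)" "B \<in> sets (\<P> s)"
    then show "\<exists>C. \<theta> t -` A \<inter> \<Omega> \<inter> (\<theta> t -` B \<inter> \<Omega>) = \<theta> t -` C \<inter> \<Omega> \<and> C \<in> sets (\<P> s)"
      by (intro exI[of _ "A \<inter> B"]) auto
  qed
  have "noise.indep_set (sigma_sets (space P) (sets (\<P> t))) (sigma_sets (space P) {\<theta> t -` A \<inter> \<Omega> |A. A \<in> sets (\<P> s)})"
    using memoryless[OF t s] by (intro noise.indep_set_sigma_sets stable sets.Int_stable)
  then have "noise.indep_var (\<P> t) (\<lambda>\<omega>. \<omega>) (\<P> s) (\<theta> t)"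
    unfolding noise.indep_var_eq 1 2 using id_noise_past sh by auto
  then show ?thesis
    using noise.indep_var_distribution_eq by blast
qed

text \<open>The shifted path may be replaced by an independent copy, because the shift also preserves the law of
the noise.\<close>

lemma freezing:
  fixes Z :: "(real \<Rightarrow> 'x) \<times> (real \<Rightarrow> 'x) \<Rightarrow> real" and K :: real
  assumes s: "s \<in> T" and t: "t \<in> T"
    and Z: "Z \<in> borel_measurable (\<P> t \<Otimes>\<^sub>M \<P> s)"
    and bound: "\<And>\<omega> \<omega>'. \<omega> \<in> \<Omega> \<Longrightarrow> \<omega>' \<in> \<Omega> \<Longrightarrow> \<bar>Z (\<omega>, \<omega>')\<bar> \<le> K"
  shows "(LINT \<omega>|P. Z (\<omega>, \<theta> t \<omega>)) = (LINT \<omega>|P. LINT \<omega>'|P. Z (\<omega>, \<omega>'))"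
proof -
  have sh: "\<theta> t \<in> P \<rightarrow>\<^sub>M \<P> s"
    unfolding measurable_noise
    using shift_measurable_full[OF t] past_le_full[of s] by (auto simp: measurable_def)
  let ?N = "distr P (\<P> t) (\<lambda>\<omega>. \<omega>)" and ?N' = "distr P (\<P> s) (\<theta> t)"
  interpret N: prob_space ?N by (rule noise.prob_space_distr) (rule id_noise_past)
  interpret N': prob_space ?N' by (rule noise.prob_space_distr) (rule sh)
  interpret pair_prob_space ?N ?N' ..
  have Z': "Z \<in> borel_measurable (?N \<Otimes>\<^sub>M ?N')" using Z by simp
  have int: "integrable (?N \<Otimes>\<^sub>M ?N') Z"
    using bound by (intro integrable_const_bound[of _ K] Z') (auto simp: space_pair_measure)
  have pair: "(\<lambda>\<omega>. (\<omega>, \<theta> t \<omega>)) \<in> P \<rightarrow>\<^sub>M \<P> t \<Otimes>\<^sub>M \<P> s"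
    using id_noise_past sh by (intro measurable_Pair)
  have "(LINT \<omega>|P. Z (\<omega>, \<theta> t \<omega>)) = (LINT z|distr P (\<P> t \<Otimes>\<^sub>M \<P> s) (\<lambda>\<omega>. (\<omega>, \<theta> t \<omega>)). Z z)"
    by (rule integral_distr[OF pair Z, symmetric])
  also have "\<dots> = (LINT z|(?N \<Otimes>\<^sub>M ?N'). Z z)"
    by (simp only: joint_law_past_shifted[OF s t])
  also have "\<dots> = (LINT \<omega>|?N. LINT \<omega>'|?N'. Z (\<omega>, \<omega>'))"
    by (rule integral_fst'[OF int, symmetric])
  also have "\<dots> = (LINT \<omega>|P. LINT \<omega>'|?N'. Z (\<omega>, \<omega>'))"
  proof (rule integral_distr[OF id_noise_past])
    show "(\<lambda>\<omega>. LINT \<omega>'|?N'. Z (\<omega>, \<omega>')) \<in> borel_measurable (\<P> t)"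
      using N'.borel_measurable_lebesgue_integral[of "\<lambda>\<omega> \<omega>'. Z (\<omega>, \<omega>')" "\<P> t"] Z by simp
  qed
  also have "\<dots> = (LINT \<omega>|P. LINT \<omega>'|P. Z (\<omega>, \<omega>'))"
  proof (rule Bochner_Integration.integral_cong[OF refl])
    fix \<omega> assume "\<omega> \<in> space P"
    then have z: "(\<lambda>\<omega>'. Z (\<omega>, \<omega>')) \<in> borel_measurable (\<P> s)"
      using measurable_compose[OF measurable_Pair1'[of \<omega> "\<P> t" "\<P> s"] Z] by simp
    then have zf: "(\<lambda>\<omega>'. Z (\<omega>, \<omega>')) \<in> borel_measurable \<F>" by (rule measurable_past_full)
    have "(LINT \<omega>'|?N'. Z (\<omega>, \<omega>')) = (LINT \<omega>'|P. Z (\<omega>, \<theta> t \<omega>'))"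
      by (rule integral_distr[OF sh z])
    also have "\<dots> = (LINT \<omega>'|distr P \<F> (\<theta> t). Z (\<omega>, \<omega>'))"
      using shift_measurable_full[OF t]
      by (intro integral_distr[symmetric] zf) (simp add: measurable_noise)
    finally show "(LINT \<omega>'|?N'. Z (\<omega>, \<omega>')) = (LINT \<omega>'|P. Z (\<omega>, \<omega>'))"
      by (simp only: shift_preserving[OF t])
  qed
  finally show ?thesis .
qed

text \<open>By the cocycle property the system after time \<open>t\<close> is a function of the shifted noise and of the position
at time \<open>t\<close>, and the latter depends on the past only. Hence the future can be integrated out first, with
that position frozen.\<close>

lemma markov_property:
  fixes a :: "(real \<Rightarrow> 'x) \<Rightarrow> real" and Y :: "(real \<Rightarrow> 'x) \<Rightarrow> 'a option \<Rightarrow> real"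
    and K L :: real
  assumes s: "s \<in> T" and t: "t \<in> T" and y: "y \<in> ext_phase S"
    and a: "a \<in> borel_measurable (\<P> t)" "\<And>\<omega>. \<omega> \<in> \<Omega> \<Longrightarrow> \<bar>a \<omega>\<bar> \<le> K"
    and Y: "(\<lambda>(\<omega>, z). Y \<omega> z) \<in> borel_measurable (\<P> s \<Otimes>\<^sub>M \<E>)"
      "\<And>\<omega> z. \<omega> \<in> \<Omega> \<Longrightarrow> z \<in> ext_phase S \<Longrightarrow> \<bar>Y \<omega> z\<bar> \<le> L"
  shows "(LINT \<omega>|P. a \<omega> * Y (\<theta> t \<omega>) (\<phi> t \<omega> y)) = (LINT \<omega>|P. a \<omega> * (LINT \<omega>'|P. Y \<omega>' (\<phi> t \<omega> y)))"
proof -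
  note [measurable] = a(1) flow_measurable_at[OF t y]
  have [measurable]: "(\<lambda>z. Y (snd z) (\<phi> t (fst z) y)) \<in> borel_measurable (\<P> t \<Otimes>\<^sub>M \<P> s)"
    by (rule measurable_compose[OF _ Y(1), of "\<lambda>z. (snd z, \<phi> t (fst z) y)", simplified]) measurable
  have "(LINT \<omega>|P. (\<lambda>z. a (fst z) * Y (snd z) (\<phi> t (fst z) y)) (\<omega>, \<theta> t \<omega>)) =
    (LINT \<omega>|P. LINT \<omega>'|P. (\<lambda>z. a (fst z) * Y (snd z) (\<phi> t (fst z) y)) (\<omega>, \<omega>'))"
  proof (rule freezing[OF s t, where K = "K * L"])
    fix \<omega> \<omega>' assume "\<omega> \<in> \<Omega>" "\<omega>' \<in> \<Omega>"
    then show "\<bar>(\<lambda>z. a (fst z) * Y (snd z) (\<phi> t (fst z) y)) (\<omega>, \<omega>')\<bar> \<le> K * L"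
      using a(2)[of \<omega>] Y(2)[of \<omega>' "\<phi> t \<omega> y"] flow_in_ext[OF t _ y]
      by (auto simp: abs_mult intro!: mult_mono order_trans[OF abs_ge_zero])
  qed measurable
  then show ?thesis by simp
qed

text \<open>The semigroup of the absorbed process. On functions that vanish at \<open>None\<close> it is the sub-Markov
semigroup of the process killed at absorption.\<close>

definition transition :: "real \<Rightarrow> ('a option \<Rightarrow> real) \<Rightarrow> 'a option \<Rightarrow> real" where
  "transition t g y = (LINT \<omega>|P. g (\<phi> t \<omega> y))"

lemma noise_integral_measurable:
  fixes f :: "(real \<Rightarrow> 'x) \<Rightarrow> 'b \<Rightarrow> real"
  assumes "(\<lambda>(\<omega>, z). f \<omega> z) \<in> borel_measurable (\<P> t \<Otimes>\<^sub>M N)"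
  shows "(\<lambda>z. LINT \<omega>|P. f \<omega> z) \<in> borel_measurable N"
proof -
  have sub: "sets (\<P> t \<Otimes>\<^sub>M N) \<subseteq> sets (P \<Otimes>\<^sub>M N)"
    unfolding sets_pair_measure space_past space_noise sets_noise using past_le_full[of t]
    by (intro sigma_sets_mono') auto
  have "(\<lambda>(\<omega>, z). f \<omega> z) \<in> borel_measurable (P \<Otimes>\<^sub>M N)"
    using assms sub by (auto simp: measurable_def space_pair_measure)
  then have [measurable]: "(\<lambda>p. f (fst p) (snd p)) \<in> borel_measurable (P \<Otimes>\<^sub>M N)" by (simp add: case_prod_beta')
  have "(\<lambda>(z, \<omega>). f \<omega> z) \<in> borel_measurable (N \<Otimes>\<^sub>M P)"
    using measurable_compose[OF measurable_pair_swap' \<open>(\<lambda>(\<omega>, z). f \<omega> z) \<in> borel_measurable (P \<Otimes>\<^sub>M N)\<close>]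
    by (simp add: case_prod_beta')
  then show ?thesis
    using noise.borel_measurable_lebesgue_integral[of "\<lambda>z \<omega>. f \<omega> z" N] by (simp add: case_prod_beta')
qed

lemma flow_compose_measurable:
  fixes g :: "'a option \<Rightarrow> real"
  assumes t: "t \<in> T" and g: "g \<in> borel_measurable \<E>"
  shows "(\<lambda>(\<omega>, y). g (\<phi> t \<omega> y)) \<in> borel_measurable (\<P> t \<Otimes>\<^sub>M \<E>)"
  using measurable_compose[OF flow_measurable_past[OF t] g] by (simp add: case_prod_beta')

lemma transition_measurable:
  assumes t: "t \<in> T" and g: "g \<in> borel_measurable \<E>"
  shows "transition t g \<in> borel_measurable \<E>"
  unfolding transition_def
  by (rule noise_integral_measurable[OF flow_compose_measurable[OF assms]])

lemma transition_None: "t \<in> T \<Longrightarrow> g None = 0 \<Longrightarrow> transition t g None = 0"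
  unfolding transition_def
  by (subst Bochner_Integration.integral_cong[OF refl, of _ _ "\<lambda>_. 0"]) (auto simp: flow_None)

lemma integrable_flow:
  fixes a :: "(real \<Rightarrow> 'x) \<Rightarrow> real" and g :: "'a option \<Rightarrow> real" and K L :: real
  assumes t: "t \<in> T" and y: "y \<in> ext_phase S" and a: "a \<in> borel_measurable \<F>" "\<And>\<omega>. \<omega> \<in> \<Omega> \<Longrightarrow> \<bar>a \<omega>\<bar> \<le> K"
    and g: "g \<in> borel_measurable \<E>" "\<And>z. z \<in> ext_phase S \<Longrightarrow> \<bar>g z\<bar> \<le> L"
  shows "integrable P (\<lambda>\<omega>. a \<omega> * g (\<phi> t \<omega> y))"
proof (rule noise.integrable_const_bound[where B = "K * L"])
  show "AE \<omega> in P. norm (a \<omega> * g (\<phi> t \<omega> y)) \<le> K * L"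
    using a(2) g(2)[OF flow_in_ext[OF t _ y]]
    by (intro AE_I2) (auto simp: abs_mult intro!: mult_mono order_trans[OF abs_ge_zero])
  have "(\<lambda>\<omega>. g (\<phi> t \<omega> y)) \<in> borel_measurable \<F>"
    by (rule measurable_past_full) (rule measurable_compose[OF flow_measurable_at[OF t y] g(1)])
  then show "(\<lambda>\<omega>. a \<omega> * g (\<phi> t \<omega> y)) \<in> borel_measurable P"
    using a(1) unfolding measurable_noise by measurable
qed

lemma integrable_flow1:
  fixes g :: "'a option \<Rightarrow> real" and L :: real
  assumes t: "t \<in> T" and y: "y \<in> ext_phase S"
    and g: "g \<in> borel_measurable \<E>" "\<And>z. z \<in> ext_phase S \<Longrightarrow> \<bar>g z\<bar> \<le> L"
  shows "integrable P (\<lambda>\<omega>. g (\<phi> t \<omega> y))"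
  using integrable_flow[OF t y, of "\<lambda>_. 1" 1 g L] g by simp

lemma transition_mono:
  fixes g h :: "'a option \<Rightarrow> real" and K L :: real
  assumes t: "t \<in> T" and y: "y \<in> ext_phase S"
    and g: "g \<in> borel_measurable \<E>" "\<And>z. z \<in> ext_phase S \<Longrightarrow> \<bar>g z\<bar> \<le> K"
    and h: "h \<in> borel_measurable \<E>" "\<And>z. z \<in> ext_phase S \<Longrightarrow> \<bar>h z\<bar> \<le> L"
    and le: "\<And>z. z \<in> ext_phase S \<Longrightarrow> g z \<le> h z"
  shows "transition t g y \<le> transition t h y"
  unfolding transition_def
  using integrable_flow1[OF t y] g h le flow_in_ext[OF t _ y]
  by (intro integral_mono) auto

lemma transition_abs_le:
  fixes g :: "'a option \<Rightarrow> real" and K :: real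
  assumes t: "t \<in> T" and y: "y \<in> ext_phase S"
    and g: "g \<in> borel_measurable \<E>" "\<And>z. z \<in> ext_phase S \<Longrightarrow> \<bar>g z\<bar> \<le> K"
  shows "\<bar>transition t g y\<bar> \<le> K"
proof -
  have i: "integrable P (\<lambda>\<omega>. g (\<phi> t \<omega> y))"
    using integrable_flow1[OF t y] g by auto
  have "\<bar>transition t g y\<bar> \<le> (LINT \<omega>|P. \<bar>g (\<phi> t \<omega> y)\<bar>)"
    unfolding transition_def by (rule integral_abs_bound)
  also have "\<dots> \<le> (LINT \<omega>|P. K)"
    using i g(2) flow_in_ext[OF t _ y] by (intro integral_mono integrable_abs) auto
  finally show ?thesis by simp
qed

text \<open>The special case of the Markov property in which the future enters through a position only; the weight
\<open>a\<close> will be the indicator of an event in the past.\<close>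

lemma weighted_markov:
  fixes a :: "(real \<Rightarrow> 'x) \<Rightarrow> real" and g :: "'a option \<Rightarrow> real" and K L :: real
  assumes s: "s \<in> T" and t: "t \<in> T" and y: "y \<in> ext_phase S"
    and a: "a \<in> borel_measurable (\<P> t)" "\<And>\<omega>. \<omega> \<in> \<Omega> \<Longrightarrow> \<bar>a \<omega>\<bar> \<le> K"
    and g: "g \<in> borel_measurable \<E>" "\<And>z. z \<in> ext_phase S \<Longrightarrow> \<bar>g z\<bar> \<le> L"
  shows "(LINT \<omega>|P. a \<omega> * g (\<phi> (s + t) \<omega> y)) = (LINT \<omega>|P. a \<omega> * transition s g (\<phi> t \<omega> y))"
proof -
  have "(LINT \<omega>|P. a \<omega> * g (\<phi> (s + t) \<omega> y)) = (LINT \<omega>|P. a \<omega> * g (\<phi> s (\<theta> t \<omega>) (\<phi> t \<omega> y)))"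
    by (intro Bochner_Integration.integral_cong refl) (simp add: cocycle[OF t s _ y])
  also have "\<dots> = (LINT \<omega>|P. a \<omega> * transition s g (\<phi> t \<omega> y))"
    unfolding transition_def
    using g(2) flow_in_ext[OF s]
    by (intro markov_property[OF s t y a flow_compose_measurable[OF s g(1)], where L = L]) auto
  finally show ?thesis .
qed

lemma transition_add:
  fixes g :: "'a option \<Rightarrow> real" and L :: real
  assumes s: "s \<in> T" and t: "t \<in> T" and y: "y \<in> ext_phase S"
    and g: "g \<in> borel_measurable \<E>" "\<And>z. z \<in> ext_phase S \<Longrightarrow> \<bar>g z\<bar> \<le> L"
  shows "transition (s + t) g y = transition t (transition s g) y"
  using weighted_markov[OF s t y _ _ g, of "\<lambda>_. 1" 1] by (simp add: transition_def)

section \<open>Laws conditioned on survival\<close>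

abbreviation lift :: "('a \<Rightarrow> real) \<Rightarrow> 'a option \<Rightarrow> real" where
  "lift f \<equiv> case_option 0 f"

definition alive :: "'a option \<Rightarrow> real" where
  "alive = lift (\<lambda>_. 1)"

lemma alive_simps[simp]: "alive None = 0" "alive (Some x) = 1"
  by (simp_all add: alive_def)

lemma alive_eq_1_iff: "alive y = 1 \<longleftrightarrow> y \<noteq> None"
  by (cases y) auto

lemma alive_measurable[measurable]: "alive \<in> borel_measurable \<E>"
  unfolding alive_def by (rule ext_measurable_lift1) simp

lemma alive_bound: "\<bar>alive y\<bar> \<le> 1" "0 \<le> alive y" "alive y \<le> 1"
  by (cases y; simp)+

lemma pair_past_le_full: "sets (\<P> t \<Otimes>\<^sub>M N) \<subseteq> sets (\<F> \<Otimes>\<^sub>M N)"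
  unfolding sets_pair_measure space_past space_full using past_le_full[of t]
  by (intro sigma_sets_mono') auto

lemma measurable_pair_past_full: "f \<in> \<P> t \<Otimes>\<^sub>M N \<rightarrow>\<^sub>M K \<Longrightarrow> f \<in> \<F> \<Otimes>\<^sub>M N \<rightarrow>\<^sub>M K"
  using pair_past_le_full[of t N] by (auto simp: measurable_def space_pair_measure)

lemma flow_Some_measurable:
  assumes "t \<in> T" shows "(\<lambda>(\<omega>, x). \<phi> t \<omega> (Some x)) \<in> \<P> t \<Otimes>\<^sub>M \<B> \<rightarrow>\<^sub>M \<E>"
  using measurable_compose[OF _ flow_measurable_past[OF assms], of "\<lambda>z. (fst z, Some (snd z))"]
  by (simp add: case_prod_beta')

lemma section_measurable:
  assumes x: "x \<in> M" shows "(\<lambda>\<omega>. (\<omega>, x)) \<in> P \<rightarrow>\<^sub>M \<F> \<Otimes>\<^sub>M \<B>"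
  unfolding measurable_noise using measurable_Pair2'[of x \<B> \<F>] x by simp

text \<open>The starting point being deterministic, everything can be computed on the path space alone, with \<open>x\<close> as
a parameter.\<close>

lemma start_law_eq:
  assumes x: "x \<in> M"
  shows "start_law S x = distr P (\<F> \<Otimes>\<^sub>M \<B>) (\<lambda>\<omega>. (\<omega>, x))"
proof (rule measure_eqI)
  have sets: "sets (start_law S x) = sets (\<F> \<Otimes>\<^sub>M \<B>)"
    unfolding start_law_def by (intro sets_pair_measure_cong sets_noise) simp
  show "sets (start_law S x) = sets (distr P (\<F> \<Otimes>\<^sub>M \<B>) (\<lambda>\<omega>. (\<omega>, x)))" using sets by simp
  fix A assume "A \<in> sets (start_law S x)"
  then have A: "A \<in> sets (\<F> \<Otimes>\<^sub>M \<B>)" using sets by simp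
  interpret R: prob_space "return \<B> x" by (rule prob_space_return) (use x in simp)
  have "emeasure (start_law S x) A = (\<integral>\<^sup>+\<omega>. emeasure (return \<B> x) (Pair \<omega> -` A) \<partial>P)"
    using A unfolding sets[symmetric] unfolding start_law_def by (rule R.emeasure_pair_measure_alt)
  also have "\<dots> = (\<integral>\<^sup>+\<omega>. indicator ((\<lambda>\<omega>. (\<omega>, x)) -` A \<inter> space P) \<omega> \<partial>P)"
    by (intro nn_integral_cong) (simp add: sets_Pair1[OF A] indicator_def)
  also have "\<dots> = emeasure (distr P (\<F> \<Otimes>\<^sub>M \<B>) (\<lambda>\<omega>. (\<omega>, x))) A"
    unfolding emeasure_distr[OF section_measurable[OF x] A]
    by (rule nn_integral_indicator[OF measurable_sets[OF section_measurable[OF x] A]])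
  finally show "emeasure (start_law S x) A = emeasure (distr P (\<F> \<Otimes>\<^sub>M \<B>) (\<lambda>\<omega>. (\<omega>, x))) A" .
qed

definition survival_event :: "real \<Rightarrow> ((real \<Rightarrow> 'x) \<times> 'a) set" where
  "survival_event t = {(\<omega>, x) \<in> \<Omega> \<times> M. ereal t < absorption_time S \<omega> (Some x)}"

lemma survival_event_iff:
  assumes "t \<in> T" "\<omega> \<in> \<Omega>" "x \<in> M"
  shows "(\<omega>, x) \<in> survival_event t \<longleftrightarrow> \<phi> t \<omega> (Some x) \<noteq> None"
  using survival[of t \<omega> "Some x"] flow_in_ext[of t \<omega> "Some x"] assms
  by (auto simp: survival_event_def ext_phase_def)

lemma indicator_survival_event:
  assumes "t \<in> T" "\<omega> \<in> \<Omega>" "x \<in> M"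
  shows "indicator (survival_event t) (\<omega>, x) = alive (\<phi> t \<omega> (Some x))"
  using survival_event_iff[OF assms] by (cases "\<phi> t \<omega> (Some x)") auto

lemma survival_event_sets:
  assumes t: "t \<in> T" shows "survival_event t \<in> sets (\<P> t \<Otimes>\<^sub>M \<B>)"
proof -
  note [measurable] = flow_Some_measurable[OF t]
  have "{z \<in> space (\<P> t \<Otimes>\<^sub>M \<B>). alive (case z of (\<omega>, x) \<Rightarrow> \<phi> t \<omega> (Some x)) = 1} \<in> sets (\<P> t \<Otimes>\<^sub>M \<B>)"
    by measurable
  also have "{z \<in> space (\<P> t \<Otimes>\<^sub>M \<B>). alive (case z of (\<omega>, x) \<Rightarrow> \<phi> t \<omega> (Some x)) = 1} = survival_event t"
    using survival_event_iff[OF t]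
    by (auto simp: space_pair_measure survival_event_def alive_eq_1_iff)
  finally show ?thesis .
qed

lemma measure_survival_event:
  assumes t: "t \<in> T" and x: "x \<in> M"
  shows "measure (start_law S x) (survival_event t) = transition t alive (Some x)"
proof -
  have D: "survival_event t \<in> sets (\<F> \<Otimes>\<^sub>M \<B>)" using survival_event_sets[OF t] pair_past_le_full by blast
  interpret L: prob_space "start_law S x"
    unfolding start_law_eq[OF x] by (rule noise.prob_space_distr[OF section_measurable[OF x]])
  have "measure (start_law S x) (survival_event t) = (LINT z|start_law S x. indicator (survival_event t) z)"
    using D by (simp add: start_law_eq[OF x])
  also have "\<dots> = (LINT \<omega>|P. indicator (survival_event t) (\<omega>, x))"
    unfolding start_law_eq[OF x]
    by (rule integral_distr[OF section_measurable[OF x]]) (use D in measurable)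
  also have "\<dots> = transition t alive (Some x)"
    unfolding transition_def
    by (intro Bochner_Integration.integral_cong refl) (simp add: indicator_survival_event[OF t _ x])
  finally show ?thesis .
qed

lemma prob_space_start_law: "x \<in> M \<Longrightarrow> prob_space (start_law S x)"
  using noise.prob_space_distr[OF section_measurable] start_law_eq by simp

lemma survival_law_eq:
  "survival_law S (start_law S x) t = uniform_measure (start_law S x) (survival_event t)"
  by (simp add: survival_law_def survival_event_def)

lemma sets_survival_law: "x \<in> M \<Longrightarrow> sets (survival_law S (start_law S x) t) = sets (\<F> \<Otimes>\<^sub>M \<B>)"
  unfolding survival_law_eq by (simp add: start_law_eq)

lemma prob_space_survival_law:
  assumes t: "t \<in> T" and x: "x \<in> M" and pos: "0 < transition t alive (Some x)"
  shows "prob_space (survival_law S (start_law S x) t)"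
proof -
  interpret L: prob_space "start_law S x" by (rule prob_space_start_law[OF x])
  show ?thesis unfolding survival_law_eq
    using pos measure_survival_event[OF t x]
    by (intro prob_space_uniform_measure) (auto simp: L.emeasure_eq_measure)
qed

lemma integral_survival_law:
  fixes f :: "(real \<Rightarrow> 'x) \<times> 'a \<Rightarrow> real"
  assumes t: "t \<in> T" and x: "x \<in> M" and pos: "0 < transition t alive (Some x)"
    and f: "f \<in> borel_measurable (\<F> \<Otimes>\<^sub>M \<B>)"
  shows "(LINT z|survival_law S (start_law S x) t. f z) =
    (LINT \<omega>|P. f (\<omega>, x) * alive (\<phi> t \<omega> (Some x))) / transition t alive (Some x)"
proof -
  let ?D = "survival_event t" and ?c = "transition t alive (Some x)"
  interpret L: prob_space "start_law S x" by (rule prob_space_start_law[OF x])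
  have D: "?D \<in> sets (\<F> \<Otimes>\<^sub>M \<B>)" using survival_event_sets[OF t] pair_past_le_full by blast
  have setsL: "sets (start_law S x) = sets (\<F> \<Otimes>\<^sub>M \<B>)" by (simp add: start_law_eq[OF x])
  have fL: "f \<in> borel_measurable (start_law S x)" using f measurable_cong_sets[OF setsL refl] by blast
  have DL: "?D \<in> sets (start_law S x)" using D setsL by simp
  have "survival_law S (start_law S x) t = density (start_law S x) (\<lambda>z. ennreal (indicator ?D z / ?c))"
    unfolding survival_law_eq uniform_measure_def
    using pos measure_survival_event[OF t x] divide_ennreal[of 1 ?c]
    by (intro density_cong)
      (use DL in \<open>auto simp: L.emeasure_eq_measure divide_ennreal split: split_indicator\<close>)
  then have "(LINT z|survival_law S (start_law S x) t. f z) = (LINT z|start_law S x. indicator ?D z / ?c * f z)"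
    using fL DL pos by (simp add: integral_real_density)
  also have "\<dots> = (LINT \<omega>|P. indicator ?D (\<omega>, x) / ?c * f (\<omega>, x))"
    unfolding start_law_eq[OF x]
    by (rule integral_distr[OF section_measurable[OF x]]) (use D f in measurable)
  also have "\<dots> = (LINT \<omega>|P. f (\<omega>, x) * alive (\<phi> t \<omega> (Some x)) / ?c)"
    by (intro Bochner_Integration.integral_cong refl) (simp add: indicator_survival_event[OF t _ x])
  finally show ?thesis by simp
qed

lemma measure_survival_law:
  assumes t: "t \<in> T" and x: "x \<in> M" and pos: "0 < transition t alive (Some x)"
    and A: "A \<in> sets (\<F> \<Otimes>\<^sub>M \<B>)"
  shows "measure (survival_law S (start_law S x) t) A =
    (LINT \<omega>|P. indicator A (\<omega>, x) * alive (\<phi> t \<omega> (Some x))) / transition t alive (Some x)"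
proof -
  interpret L: prob_space "survival_law S (start_law S x) t" by (rule prob_space_survival_law[OF t x pos])
  have "measure (survival_law S (start_law S x) t) A = (LINT z|survival_law S (start_law S x) t. indicator A z)"
    using A sets_survival_law[OF x, of t] by simp
  also have "\<dots> = (LINT \<omega>|P. indicator A (\<omega>, x) * alive (\<phi> t \<omega> (Some x))) / transition t alive (Some x)"
    by (rule integral_survival_law[OF t x pos]) (use A in measurable)
  finally show ?thesis .
qed

lemma position_event_sets:
  assumes t: "t \<in> T" and A: "A \<in> sets \<B>"
  shows "position_event S t A \<in> sets (\<F> \<Otimes>\<^sub>M \<B>)"
proof -
  note [measurable] = measurable_pair_past_full[OF flow_Some_measurable[OF t]] ext_measurable_lift1[of "indicator A"] A
  have "{z \<in> space (\<F> \<Otimes>\<^sub>M \<B>). lift (indicator A) (case z of (\<omega>, x) \<Rightarrow> \<phi> t \<omega> (Some x)) = 1} \<in> sets (\<F> \<Otimes>\<^sub>M \<B>)"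
    by measurable
  also have "{z \<in> space (\<F> \<Otimes>\<^sub>M \<B>). lift (indicator A) (case z of (\<omega>, x) \<Rightarrow> \<phi> t \<omega> (Some x)) = 1} = position_event S t A"
    by (auto simp: space_pair_measure position_event_def indicator_def split: if_splits option.splits)
  finally show ?thesis .
qed

text \<open>If survival beyond \<open>t\<close> is a null event, then conditioning on it yields the zero measure. The bound makes the supremum that defines the total variation distance a supremum of a bounded
set.\<close>

lemma measure_survival_law_le_1:
  assumes t: "t \<in> T" and x: "x \<in> M" and A: "A \<in> sets (\<F> \<Otimes>\<^sub>M \<B>)"
  shows "measure (survival_law S (start_law S x) t) A \<le> 1"
proof -
  interpret L: prob_space "start_law S x" by (rule prob_space_start_law[OF x])
  let ?D = "survival_event t"
  have sets: "sets (start_law S x) = sets (\<F> \<Otimes>\<^sub>M \<B>)" by (simp add: start_law_eq[OF x])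
  have D: "?D \<in> sets (start_law S x)" using survival_event_sets[OF t] pair_past_le_full sets by blast
  show ?thesis
  proof (cases "measure (start_law S x) ?D = 0")
    case True
    then have D0: "emeasure (start_law S x) ?D = 0" by (simp add: L.emeasure_eq_measure)
    then have "emeasure (start_law S x) (?D \<inter> A) = 0"
      using emeasure_mono[of "?D \<inter> A" ?D "start_law S x"] D by auto
    then have "emeasure (survival_law S (start_law S x) t) A = 0"
      using D A sets by (simp add: survival_law_eq)
    then show ?thesis by (simp add: measure_def)
  next
    case False
    then have "measure (survival_law S (start_law S x) t) A = measure (start_law S x) (?D \<inter> A) / measure (start_law S x) ?D"
      using A sets unfolding survival_law_eq by (intro measure_uniform_measure) (auto simp: L.emeasure_eq_measure)
    then show ?thesis
      using L.finite_measure_mono[of "?D \<inter> A" ?D] D False by (simp add: divide_le_eq_1 zero_less_measure_iff)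
  qed
qed

end

section \<open>The eigenfunction and the eigenmeasure\<close>

text \<open>The objects whose existence the hypothesis asserts become parameters here: the
conditioned laws of the position converge setwise to \<open>\<mu>\<close>, and \<open>exp (\<beta> * t)\<close> times the survival
probability converges to \<open>\<eta>\<close> uniformly. That \<open>\<mu>\<close> is quasi-stationary is recovered in the form of
\<open>mu_eigenmeasure\<close>.\<close>

locale conditioned_rds = timed_rds d S
  for d and S :: "('x::topological_space, 'a::euclidean_space) rds" +
  fixes \<mu> :: "'a measure" and \<eta> :: "'a \<Rightarrow> real" and \<beta> :: real
  assumes prob_mu: "prob_space \<mu>" and sets_mu: "sets \<mu> = sets \<B>"
    and yaglom: "\<And>x A. x \<in> M \<Longrightarrow> A \<in> sets \<B> \<Longrightarrow>
      ((\<lambda>t. measure (survival_law S (start_law S x) t) (position_event S t A)) \<longlongrightarrow> measure \<mu> A) (time_at_top S)"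
    and eta_pos: "\<And>x. x \<in> M \<Longrightarrow> 0 < \<eta> x" and eta_bounded: "bounded (\<eta> ` M)"
    and survival_rate: "((\<lambda>t. SUP x\<in>M. \<bar>exp (\<beta> * t) * measure (start_law S x)
            {(\<omega>, y) \<in> \<Omega> \<times> M. ereal t < absorption_time S \<omega> (Some y)} - \<eta> x\<bar>)
        \<longlongrightarrow> 0) (time_at_top S)"
begin

sublocale mu: prob_space \<mu>
  by (rule prob_mu)

lemma space_mu[simp]: "space \<mu> = M"
  using sets_eq_imp_space_eq[OF sets_mu] by simp

lemma measurable_mu: "f \<in> \<mu> \<rightarrow>\<^sub>M N \<longleftrightarrow> f \<in> \<B> \<rightarrow>\<^sub>M N"
  using measurable_cong_sets[OF sets_mu refl] by blast

text \<open>A fixed upper bound for \<open>\<eta>\<close>, not necessarily the least, that serves as the constant in all dominations.\<close>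

definition eta_sup :: real where
  "eta_sup = (SOME K. \<forall>x\<in>M. \<eta> x \<le> K)"

lemma eta_le: "x \<in> M \<Longrightarrow> \<eta> x \<le> eta_sup"
proof -
  obtain K where "\<And>x. x \<in> M \<Longrightarrow> \<bar>\<eta> x\<bar> \<le> K" using eta_bounded by (auto simp: bounded_iff)
  then have "\<exists>K. \<forall>x\<in>M. \<eta> x \<le> K" by (intro exI[of _ K]) (auto dest: abs_le_D1)
  then have "\<forall>x\<in>M. \<eta> x \<le> eta_sup" unfolding eta_sup_def by (rule someI_ex)
  then show "x \<in> M \<Longrightarrow> \<eta> x \<le> eta_sup" by blast
qed

lemma phase_nonempty: "M \<noteq> {}"
  using mu.not_empty by simp

lemma lift_eta_bound: "y \<in> ext_phase S \<Longrightarrow> \<bar>lift \<eta> y\<bar> \<le> eta_sup"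
proof -
  obtain x where "x \<in> M" using phase_nonempty by auto
  then have "0 \<le> eta_sup" using eta_pos[of x] eta_le[of x] by simp
  then show "y \<in> ext_phase S \<Longrightarrow> \<bar>lift \<eta> y\<bar> \<le> eta_sup"
    using eta_pos eta_le by (cases y) (auto simp: abs_of_pos)
qed

definition survival_error :: "real \<Rightarrow> real" where
  "survival_error t = (SUP x\<in>M. \<bar>exp (\<beta> * t) * measure (start_law S x) (survival_event t) - \<eta> x\<bar>)"

lemma survival_error_tendsto: "(survival_error \<longlongrightarrow> 0) (time_at_top S)"
  using survival_rate unfolding survival_error_def survival_event_def .

lemma survival_error_Some:
  assumes t: "t \<in> T" and x: "x \<in> M"
  shows "\<bar>exp (\<beta> * t) * transition t alive (Some x) - \<eta> x\<bar> \<le> survival_error t"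
proof -
  have "\<bar>exp (\<beta> * t) * measure (start_law S y) (survival_event t) - \<eta> y\<bar> \<le> exp (\<beta> * t) + eta_sup" if y: "y \<in> M" for y
  proof -
    interpret L: prob_space "start_law S y" by (rule prob_space_start_law[OF y])
    have "exp (\<beta> * t) * measure (start_law S y) (survival_event t) \<le> exp (\<beta> * t) * 1"
      using L.prob_le_1 by (intro mult_left_mono) auto
    moreover have "0 \<le> exp (\<beta> * t) * measure (start_law S y) (survival_event t)" by simp
    ultimately show ?thesis using eta_pos[OF y] eta_le[OF y] exp_ge_zero[of "\<beta> * t"] by linarith
  qed
  then have bdd: "bdd_above ((\<lambda>y. \<bar>exp (\<beta> * t) * measure (start_law S y) (survival_event t) - \<eta> y\<bar>) ` M)"
    by (auto intro!: bdd_aboveI2)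
  have "\<bar>exp (\<beta> * t) * measure (start_law S x) (survival_event t) - \<eta> x\<bar> \<le> survival_error t"
    unfolding survival_error_def by (rule cSUP_upper[OF x bdd])
  then show ?thesis by (simp add: measure_survival_event[OF t x])
qed

lemma survival_error_nonneg: "t \<in> T \<Longrightarrow> 0 \<le> survival_error t"
  using phase_nonempty survival_error_Some[of t] by (meson abs_ge_zero equals0I order_trans)

lemma survival_error:
  assumes t: "t \<in> T" and y: "y \<in> ext_phase S"
  shows "\<bar>exp (\<beta> * t) * transition t alive y - lift \<eta> y\<bar> \<le> survival_error t"
  using survival_error_Some[OF t] y survival_error_nonneg[OF t] transition_None[OF t, of alive]
  by (cases y) auto

lemma survival_tendsto:
  assumes x: "x \<in> M"
  shows "((\<lambda>t. exp (\<beta> * t) * transition t alive (Some x)) \<longlongrightarrow> \<eta> x) (time_at_top S)"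
proof (rule Lim_transform[OF tendsto_const])
  show "((\<lambda>t. exp (\<beta> * t) * transition t alive (Some x) - \<eta> x) \<longlongrightarrow> 0) (time_at_top S)"
  proof (rule Lim_null_comparison[OF _ survival_error_tendsto])
    show "\<forall>\<^sub>F t in time_at_top S. norm (exp (\<beta> * t) * transition t alive (Some x) - \<eta> x) \<le> survival_error t"
      using eventually_in_time
      by eventually_elim (use survival_error_Some[OF _ x] in simp)
  qed
qed

lemma survival_pos:
  assumes x: "x \<in> M"
  shows "\<forall>\<^sub>F t in time_at_top S. t \<in> T \<and> 0 < transition t alive (Some x)"
  using eventually_in_time order_tendstoD(1)[OF survival_tendsto[OF x] eta_pos[OF x]]
  by eventually_elim (auto simp: zero_less_mult_iff)

lemma eta_measurable[measurable]: "\<eta> \<in> borel_measurable \<B>"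
proof (rule borel_measurable_LIMSEQ_metric)
  fix n
  show "(\<lambda>x. exp (\<beta> * real n) * transition (real n) alive (Some x)) \<in> borel_measurable \<B>"
    using measurable_compose[OF Some_measurable transition_measurable[OF time_of_nat alive_measurable]]
    by measurable
next
  fix x assume "x \<in> space \<B>"
  then show "(\<lambda>n. exp (\<beta> * real n) * transition (real n) alive (Some x)) \<longlonglongrightarrow> \<eta> x"
    using filterlim_compose[OF survival_tendsto filterlim_real_time] by simp
qed

lemma lift_eta_measurable[measurable]: "lift \<eta> \<in> borel_measurable \<E>"
  by (rule ext_measurable_lift1) simp

text \<open>Uniformity in the starting point is what allows the survival probability to be replaced by \<open>\<eta>\<close> at the
random position \<open>\<phi> s \<omega> y\<close>. The error is kept explicit because in \<open>conditioned_position_tendsto\<close> both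
\<open>s\<close> and \<open>t\<close> move.\<close>

lemma weighted_survival_error:
  fixes a :: "(real \<Rightarrow> 'x) \<Rightarrow> real"
  assumes s: "s \<in> T" and t: "t \<in> T" and y: "y \<in> ext_phase S"
    and a: "a \<in> borel_measurable \<F>" "\<And>\<omega>. \<omega> \<in> \<Omega> \<Longrightarrow> \<bar>a \<omega>\<bar> \<le> K"
  shows "\<bar>exp (\<beta> * t) * (LINT \<omega>|P. a \<omega> * transition t alive (\<phi> s \<omega> y)) - (LINT \<omega>|P. a \<omega> * lift \<eta> (\<phi> s \<omega> y))\<bar>
    \<le> (LINT \<omega>|P. \<bar>a \<omega>\<bar>) * survival_error t"
proof -
  have i1: "integrable P (\<lambda>\<omega>. a \<omega> * transition t alive (\<phi> s \<omega> y))"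
    using alive_bound by (intro integrable_flow[OF s y a] transition_measurable t transition_abs_le) auto
  have i2: "integrable P (\<lambda>\<omega>. a \<omega> * lift \<eta> (\<phi> s \<omega> y))"
    by (rule integrable_flow[OF s y a lift_eta_measurable lift_eta_bound])
  have ia: "integrable P (\<lambda>\<omega>. \<bar>a \<omega>\<bar>)"
    using a by (intro integrable_abs noise.integrable_const_bound[of _ K]) (auto simp: measurable_noise)
  have "\<bar>exp (\<beta> * t) * (LINT \<omega>|P. a \<omega> * transition t alive (\<phi> s \<omega> y)) - (LINT \<omega>|P. a \<omega> * lift \<eta> (\<phi> s \<omega> y))\<bar>
    = \<bar>LINT \<omega>|P. exp (\<beta> * t) * (a \<omega> * transition t alive (\<phi> s \<omega> y)) - a \<omega> * lift \<eta> (\<phi> s \<omega> y)\<bar>"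
    using i1 i2 by simp
  also have "\<dots> \<le> (LINT \<omega>|P. \<bar>exp (\<beta> * t) * (a \<omega> * transition t alive (\<phi> s \<omega> y)) - a \<omega> * lift \<eta> (\<phi> s \<omega> y)\<bar>)"
    by (rule integral_abs_bound)
  also have "\<dots> \<le> (LINT \<omega>|P. \<bar>a \<omega>\<bar> * survival_error t)"
  proof (rule integral_mono)
    have "integrable P (\<lambda>\<omega>. exp (\<beta> * t) * (a \<omega> * transition t alive (\<phi> s \<omega> y)))"
      by (rule integrable_mult_right) (rule i1)
    then have "integrable P (\<lambda>\<omega>. exp (\<beta> * t) * (a \<omega> * transition t alive (\<phi> s \<omega> y)) - a \<omega> * lift \<eta> (\<phi> s \<omega> y))"
      by (rule Bochner_Integration.integrable_diff) (rule i2)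
    then show "integrable P (\<lambda>\<omega>. \<bar>exp (\<beta> * t) * (a \<omega> * transition t alive (\<phi> s \<omega> y)) - a \<omega> * lift \<eta> (\<phi> s \<omega> y)\<bar>)"
      by (rule integrable_abs)
    show "integrable P (\<lambda>\<omega>. \<bar>a \<omega>\<bar> * survival_error t)"
      by (rule integrable_mult_left[OF ia])
    fix \<omega> assume "\<omega> \<in> space P"
    then have "\<bar>exp (\<beta> * t) * transition t alive (\<phi> s \<omega> y) - lift \<eta> (\<phi> s \<omega> y)\<bar> \<le> survival_error t"
      using flow_in_ext[OF s _ y] by (intro survival_error[OF t]) auto
    then have "\<bar>a \<omega>\<bar> * \<bar>exp (\<beta> * t) * transition t alive (\<phi> s \<omega> y) - lift \<eta> (\<phi> s \<omega> y)\<bar> \<le> \<bar>a \<omega>\<bar> * survival_error t"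
      by (intro mult_left_mono) auto
    then show "\<bar>exp (\<beta> * t) * (a \<omega> * transition t alive (\<phi> s \<omega> y)) - a \<omega> * lift \<eta> (\<phi> s \<omega> y)\<bar> \<le> \<bar>a \<omega>\<bar> * survival_error t"
      by (simp only: abs_mult[symmetric] right_diff_distrib mult.left_commute)
  qed
  finally show ?thesis by simp
qed

text \<open>Survival beyond \<open>t + s\<close> means survival beyond \<open>t\<close> when started from the position at time \<open>s\<close>, which for
large \<open>t\<close> has probability about \<open>exp (- \<beta> * t)\<close> times \<open>\<eta>\<close> of that position. Divided by the survival
probability of \<open>x\<close>, this is where the density of the \<open>Q\<close>-measures comes from.\<close>

lemma weighted_survival_tendsto:
  fixes a :: "(real \<Rightarrow> 'x) \<Rightarrow> real"
  assumes s: "s \<in> T" and x: "x \<in> M"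
    and a: "a \<in> borel_measurable (\<P> s)" "\<And>\<omega>. \<omega> \<in> \<Omega> \<Longrightarrow> \<bar>a \<omega>\<bar> \<le> K"
  shows "((\<lambda>t. exp (\<beta> * t) * (LINT \<omega>|P. a \<omega> * alive (\<phi> t \<omega> (Some x)))) \<longlongrightarrow>
    exp (\<beta> * s) * (LINT \<omega>|P. a \<omega> * lift \<eta> (\<phi> s \<omega> (Some x)))) (time_at_top S)"
proof (rule tendsto_time_shiftD[OF s])
  have y: "Some x \<in> ext_phase S" using x by simp
  let ?I = "LINT \<omega>|P. a \<omega> * lift \<eta> (\<phi> s \<omega> (Some x))"
  have "((\<lambda>t. exp (\<beta> * t) * (LINT \<omega>|P. a \<omega> * transition t alive (\<phi> s \<omega> (Some x))) - ?I) \<longlongrightarrow> 0) (time_at_top S)"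
  proof (rule Lim_null_comparison)
    show "\<forall>\<^sub>F t in time_at_top S. norm (exp (\<beta> * t) * (LINT \<omega>|P. a \<omega> * transition t alive (\<phi> s \<omega> (Some x))) - ?I)
      \<le> (LINT \<omega>|P. \<bar>a \<omega>\<bar>) * survival_error t"
      using eventually_in_time
      by eventually_elim (use weighted_survival_error[OF s _ y measurable_past_full[OF a(1)] a(2)] in simp)
    show "((\<lambda>t. (LINT \<omega>|P. \<bar>a \<omega>\<bar>) * survival_error t) \<longlongrightarrow> 0) (time_at_top S)"
      by (rule tendsto_mult_right_zero[OF survival_error_tendsto])
  qed
  from Lim_transform[OF tendsto_const this]
  have "((\<lambda>t. exp (\<beta> * s) * (exp (\<beta> * t) * (LINT \<omega>|P. a \<omega> * transition t alive (\<phi> s \<omega> (Some x))))) \<longlongrightarrow> exp (\<beta> * s) * ?I) (time_at_top S)"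
    by (intro tendsto_mult tendsto_const)
  moreover have "\<forall>\<^sub>F t in time_at_top S. exp (\<beta> * (t + s)) * (LINT \<omega>|P. a \<omega> * alive (\<phi> (t + s) \<omega> (Some x))) =
    exp (\<beta> * s) * (exp (\<beta> * t) * (LINT \<omega>|P. a \<omega> * transition t alive (\<phi> s \<omega> (Some x))))"
    using eventually_in_time
  proof eventually_elim
    case (elim t)
    then show ?case
      using weighted_markov[OF elim s y a alive_measurable alive_bound(1)]
      by (simp add: distrib_left exp_add)
  qed
  ultimately show "((\<lambda>t. exp (\<beta> * (t + s)) * (LINT \<omega>|P. a \<omega> * alive (\<phi> (t + s) \<omega> (Some x)))) \<longlongrightarrow> exp (\<beta> * s) * ?I) (time_at_top S)"
    by (subst tendsto_cong)
qed

text \<open>With the trivial weight both sides are the limit of the rescaled survival probability.\<close>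

lemma eta_eigenfunction:
  assumes s: "s \<in> T" and x: "x \<in> M"
  shows "exp (\<beta> * s) * transition s (lift \<eta>) (Some x) = \<eta> x"
proof -
  have "((\<lambda>t. exp (\<beta> * t) * transition t alive (Some x)) \<longlongrightarrow> exp (\<beta> * s) * transition s (lift \<eta>) (Some x)) (time_at_top S)"
    using weighted_survival_tendsto[OF s x, of "\<lambda>_. 1" 1] by (simp add: transition_def)
  then show ?thesis
    using tendsto_unique[OF time_at_top_neq_bot _ survival_tendsto[OF x]] by blast
qed

lemma eta_eigenfunction_ext:
  assumes s: "s \<in> T" and y: "y \<in> ext_phase S"
  shows "exp (\<beta> * s) * transition s (lift \<eta>) y = lift \<eta> y"
  using eta_eigenfunction[OF s] transition_None[OF s, of "lift \<eta>"] y by (cases y) auto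

text \<open>The conditional expectation of \<open>g\<close> tends to its \<open>\<mu>\<close>-mean, and the normalising survival probability is
asymptotically \<open>exp (- \<beta> * t) * \<eta> x\<close>. So the rescaled semigroup converges to the rank-one projection
\<open>g \<mapsto> \<eta> * (LINT y|\<mu>. g y)\<close>; all asymptotic statements below rest on this.\<close>

lemma transition_tendsto:
  fixes g :: "'a \<Rightarrow> real"
  assumes x: "x \<in> M" and g: "g \<in> borel_measurable \<B>" "\<And>y. y \<in> M \<Longrightarrow> 0 \<le> g y" "\<And>y. y \<in> M \<Longrightarrow> g y \<le> K"
  shows "((\<lambda>t. exp (\<beta> * t) * transition t (lift g) (Some x)) \<longlongrightarrow> \<eta> x * (LINT y|\<mu>. g y)) (time_at_top S)"
proof -
  \<comment> \<open>the conditional law of the position at time \<open>t\<close>; the default of the retraction is only taken on a null set\<close>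
  define p where "p t = distr (survival_law S (start_law S x) t) \<B> (\<lambda>z. retract x (\<phi> t (fst z) (Some (snd z))))" for t
  have m: "(\<lambda>z. retract x (\<phi> t (fst z) (Some (snd z)))) \<in> survival_law S (start_law S x) t \<rightarrow>\<^sub>M \<B>" if t: "t \<in> T" for t
    using measurable_compose[OF measurable_pair_past_full[OF flow_Some_measurable[OF t]] retract_measurable[OF x]]
    unfolding measurable_cong_sets[OF sets_survival_law[OF x] refl] using t by (simp add: case_prod_beta')
  have int: "(LINT y|p t. f y) = transition t (lift f) (Some x) / transition t alive (Some x)"
    if t: "t \<in> T" "0 < transition t alive (Some x)" and f: "f \<in> borel_measurable \<B>" for t f
  proof -
    have "(LINT y|p t. f y) = (LINT z|survival_law S (start_law S x) t. f (retract x (\<phi> t (fst z) (Some (snd z)))))"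
      unfolding p_def by (rule integral_distr[OF m[OF t(1)] f])
    also have "\<dots> = (LINT \<omega>|P. f (retract x (\<phi> t \<omega> (Some x))) * alive (\<phi> t \<omega> (Some x))) / transition t alive (Some x)"
      using measurable_compose[OF m[OF t(1)] f] measurable_cong_sets[OF sets_survival_law[OF x] refl]
      by (subst integral_survival_law[OF t(1) x t(2)]) auto
    also have "(LINT \<omega>|P. f (retract x (\<phi> t \<omega> (Some x))) * alive (\<phi> t \<omega> (Some x))) = transition t (lift f) (Some x)"
      unfolding transition_def
      by (intro Bochner_Integration.integral_cong refl) (auto simp: retract_def split: option.splits)
    finally show ?thesis .
  qed
  have prob: "prob_space (p t)" if t: "t \<in> T" "0 < transition t alive (Some x)" for t
    unfolding p_def by (rule prob_space.prob_space_distr[OF prob_space_survival_law[OF t(1) x t(2)] m[OF t(1)]])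
  have "((\<lambda>t. LINT y|p t. g y) \<longlongrightarrow> (LINT y|\<mu>. g y)) (time_at_top S)"
  proof (rule integral_tendsto_of_setwise[where K = K])
    show "\<forall>\<^sub>F t in time_at_top S. prob_space (p t) \<and> sets (p t) = sets \<mu>"
      using survival_pos[OF x] by eventually_elim (use prob sets_mu in \<open>auto simp: p_def\<close>)
    fix A assume "A \<in> sets \<mu>"
    then have A: "A \<in> sets \<B>" using sets_mu by simp
    then have AM: "A \<inter> M = A" using sets.sets_into_space[OF A] by auto
    have "\<forall>\<^sub>F t in time_at_top S. measure (p t) A = measure (survival_law S (start_law S x) t) (position_event S t A)"
      using survival_pos[OF x]
    proof eventually_elim
      case (elim t)
      then interpret p: prob_space "p t" by (intro prob) auto
      have "measure (p t) A = (LINT y|p t. indicator A y)" by (simp add: p_def AM)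
      also have "\<dots> = transition t (lift (indicator A)) (Some x) / transition t alive (Some x)"
        using elim A by (intro int) auto
      also have "transition t (lift (indicator A)) (Some x) =
        (LINT \<omega>|P. indicator (position_event S t A) (\<omega>, x) * alive (\<phi> t \<omega> (Some x)))"
        unfolding transition_def using x
        by (intro Bochner_Integration.integral_cong refl)
          (auto simp: position_event_def indicator_def split: option.splits)
      finally show ?case
        using elim position_event_sets[OF _ A] by (subst measure_survival_law[OF _ x]) auto
    qed
    then show "((\<lambda>t. measure (p t) A) \<longlongrightarrow> measure \<mu> A) (time_at_top S)"
      using yaglom[OF x A] by (subst tendsto_cong)
  qed (use g prob_mu in \<open>auto simp: measurable_mu\<close>)
  then have "((\<lambda>t. exp (\<beta> * t) * transition t alive (Some x) * (LINT y|p t. g y)) \<longlongrightarrow> \<eta> x * (LINT y|\<mu>. g y)) (time_at_top S)"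
    by (intro tendsto_mult survival_tendsto[OF x])
  moreover have "\<forall>\<^sub>F t in time_at_top S. exp (\<beta> * t) * transition t (lift g) (Some x) =
    exp (\<beta> * t) * transition t alive (Some x) * (LINT y|p t. g y)"
    using survival_pos[OF x] by eventually_elim (use int g(1) in simp)
  ultimately show ?thesis by (subst tendsto_cong)
qed

text \<open>The rescaled semigroup fixes \<open>\<eta>\<close>, so its limit must do so as well.\<close>

lemma integral_eta: "(LINT y|\<mu>. \<eta> y) = 1"
proof -
  obtain x where x: "x \<in> M" using phase_nonempty by auto
  have "((\<lambda>t. exp (\<beta> * t) * transition t (lift \<eta>) (Some x)) \<longlongrightarrow> \<eta> x * (LINT y|\<mu>. \<eta> y)) (time_at_top S)"
    using eta_pos eta_le by (intro transition_tendsto[OF x, where K = eta_sup]) (auto intro: less_imp_le)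
  moreover have "\<forall>\<^sub>F t in time_at_top S. exp (\<beta> * t) * transition t (lift \<eta>) (Some x) = \<eta> x"
    using eventually_in_time by eventually_elim (rule eta_eigenfunction[OF _ x])
  ultimately have "((\<lambda>t. \<eta> x) \<longlongrightarrow> \<eta> x * (LINT y|\<mu>. \<eta> y)) (time_at_top S)"
    using tendsto_cong by force
  then have "\<eta> x = \<eta> x * (LINT y|\<mu>. \<eta> y)"
    using tendsto_unique[OF time_at_top_neq_bot tendsto_const] by blast
  then show ?thesis using eta_pos[OF x] by simp
qed

text \<open>The limit of \<open>exp (\<beta> * (s + t)) * transition (s + t) (lift g)\<close> as \<open>s\<close> grows can be read off in two ways, from
\<open>g\<close> directly or after splitting off the last \<open>t\<close> units of time.\<close>

lemma mu_eigenmeasure: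
  fixes g :: "'a \<Rightarrow> real"
  assumes t: "t \<in> T" and g: "g \<in> borel_measurable \<B>" "\<And>y. y \<in> M \<Longrightarrow> 0 \<le> g y" "\<And>y. y \<in> M \<Longrightarrow> g y \<le> K"
  shows "exp (\<beta> * t) * (LINT y|\<mu>. transition t (lift g) (Some y)) = (LINT y|\<mu>. g y)"
proof -
  obtain x where x: "x \<in> M" using phase_nonempty by auto
  have K: "0 \<le> K" using g(2)[OF x] g(3)[OF x] by simp
  have lg: "lift g \<in> borel_measurable \<E>" by (rule ext_measurable_lift1[OF g(1)])
  have lgK: "\<bar>lift g y\<bar> \<le> K" if "y \<in> ext_phase S" for y
    using g K that by (cases y) auto
  define h where "h y = transition t (lift g) (Some y)" for y
  have h: "h \<in> borel_measurable \<B>" unfolding h_def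
    by (rule measurable_compose[OF Some_measurable transition_measurable[OF t lg]])
  have h0: "0 \<le> h y" if "y \<in> M" for y
  proof -
    have "0 \<le> lift g (\<phi> t \<omega> (Some y))" if "\<omega> \<in> \<Omega>" for \<omega>
      using flow_in_ext[OF t that, of "Some y"] \<open>y \<in> M\<close> g(2) by (auto split: option.splits)
    then show ?thesis
      unfolding h_def transition_def by (intro integral_nonneg_AE AE_I2) auto
  qed
  have hK: "h y \<le> K" if "y \<in> M" for y
    using transition_abs_le[OF t _ lg lgK, of "Some y"] that unfolding h_def by auto
  have eq: "transition s (lift h) (Some x) = transition (s + t) (lift g) (Some x)" if s: "s \<in> T" for s
  proof -
    have "transition (t + s) (lift g) (Some x) = transition s (transition t (lift g)) (Some x)"
      using x by (intro transition_add[OF t s _ lg lgK]) auto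
    also have "\<dots> = transition s (lift h) (Some x)"
      unfolding transition_def[of s] using transition_None[OF t, of "lift g"]
      by (intro Bochner_Integration.integral_cong refl) (auto simp: h_def split: option.splits)
    finally show ?thesis by (simp add: add.commute)
  qed
  have 1: "((\<lambda>s. exp (\<beta> * (s + t)) * transition (s + t) (lift g) (Some x)) \<longlongrightarrow> \<eta> x * (LINT y|\<mu>. g y)) (time_at_top S)"
    by (rule filterlim_compose[OF transition_tendsto[OF x g] filterlim_time_shift[OF t]])
  have 2: "((\<lambda>s. exp (\<beta> * t) * (exp (\<beta> * s) * transition s (lift h) (Some x))) \<longlongrightarrow> exp (\<beta> * t) * (\<eta> x * (LINT y|\<mu>. h y))) (time_at_top S)"
    by (intro tendsto_mult tendsto_const transition_tendsto[OF x h h0 hK])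
  have "\<forall>\<^sub>F s in time_at_top S. exp (\<beta> * (s + t)) * transition (s + t) (lift g) (Some x) =
    exp (\<beta> * t) * (exp (\<beta> * s) * transition s (lift h) (Some x))"
    using eventually_in_time by eventually_elim (simp add: eq distrib_left exp_add)
  from tendsto_cong[OF this] 1 have "((\<lambda>s. exp (\<beta> * t) * (exp (\<beta> * s) * transition s (lift h) (Some x))) \<longlongrightarrow> \<eta> x * (LINT y|\<mu>. g y)) (time_at_top S)"
    by (rule iffD1)
  then have "exp (\<beta> * t) * (\<eta> x * (LINT y|\<mu>. h y)) = \<eta> x * (LINT y|\<mu>. g y)"
    by (rule tendsto_unique[OF time_at_top_neq_bot 2])
  then show ?thesis using eta_pos[OF x] by (simp add: h_def)
qed

end

section \<open>Time averages and the quasi-ergodic distribution\<close>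

context timed_rds
begin

definition time_measure :: "real measure" where
  "time_measure = (if T = \<nat> then count_space \<nat> else restrict_space lborel {0..})"

text \<open>The range of summation or integration in \<open>time_average\<close>. It excludes \<open>t\<close> in discrete and includes it in
continuous time; its measure is \<open>t\<close> in both cases.\<close>

definition window :: "real \<Rightarrow> real set" where
  "window t = (if T = \<nat> then {s\<in>\<nat>. s < t} else {0..t})"

definition averaging_measure :: "real \<Rightarrow> real measure" where
  "averaging_measure t = uniform_measure time_measure (window t)"

lemma time_not_nat: "T \<noteq> \<nat> \<Longrightarrow> T = {0..}"
  using time_cases by blast

lemma space_time_measure[simp]: "space time_measure = T"
  unfolding time_measure_def using time_not_nat by (simp add: space_restrict_space)

lemma window_sets: "window t \<in> sets time_measure"
  unfolding time_measure_def window_def by (auto simp: sets_restrict_space)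

lemma window_in_time: "s \<in> window t \<Longrightarrow> s \<in> T \<and> s \<le> t"
  unfolding window_def using time_not_nat by (auto split: if_splits)

lemma emeasure_window:
  assumes t: "t \<in> T" shows "emeasure time_measure (window t) = ennreal t"
proof (cases "T = \<nat>")
  case True
  with t obtain n where n: "t = real n" by (metis Nats_cases)
  have "window t = real ` {..<n}"
    unfolding window_def n using True by (force simp: Nats_def)
  then have "emeasure time_measure (window t) = card (real ` {..<n})"
    using True by (simp add: time_measure_def emeasure_count_space_finite image_subset_iff)
  then show ?thesis by (simp add: n card_image ennreal_of_nat_eq_real_of_nat)
next
  case False
  then show ?thesis
    using time_nonneg[OF t] unfolding time_measure_def window_def
    by (simp add: emeasure_restrict_space)
qed

lemma measure_window: "t \<in> T \<Longrightarrow> measure time_measure (window t) = t"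
  using time_nonneg by (simp add: measure_def emeasure_window)

lemma prob_averaging:
  assumes "t \<in> T" "0 < t" shows "prob_space (averaging_measure t)"
  unfolding averaging_measure_def using assms
  by (intro prob_space_uniform_measure) (auto simp: emeasure_window)

lemma space_averaging[simp]: "space (averaging_measure t) = T"
  by (simp add: averaging_measure_def)

lemma measure_averaging:
  assumes "t \<in> T" "0 < t" "A \<in> sets time_measure"
  shows "measure (averaging_measure t) A = measure time_measure (window t \<inter> A) / t"
  unfolding averaging_measure_def using assms
  by (subst measure_uniform_measure) (auto simp: emeasure_window measure_window)

lemma sets_averaging: "sets (averaging_measure t) = sets time_measure"
  by (simp add: averaging_measure_def)

lemma id_averaging: "(\<lambda>s. s) \<in> averaging_measure t \<rightarrow>\<^sub>M restrict_space borel T"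
proof (cases "T = \<nat>")
  case True
  then have tm: "time_measure = count_space \<nat>" by (simp add: time_measure_def)
  have "(\<lambda>s. s) \<in> time_measure \<rightarrow>\<^sub>M restrict_space borel T"
    unfolding tm measurable_count_space_eq1 Pi_iff space_restrict_space space_borel True by blast
  then show ?thesis
    unfolding measurable_cong_sets[OF sets_averaging refl] .
next
  case False
  have "sets time_measure = sets (restrict_space lborel {0..})" using False by (simp add: time_measure_def)
  also have "\<dots> = sets (restrict_space borel T)"
    unfolding time_not_nat[OF False] by (rule sets_restrict_space_cong) simp
  finally have "sets (averaging_measure t) = sets (restrict_space borel T)" unfolding sets_averaging .
  then show ?thesis by (rule measurable_ident_sets)
qed

lemma integral_averaging:
  fixes h :: "real \<Rightarrow> real"
  assumes t: "t \<in> T" "0 < t" and h: "h \<in> borel_measurable (averaging_measure t)"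
  shows "(LINT s|averaging_measure t. h s) =
    (if T = \<nat> then (\<Sum>s\<in>{s\<in>\<nat>. s < t}. h s) else (LINT s:{0..t}|lborel. h s)) / t"
proof -
  have h': "h \<in> borel_measurable time_measure"
    using h unfolding measurable_cong_sets[OF sets_averaging refl] .
  have "averaging_measure t = density time_measure (\<lambda>s. ennreal (indicator (window t) s / t))"
    unfolding averaging_measure_def uniform_measure_def
    using t divide_ennreal[of 1 t] window_sets
    by (intro density_cong) (auto simp: emeasure_window split: split_indicator)
  then have *: "(LINT s|averaging_measure t. h s) = (LINT s|time_measure. indicator (window t) s / t * h s)"
    using h' window_sets t by (simp add: integral_real_density)
  show ?thesis
  proof (cases "T = \<nat>")
    case True
    with t obtain n where n: "t = real n" by (metis Nats_cases)
    have fin: "finite {s\<in>\<nat>. s < t}"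
    proof -
      have "{s\<in>\<nat>. s < t} \<subseteq> real ` {..<n}" unfolding n by (force simp: Nats_def)
      then show ?thesis by (rule finite_subset) simp
    qed
    have "(LINT s|count_space \<nat>. indicator (window t) s / t * h s) =
      (\<Sum>s | s \<in> \<nat> \<and> indicator (window t) s / t * h s \<noteq> 0. indicator (window t) s / t * h s)"
      by (rule lebesgue_integral_count_space_finite_support, rule finite_subset[OF _ fin])
        (auto simp: window_def True indicator_def)
    also have "\<dots> = (\<Sum>s\<in>{s\<in>\<nat>. s < t}. indicator (window t) s / t * h s)"
      by (rule sum.mono_neutral_left[OF fin]) (auto simp: window_def True indicator_def)
    also have "\<dots> = (\<Sum>s\<in>{s\<in>\<nat>. s < t}. h s) / t"
      unfolding sum_divide_distrib by (intro sum.cong refl) (auto simp: window_def True)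
    finally show ?thesis using * True by (simp add: time_measure_def)
  next
    case False
    have "(LINT s|time_measure. indicator (window t) s / t * h s) =
      (LINT s|lborel. indicator {0..} s *\<^sub>R (indicator (window t) s / t * h s))"
      unfolding time_measure_def using False by (simp add: integral_restrict_space)
    also have "\<dots> = (LINT s|lborel. indicator {0..t} s *\<^sub>R h s / t)"
      by (intro Bochner_Integration.integral_cong refl) (auto simp: window_def False indicator_def)
    also have "\<dots> = (LINT s:{0..t}|lborel. h s) / t"
      unfolding set_lebesgue_integral_def by simp
    finally show ?thesis using * False by simp
  qed
qed

text \<open>In a time average conditioned on survival beyond \<open>t\<close>, the times \<open>s\<close> near \<open>0\<close> have not reached equilibrium
yet, and those near \<open>t\<close> feel the conditioning at the end. Both boundary layers have length at most \<open>R\<close>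
and drop out as \<open>t\<close> grows.\<close>

lemma averaging_estimate:
  fixes h :: "real \<Rightarrow> real"
  assumes t: "t \<in> T" "0 < t" and R: "R \<in> T" "R \<le> t" and h: "h \<in> borel_measurable (averaging_measure t)"
    and bound: "\<And>s. s \<in> window t \<Longrightarrow> \<bar>h s - l\<bar> \<le> b"
    and bulk: "\<And>s. s \<in> T \<Longrightarrow> R \<le> s \<Longrightarrow> R \<le> t - s \<Longrightarrow> \<bar>h s - l\<bar> \<le> e"
    and e: "0 \<le> e" and b: "0 \<le> b"
  shows "\<bar>(LINT s|averaging_measure t. h s) - l\<bar> \<le> e + b * (2 * R / t)"
proof -
  interpret K: prob_space "averaging_measure t" by (rule prob_averaging[OF t])
  have tR: "t - R \<in> T" by (rule time_diff[OF R(1) t(1) R(2)])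
  define bad where "bad = window R \<union> (window t - window (t - R))"
  have bad: "bad \<in> sets time_measure" unfolding bad_def by (intro sets.Un sets.Diff window_sets)
  have "AE s in averaging_measure t. s \<in> window t"
    unfolding averaging_measure_def using window_sets by (intro AE_uniform_measureI) auto
  then have AE: "AE s in averaging_measure t. \<bar>h s - l\<bar> \<le> e + b * indicator bad s"
  proof eventually_elim
    case (elim s)
    show ?case
    proof (cases "s \<in> bad")
      case True
      then show ?thesis using bound[OF elim] e by simp
    next
      case False
      then have "s \<notin> window R" "s \<in> window (t - R)" using elim by (auto simp: bad_def)
      then have "s \<in> T" "R \<le> s" "R \<le> t - s"
        using window_in_time[of s "t - R"] by (auto simp: window_def split: if_splits)
      then show ?thesis using bulk False by simp
    qed
  qed
  have "AE s in averaging_measure t. norm (h s - l) \<le> e + b"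
    using AE by eventually_elim (use b in \<open>auto simp: indicator_def of_bool_def split: if_splits\<close>)
  then have int: "integrable (averaging_measure t) (\<lambda>s. h s - l)"
    using h by (intro K.integrable_const_bound) auto
  have "integrable (averaging_measure t) (\<lambda>s. (h s - l) + l)"
    by (rule Bochner_Integration.integrable_add[OF int]) simp
  then have inth: "integrable (averaging_measure t) h" by simp
  have ind: "integrable (averaging_measure t) (\<lambda>s. b * indicator bad s)"
    using bad by (intro integrable_mult_right integrable_real_indicator) (auto simp: sets_averaging less_top[symmetric])
  have win: "window t \<in> fmeasurable time_measure" "window R \<in> fmeasurable time_measure" "window (t - R) \<in> fmeasurable time_measure"
    using t R tR window_sets by (auto simp: fmeasurable_def emeasure_window)
  have sub: "window (t - R) \<subseteq> window t"
    using time_nonneg[OF R(1)] unfolding window_def by auto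
  have "measure time_measure (window t \<inter> bad) \<le> measure time_measure bad"
    using bad win window_sets by (intro measure_mono_fmeasurable) (auto simp: bad_def intro!: fmeasurable.Un fmeasurable.Diff)
  also have "\<dots> \<le> measure time_measure (window R) + measure time_measure (window t - window (t - R))"
    unfolding bad_def by (intro measure_Un_le sets.Diff window_sets)
  also have "measure time_measure (window t - window (t - R)) = measure time_measure (window t) - measure time_measure (window (t - R))"
    using win sub by (intro measurable_measure_Diff) (auto simp: fmeasurable_def)
  finally have "measure time_measure (window t \<inter> bad) \<le> 2 * R"
    using t R tR by (simp add: measure_window)
  then have mbad: "measure (averaging_measure t) bad \<le> 2 * R / t"
    using measure_averaging[OF t bad] t by (simp add: divide_right_mono)
  have "(LINT s|averaging_measure t. h s) - l = (LINT s|averaging_measure t. h s - l)"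
    using inth K.prob_space by (subst Bochner_Integration.integral_diff) auto
  then have "\<bar>(LINT s|averaging_measure t. h s) - l\<bar> \<le> (LINT s|averaging_measure t. \<bar>h s - l\<bar>)"
    using integral_abs_bound by simp
  also have "\<dots> \<le> (LINT s|averaging_measure t. e + b * indicator bad s)"
    by (rule integral_mono_AE[OF integrable_abs[OF int] Bochner_Integration.integrable_add[OF _ ind] AE]) simp
  also have "\<dots> = e + b * measure (averaging_measure t) bad"
    using ind bad K.prob_space sets_averaging sets.sets_into_space[OF bad]
    by (subst Bochner_Integration.integral_add) (auto simp: Int_absorb2)
  also have "\<dots> \<le> e + b * (2 * R / t)"
    using mbad b by (intro add_left_mono mult_left_mono)
  finally show ?thesis .
qed

lemma flow_time_measurable:
  assumes f: "f \<in> borel_measurable \<B>"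
  shows "(\<lambda>(z, s). lift f (\<phi> s (fst z) (Some (snd z)))) \<in> borel_measurable ((\<F> \<Otimes>\<^sub>M \<B>) \<Otimes>\<^sub>M averaging_measure t)"
proof -
  note [measurable] = measurable_compose[OF measurable_snd id_averaging]
  have "(\<lambda>p. (\<lambda>(t, \<omega>, x). \<phi> t \<omega> x) (snd p, fst (fst p), Some (snd (fst p)))) \<in> (\<F> \<Otimes>\<^sub>M \<B>) \<Otimes>\<^sub>M averaging_measure t \<rightarrow>\<^sub>M \<E>"
    by (rule measurable_compose[OF _ flow_measurable]) measurable
  from measurable_compose[OF this ext_measurable_lift1[OF f]] show ?thesis by (simp add: case_prod_beta')
qed

lemma integral_time_average:
  fixes f :: "'a \<Rightarrow> real"
  assumes t: "t \<in> T" "0 < t" and x: "x \<in> M" and pos: "0 < transition t alive (Some x)"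
    and f: "f \<in> borel_measurable \<B>" "\<And>y. y \<in> M \<Longrightarrow> \<bar>f y\<bar> \<le> K"
  defines "h \<equiv> \<lambda>s. (LINT \<omega>|P. lift f (\<phi> s \<omega> (Some x)) * alive (\<phi> t \<omega> (Some x))) / transition t alive (Some x)"
  shows "(LINT z|survival_law S (start_law S x) t. time_average S f t z) = (LINT s|averaging_measure t. h s)"
    and "h \<in> borel_measurable (averaging_measure t)"
proof -
  let ?L = "survival_law S (start_law S x) t" and ?K = "averaging_measure t"
  interpret L: prob_space ?L by (rule prob_space_survival_law[OF t(1) x pos])
  interpret K: prob_space ?K by (rule prob_averaging[OF t])
  interpret pair_prob_space ?L ?K ..
  have "0 \<le> \<bar>f x\<bar>" by simp
  then have K: "0 \<le> K" using f(2)[OF x] by linarith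
  have sets: "sets (?L \<Otimes>\<^sub>M ?K) = sets ((\<F> \<Otimes>\<^sub>M \<B>) \<Otimes>\<^sub>M ?K)"
    by (intro sets_pair_measure_cong sets_survival_law x refl)
  have spL: "space ?L = \<Omega> \<times> M"
    using sets_eq_imp_space_eq[OF sets_survival_law[OF x, of t]] by (simp add: space_pair_measure)
  have m: "(\<lambda>(z, s). lift f (\<phi> s (fst z) (Some (snd z)))) \<in> borel_measurable (?L \<Otimes>\<^sub>M ?K)"
    using flow_time_measurable[OF f(1)] measurable_cong_sets[OF sets refl] by blast
  have bd: "\<bar>lift f (\<phi> s \<omega> (Some y))\<bar> \<le> K" if "s \<in> T" "\<omega> \<in> \<Omega>" "y \<in> M" for s \<omega> y
    using flow_in_ext[of s \<omega> "Some y"] that f(2) K by (auto split: option.splits)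
  have int: "integrable (?L \<Otimes>\<^sub>M ?K) (\<lambda>(z, s). lift f (\<phi> s (fst z) (Some (snd z))))"
    using bd by (intro integrable_const_bound[of _ K] m) (auto simp: space_pair_measure spL)
  have inner: "(LINT z|?L. lift f (\<phi> s (fst z) (Some (snd z)))) = h s" if s: "s \<in> T" for s
  proof -
    have "(\<lambda>z. lift f (\<phi> s (fst z) (Some (snd z)))) \<in> borel_measurable (\<F> \<Otimes>\<^sub>M \<B>)"
      using measurable_compose[OF measurable_pair_past_full[OF flow_Some_measurable[OF s]] ext_measurable_lift1[OF f(1)]]
      by (simp add: case_prod_beta')
    then show ?thesis unfolding h_def by (subst integral_survival_law[OF t(1) x pos]) auto
  qed
  have "(LINT z|?L. time_average S f t z) = (LINT z|?L. LINT s|?K. lift f (\<phi> s (fst z) (Some (snd z))))"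
  proof (intro Bochner_Integration.integral_cong refl)
    fix z assume z: "z \<in> space ?L"
    have "(\<lambda>s. lift f (\<phi> s (fst z) (Some (snd z)))) \<in> borel_measurable ?K"
      using measurable_compose[OF measurable_Pair1'[OF z] m] by simp
    from integral_averaging[OF t this]
    show "time_average S f t z = (LINT s|?K. lift f (\<phi> s (fst z) (Some (snd z))))"
      by (simp add: time_average_def case_prod_beta')
  qed
  also have "\<dots> = (LINT s|?K. LINT z|?L. lift f (\<phi> s (fst z) (Some (snd z))))"
    using Fubini_integral[OF int] by simp
  also have "\<dots> = (LINT s|?K. h s)"
    by (intro Bochner_Integration.integral_cong refl) (simp add: inner)
  finally show "(LINT z|?L. time_average S f t z) = (LINT s|?K. h s)" .
  have "(\<lambda>s. LINT z|?L. lift f (\<phi> s (fst z) (Some (snd z)))) \<in> borel_measurable ?K"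
    using L.borel_measurable_lebesgue_integral[of "\<lambda>s z. lift f (\<phi> s (fst z) (Some (snd z)))" ?K]
      measurable_compose[OF measurable_pair_swap' m] by (simp add: case_prod_beta')
  then show "h \<in> borel_measurable ?K"
    using inner by (subst measurable_cong[of _ _ "\<lambda>s. LINT z|?L. lift f (\<phi> s (fst z) (Some (snd z)))"]) auto
qed

lemma filterlim_time_sum: "filterlim (\<lambda>z. fst z + snd z) (time_at_top S) (time_at_top S \<times>\<^sub>F time_at_top S)"
  unfolding filterlim_iff
proof safe
  fix R assume "eventually R (time_at_top S)"
  then obtain t0 where t0: "\<And>t. t \<in> T \<Longrightarrow> t0 \<le> t \<Longrightarrow> R t" by (auto simp: eventually_time_at_top)
  have "\<forall>\<^sub>F s in time_at_top S. s \<in> T \<and> t0 \<le> s" unfolding eventually_time_at_top by auto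
  then show "\<forall>\<^sub>F z in time_at_top S \<times>\<^sub>F time_at_top S. R (fst z + snd z)"
    unfolding eventually_prod_filter using eventually_in_time t0 time_add time_nonneg
    by (intro exI[of _ "\<lambda>s. s \<in> T \<and> t0 \<le> s"] exI[of _ "\<lambda>s. s \<in> T"]) (auto simp: add_increasing2)
qed

end

context conditioned_rds
begin

text \<open>At a time \<open>s\<close> that is far from both ends of a surviving path of length \<open>s + r\<close>, the position is
distributed approximately as \<open>\<eta> \<mu>\<close>: the first stretch brings in \<open>\<mu>\<close>, survival during the second
stretch the weight \<open>\<eta>\<close>. The limit is taken jointly in \<open>s\<close> and \<open>r\<close>, as the time average contains all splittings
of \<open>t\<close>.\<close>

lemma conditioned_position_tendsto:
  fixes f :: "'a \<Rightarrow> real"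
  assumes x: "x \<in> M" and f: "f \<in> borel_measurable \<B>" "\<And>y. y \<in> M \<Longrightarrow> 0 \<le> f y" "\<And>y. y \<in> M \<Longrightarrow> f y \<le> 1"
  shows "((\<lambda>z. (LINT \<omega>|P. lift f (\<phi> (fst z) \<omega> (Some x)) * alive (\<phi> (fst z + snd z) \<omega> (Some x)))
      / transition (fst z + snd z) alive (Some x)) \<longlongrightarrow> (LINT y|\<mu>. f y * \<eta> y))
    (time_at_top S \<times>\<^sub>F time_at_top S)"
proof -
  let ?F = "time_at_top S \<times>\<^sub>F time_at_top S" and ?x = "Some x"
  have y: "?x \<in> ext_phase S" using x by simp
  have lf: "lift f \<in> borel_measurable \<E>" by (rule ext_measurable_lift1[OF f(1)])
  have lf0: "0 \<le> lift f y" if "y \<in> ext_phase S" for y using f that by (cases y) auto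
  have lf1: "lift f y \<le> alive y" if "y \<in> ext_phase S" for y using f that by (cases y) auto
  have lfb: "\<bar>lift f y\<bar> \<le> 1" if "y \<in> ext_phase S" for y
    using lf0[OF that] lf1[OF that] alive_bound[of y] by linarith
  have "((\<lambda>t. exp (\<beta> * t) * transition t (lift (\<lambda>y. f y * \<eta> y)) ?x) \<longlongrightarrow> \<eta> x * (LINT y|\<mu>. f y * \<eta> y)) (time_at_top S)"
  proof (rule transition_tendsto[OF x, where K = eta_sup])
    show "(\<lambda>y. f y * \<eta> y) \<in> borel_measurable \<B>" using f(1) by measurable
    show "0 \<le> f y * \<eta> y" if "y \<in> M" for y using f(2) eta_pos that by (intro mult_nonneg_nonneg) (auto intro: less_imp_le)
    show "f y * \<eta> y \<le> eta_sup" if "y \<in> M" for y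
      using mult_mono[OF f(3)[OF that] eta_le[OF that]] eta_pos[OF that] by simp
  qed
  then have A: "((\<lambda>z. exp (\<beta> * fst z) * transition (fst z) (lift (\<lambda>y. f y * \<eta> y)) ?x) \<longlongrightarrow> \<eta> x * (LINT y|\<mu>. f y * \<eta> y)) ?F"
    by (rule filterlim_compose[OF _ filterlim_fst])
  have "((\<lambda>z. exp (\<beta> * fst z) * transition (fst z) alive ?x * survival_error (snd z)) \<longlongrightarrow> \<eta> x * 0) ?F"
    by (intro tendsto_mult filterlim_compose[OF survival_tendsto[OF x] filterlim_fst]
        filterlim_compose[OF survival_error_tendsto filterlim_snd])
  then have B: "((\<lambda>z. exp (\<beta> * fst z) * transition (fst z) alive ?x * survival_error (snd z)) \<longlongrightarrow> 0) ?F" by simp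
  have inT: "\<forall>\<^sub>F z in ?F. fst z \<in> T \<and> snd z \<in> T"
    unfolding eventually_prod_filter using eventually_in_time
    by (intro exI[of _ "\<lambda>s. s \<in> T"]) auto
  \<comment> \<open>the numerator, rescaled by the decay of the survival probability\<close>
  define G where "G z = exp (\<beta> * (fst z + snd z)) * (LINT \<omega>|P. lift f (\<phi> (fst z) \<omega> ?x) * alive (\<phi> (fst z + snd z) \<omega> ?x))" for z
  have "((\<lambda>z. G z - exp (\<beta> * fst z) * transition (fst z) (lift (\<lambda>y. f y * \<eta> y)) ?x) \<longlongrightarrow> 0) ?F"
  proof (rule Lim_null_comparison[OF _ B], rule eventually_mono[OF inT])
    fix z :: "real \<times> real" assume z: "fst z \<in> T \<and> snd z \<in> T"
    define s r where "s = fst z" "r = snd z"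
    have s: "s \<in> T" and r: "r \<in> T" using z by (auto simp: s_r_def)
    define a where "a \<omega> = lift f (\<phi> s \<omega> ?x)" for \<omega>
    have a: "a \<in> borel_measurable (\<P> s)"
      unfolding a_def by (rule measurable_compose[OF flow_measurable_at[OF s y] lf])
    have ab: "\<bar>a \<omega>\<bar> \<le> 1" if "\<omega> \<in> \<Omega>" for \<omega> unfolding a_def by (rule lfb[OF flow_in_ext[OF s that y]])
    have "G z = exp (\<beta> * s) * (exp (\<beta> * r) * (LINT \<omega>|P. a \<omega> * transition r alive (\<phi> s \<omega> ?x)))"
      using weighted_markov[OF r s y a ab alive_measurable alive_bound(1)]
      unfolding G_def s_r_def[symmetric] a_def by (simp add: distrib_left exp_add add.commute)
    moreover have "transition s (lift (\<lambda>y. f y * \<eta> y)) ?x = (LINT \<omega>|P. a \<omega> * lift \<eta> (\<phi> s \<omega> ?x))"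
      unfolding transition_def a_def by (intro Bochner_Integration.integral_cong refl) (auto split: option.splits)
    ultimately have eq: "G z - exp (\<beta> * s) * transition s (lift (\<lambda>y. f y * \<eta> y)) ?x =
      exp (\<beta> * s) * (exp (\<beta> * r) * (LINT \<omega>|P. a \<omega> * transition r alive (\<phi> s \<omega> ?x)) - (LINT \<omega>|P. a \<omega> * lift \<eta> (\<phi> s \<omega> ?x)))"
      by (simp add: right_diff_distrib)
    have "(LINT \<omega>|P. \<bar>a \<omega>\<bar>) = transition s (lift f) ?x"
      unfolding transition_def a_def using lf0[OF flow_in_ext[OF s _ y]]
      by (intro Bochner_Integration.integral_cong refl) auto
    also have "\<dots> \<le> transition s alive ?x"
      by (rule transition_mono[OF s y lf lfb alive_measurable alive_bound(1) lf1])
    finally have le: "(LINT \<omega>|P. \<bar>a \<omega>\<bar>) * survival_error r \<le> transition s alive ?x * survival_error r"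
      using survival_error_nonneg[OF r] by (rule mult_right_mono)
    have "\<bar>exp (\<beta> * r) * (LINT \<omega>|P. a \<omega> * transition r alive (\<phi> s \<omega> ?x)) - (LINT \<omega>|P. a \<omega> * lift \<eta> (\<phi> s \<omega> ?x))\<bar>
      \<le> transition s alive ?x * survival_error r"
      by (rule order_trans[OF weighted_survival_error[OF s r y measurable_past_full[OF a] ab] le])
    then have "exp (\<beta> * s) * \<bar>exp (\<beta> * r) * (LINT \<omega>|P. a \<omega> * transition r alive (\<phi> s \<omega> ?x)) - (LINT \<omega>|P. a \<omega> * lift \<eta> (\<phi> s \<omega> ?x))\<bar>
      \<le> exp (\<beta> * s) * (transition s alive ?x * survival_error r)"
      by (rule mult_left_mono) simp
    then have "norm (G z - exp (\<beta> * s) * transition s (lift (\<lambda>y. f y * \<eta> y)) ?x) \<le> exp (\<beta> * s) * transition s alive ?x * survival_error r"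
      unfolding eq by (simp add: abs_mult)
    then show "norm (G z - exp (\<beta> * fst z) * transition (fst z) (lift (\<lambda>y. f y * \<eta> y)) ?x)
      \<le> exp (\<beta> * fst z) * transition (fst z) alive ?x * survival_error (snd z)"
      by (simp add: s_r_def)
  qed
  from Lim_transform[OF A this] have G: "(G \<longlongrightarrow> \<eta> x * (LINT y|\<mu>. f y * \<eta> y)) ?F" .
  have "((\<lambda>z. exp (\<beta> * (fst z + snd z)) * transition (fst z + snd z) alive ?x) \<longlongrightarrow> \<eta> x) ?F"
    by (rule filterlim_compose[OF survival_tendsto[OF x] filterlim_time_sum])
  from tendsto_divide[OF G this] eta_pos[OF x]
  show ?thesis by (simp add: G_def)
qed

lemma quasi_ergodic_limit:
  fixes f :: "'a \<Rightarrow> real"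
  assumes x: "x \<in> M" and f: "f \<in> borel_measurable \<B>" "\<And>y. y \<in> M \<Longrightarrow> 0 \<le> f y" "\<And>y. y \<in> M \<Longrightarrow> f y \<le> 1"
  shows "((\<lambda>t. LINT z|survival_law S (start_law S x) t. time_average S f t z) \<longlongrightarrow> (LINT y|\<mu>. f y * \<eta> y)) (time_at_top S)"
proof (rule tendstoI)
  fix e :: real assume e: "0 < e"
  let ?l = "LINT y|\<mu>. f y * \<eta> y" and ?x = "Some x"
  have y: "?x \<in> ext_phase S" using x by simp
  have lf: "lift f \<in> borel_measurable \<E>" by (rule ext_measurable_lift1[OF f(1)])
  have lf0: "0 \<le> lift f y" if "y \<in> ext_phase S" for y using f that by (cases y) auto
  have lf1: "lift f y \<le> 1" if "y \<in> ext_phase S" for y using f that by (cases y) auto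
  define h where "h t s = (LINT \<omega>|P. lift f (\<phi> s \<omega> ?x) * alive (\<phi> t \<omega> ?x)) / transition t alive ?x" for t s
  have "\<forall>\<^sub>F z in time_at_top S \<times>\<^sub>F time_at_top S. dist (h (fst z + snd z) (fst z)) ?l < e / 2"
    unfolding h_def by (rule tendstoD[OF conditioned_position_tendsto[OF x f]]) (use e in auto)
  then obtain Pf Pg where "eventually Pf (time_at_top S)" "eventually Pg (time_at_top S)"
    and P: "\<And>s r. Pf s \<Longrightarrow> Pg r \<Longrightarrow> dist (h (s + r) s) ?l < e / 2"
    unfolding eventually_prod_filter by auto
  then obtain t1 t2 where t12: "\<And>t. t \<in> T \<Longrightarrow> t1 \<le> t \<Longrightarrow> Pf t" "\<And>t. t \<in> T \<Longrightarrow> t2 \<le> t \<Longrightarrow> Pg t"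
    unfolding eventually_time_at_top by blast
  define R where "R = real (nat \<lceil>max t1 t2\<rceil>)"
  have R: "R \<in> T" "t1 \<le> R" "t2 \<le> R" unfolding R_def using time_of_nat by (auto) linarith+
  define b where "b = 1 + \<bar>?l\<bar>"
  have lim: "((\<lambda>t. b * (2 * R / t)) \<longlongrightarrow> 0) (time_at_top S)"
  proof -
    have "((\<lambda>t. b * (2 * R / t)) \<longlongrightarrow> 0) at_top"
      by (intro tendsto_mult_right_zero tendsto_divide_0[OF tendsto_const] filterlim_at_top_imp_at_infinity filterlim_ident)
    then show ?thesis unfolding time_at_top_def by (rule filterlim_mono) auto
  qed
  then have "\<forall>\<^sub>F t in time_at_top S. b * (2 * R / t) < e / 2"
    using e by (intro order_tendstoD(2)) auto
  moreover have "\<forall>\<^sub>F t in time_at_top S. R \<le> t \<and> 0 < t"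
    unfolding eventually_time_at_top by (intro exI[of _ "max R 1"]) auto
  ultimately show "\<forall>\<^sub>F t in time_at_top S. dist (LINT z|survival_law S (start_law S x) t. time_average S f t z) ?l < e"
    using survival_pos[OF x]
  proof eventually_elim
    case (elim t)
    then have t: "t \<in> T" "0 < t" and pos: "0 < transition t alive ?x" and Rt: "R \<le> t" by auto
    note ta = integral_time_average[OF t x pos f(1), of 1, folded h_def]
    have fb: "\<bar>f y\<bar> \<le> 1" if "y \<in> M" for y using f that by simp
    have h01: "0 \<le> h t s \<and> h t s \<le> 1" if s: "s \<in> T" for s
    proof -
      have i: "integrable P (\<lambda>\<omega>. lift f (\<phi> s \<omega> ?x) * alive (\<phi> t \<omega> ?x))"
        using lf0 lf1 flow_in_ext[OF s _ y] alive_bound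
        by (intro integrable_flow[OF t(1) y, where K = 1 and L = 1]
            measurable_past_full[OF measurable_compose[OF flow_measurable_at[OF s y] lf]]) auto
      have "0 \<le> (LINT \<omega>|P. lift f (\<phi> s \<omega> ?x) * alive (\<phi> t \<omega> ?x))"
        using lf0[OF flow_in_ext[OF s _ y]] alive_bound
        by (intro integral_nonneg_AE AE_I2 mult_nonneg_nonneg) auto
      moreover have "(LINT \<omega>|P. lift f (\<phi> s \<omega> ?x) * alive (\<phi> t \<omega> ?x)) \<le> transition t alive ?x"
        unfolding transition_def
        using lf0[OF flow_in_ext[OF s _ y]] lf1[OF flow_in_ext[OF s _ y]] alive_bound
        by (intro integral_mono i integrable_flow1[OF t(1) y alive_measurable, of 1]) (auto intro!: mult_left_le_one_le mult_left_le)
      ultimately show ?thesis using pos by (simp add: h_def)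
    qed
    have "\<bar>(LINT s|averaging_measure t. h t s) - ?l\<bar> \<le> e / 2 + b * (2 * R / t)"
    proof (rule averaging_estimate[OF t R(1) Rt])
      show "h t \<in> borel_measurable (averaging_measure t)" using ta(2) fb by (simp add: h_def[abs_def])
      show "\<bar>h t s - ?l\<bar> \<le> b" if "s \<in> window t" for s
        using h01[of s] window_in_time[OF that] unfolding b_def by linarith
      show "\<bar>h t s - ?l\<bar> \<le> e / 2" if "s \<in> T" "R \<le> s" "R \<le> t - s" for s
      proof -
        have "t - s \<in> T" using that time_nonneg[OF R(1)] by (intro time_diff t) auto
        then have "dist (h (s + (t - s)) s) ?l < e / 2"
          using that R by (intro P t12) auto
        then show ?thesis by (simp add: dist_real_def)
      qed
    qed (use e in \<open>auto simp: b_def\<close>)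
    moreover have "(LINT z|survival_law S (start_law S x) t. time_average S f t z) = (LINT s|averaging_measure t. h t s)"
      using ta(1) fb by (simp add: h_def[abs_def])
    ultimately show ?case using elim by (simp add: dist_real_def)
  qed
qed

text \<open>A quasi-ergodic distribution is determined by the limits of the conditioned time averages, and these
have just been computed.\<close>

lemma quasi_ergodic_eq:
  assumes "quasi_ergodic S \<nu>"
  shows "\<nu> = density \<mu> (\<lambda>y. ennreal (\<eta> y))"
proof (rule measure_eqI)
  have \<nu>: "prob_space \<nu>" "sets \<nu> = sets \<B>" using assms by (auto simp: quasi_ergodic_def)
  interpret nu: prob_space \<nu> by fact
  show "sets \<nu> = sets (density \<mu> (\<lambda>y. ennreal (\<eta> y)))" using \<nu>(2) sets_mu by simp
  fix A assume "A \<in> sets \<nu>"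
  then have A: "A \<in> sets \<B>" using \<nu>(2) by simp
  then have AM: "A \<subseteq> M" using sets.sets_into_space by force
  obtain x where x: "x \<in> M" using phase_nonempty by auto
  have "bounded ((indicator A :: 'a \<Rightarrow> real) ` M)"
    by (rule bounded_subset[of "{0, 1}"]) (auto simp: indicator_def)
  then have "((\<lambda>t. LINT z|survival_law S (start_law S x) t. time_average S (indicator A) t z) \<longlongrightarrow> (LINT y|\<nu>. indicator A y)) (time_at_top S)"
    using assms x borel_measurable_indicator[OF A] unfolding quasi_ergodic_def by blast
  moreover have "((\<lambda>t. LINT z|survival_law S (start_law S x) t. time_average S (indicator A) t z) \<longlongrightarrow> (LINT y|\<mu>. indicator A y * \<eta> y)) (time_at_top S)"
    using A by (intro quasi_ergodic_limit[OF x]) auto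
  ultimately have "(LINT y|\<nu>. indicator A y) = (LINT y|\<mu>. indicator A y * \<eta> y)"
    using tendsto_unique[OF time_at_top_neq_bot] by blast
  moreover have "space \<nu> = M" using sets_eq_imp_space_eq[OF \<nu>(2)] by simp
  ultimately have 1: "measure \<nu> A = (LINT y|\<mu>. indicator A y * \<eta> y)" using AM by (simp add: Int_absorb2)
  have m: "(\<lambda>y. indicator A y * \<eta> y) \<in> borel_measurable \<mu>" using A unfolding measurable_mu by measurable
  have pos: "0 \<le> indicator A y * \<eta> y" if "y \<in> M" for y using eta_pos[OF that] by simp
  have eb: "\<bar>indicator A y * \<eta> y\<bar> \<le> eta_sup" if "y \<in> M" for y
    using lift_eta_bound[of "Some y"] that by (cases "y \<in> A") auto
  have "integrable \<mu> (\<lambda>y. indicator A y * \<eta> y)"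
    using m eb by (intro mu.integrable_const_bound[of _ eta_sup] AE_I2) auto
  then have "(\<integral>\<^sup>+ y. ennreal (indicator A y * \<eta> y) \<partial>\<mu>) = ennreal (LINT y|\<mu>. indicator A y * \<eta> y)"
    using pos by (intro nn_integral_eq_integral AE_I2) auto
  moreover have "emeasure (density \<mu> (\<lambda>y. ennreal (\<eta> y))) A = (\<integral>\<^sup>+ y. ennreal (indicator A y * \<eta> y) \<partial>\<mu>)"
    using A by (subst emeasure_density) (auto simp: sets_mu measurable_mu intro!: nn_integral_cong split: split_indicator)
  ultimately show "emeasure \<nu> A = emeasure (density \<mu> (\<lambda>y. ennreal (\<eta> y))) A"
    using 1 by (simp add: nu.emeasure_eq_measure)
qed

end

section \<open>Past events and preimages under the skew product\<close>

context timed_rds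
begin

text \<open>The events that are determined by the starting point and the noise up to some finite time. The
\<open>Q\<close>-measures are given explicitly on them, and they form an intersection-stable generator.\<close>

definition past_events :: "((real \<Rightarrow> 'x) \<times> 'a) set set" where
  "past_events = (\<Union>s\<in>T. sets (\<P> s \<Otimes>\<^sub>M \<B>))"

lemma past_events_mono: "s \<le> t \<Longrightarrow> sets (\<P> s \<Otimes>\<^sub>M \<B>) \<subseteq> sets (\<P> t \<Otimes>\<^sub>M \<B>)"
  unfolding sets_pair_measure space_past using past_mono[of s t]
  by (intro sigma_sets_mono') auto

lemma past_events_Pow: "past_events \<subseteq> Pow (\<Omega> \<times> M)"
proof
  fix A assume "A \<in> past_events"
  then obtain s where "A \<in> sets (\<P> s \<Otimes>\<^sub>M \<B>)" by (auto simp: past_events_def)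
  from sets.sets_into_space[OF this] show "A \<in> Pow (\<Omega> \<times> M)" by (simp add: space_pair_measure)
qed

lemma past_events_sets: "past_events \<subseteq> sets (\<F> \<Otimes>\<^sub>M \<B>)"
  unfolding past_events_def using pair_past_le_full by blast

lemma past_events_common:
  assumes "s \<in> T" "t \<in> T" "A \<in> sets (\<P> s \<Otimes>\<^sub>M \<B>)" "B \<in> sets (\<P> t \<Otimes>\<^sub>M \<B>)"
  shows "\<exists>r\<in>T. A \<in> sets (\<P> r \<Otimes>\<^sub>M \<B>) \<and> B \<in> sets (\<P> r \<Otimes>\<^sub>M \<B>)"
proof (cases "s \<le> t")
  case True
  then show ?thesis using past_events_mono[of s t] assms by blast
next
  case False
  then show ?thesis using past_events_mono[of t s] assms by (intro bexI[of _ s]) auto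
qed

lemma Int_stable_past_events: "Int_stable past_events"
proof (rule Int_stableI)
  fix A B assume "A \<in> past_events" "B \<in> past_events"
  then obtain r where "r \<in> T" "A \<in> sets (\<P> r \<Otimes>\<^sub>M \<B>)" "B \<in> sets (\<P> r \<Otimes>\<^sub>M \<B>)"
    unfolding past_events_def using past_events_common by (elim UN_E) blast
  then show "A \<inter> B \<in> past_events" unfolding past_events_def by blast
qed

lemma space_past_events: "\<Omega> \<times> M \<in> past_events"
  using sets.top[of "\<P> 0 \<Otimes>\<^sub>M \<B>"] time_zero unfolding past_events_def by (auto simp: space_pair_measure)

lemma sets_full_past_events: "sets (\<F> \<Otimes>\<^sub>M \<B>) = sigma_sets (\<Omega> \<times> M) past_events"
proof
  let ?G = "sigma (\<Omega> \<times> M) past_events"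
  have spG: "space ?G = \<Omega> \<times> M" and setsG: "sets ?G = sigma_sets (\<Omega> \<times> M) past_events"
    using past_events_Pow by (auto simp: space_measure_of sets_measure_of)
  have fst: "fst \<in> ?G \<rightarrow>\<^sub>M \<F>"
    unfolding full_algebra_def coordinate_algebra_def
  proof (rule measurable_measure_of)
    fix A assume "A \<in> {(\<lambda>\<omega>. \<omega> s) -` B \<inter> \<Omega> |s B. s \<in> T \<and> B \<in> sets borel}"
    then obtain s B where s: "s \<in> T" "B \<in> sets borel" and A: "A = (\<lambda>\<omega>. \<omega> s) -` B \<inter> \<Omega>" by auto
    have "A \<in> sets (\<P> s)"
      unfolding past_algebra_def sets_coordinate_algebra A using s by (intro sigma_sets.Basic) auto
    then have "A \<times> M \<in> sets (\<P> s \<Otimes>\<^sub>M \<B>)" using sets.top[of \<B>] by (intro pair_measureI) auto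
    then have "A \<times> M \<in> past_events" unfolding past_events_def using s by blast
    then have "A \<times> M \<in> sets ?G" unfolding setsG by (rule sigma_sets.Basic)
    moreover have "fst -` A \<inter> space ?G = A \<times> M" unfolding spG A by auto
    ultimately show "fst -` A \<inter> space ?G \<in> sets ?G" by simp
  qed (auto simp: spG)
  have snd: "snd \<in> ?G \<rightarrow>\<^sub>M \<B>"
  proof (rule measurableI)
    fix A assume A: "A \<in> sets \<B>"
    then have "\<Omega> \<times> A \<in> sets (\<P> 0 \<Otimes>\<^sub>M \<B>)" using sets.top[of "\<P> 0"] by (intro pair_measureI) auto
    then have "\<Omega> \<times> A \<in> past_events" unfolding past_events_def using time_zero by blast
    then have "\<Omega> \<times> A \<in> sets ?G" unfolding setsG by (rule sigma_sets.Basic)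
    moreover have "snd -` A \<inter> space ?G = \<Omega> \<times> A" using sets.sets_into_space[OF A] unfolding spG by auto
    ultimately show "snd -` A \<inter> space ?G \<in> sets ?G" by simp
  qed (auto simp: spG)
  have "(\<lambda>z. (fst z, snd z)) \<in> ?G \<rightarrow>\<^sub>M \<F> \<Otimes>\<^sub>M \<B>" using fst snd by (rule measurable_Pair)
  then have id: "(\<lambda>z. z) \<in> ?G \<rightarrow>\<^sub>M \<F> \<Otimes>\<^sub>M \<B>" by simp
  show "sets (\<F> \<Otimes>\<^sub>M \<B>) \<subseteq> sigma_sets (\<Omega> \<times> M) past_events"
  proof
    fix A assume A: "A \<in> sets (\<F> \<Otimes>\<^sub>M \<B>)"
    then have "A \<subseteq> \<Omega> \<times> M" using sets.sets_into_space[OF A] by (simp add: space_pair_measure)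
    then have "(\<lambda>z. z) -` A \<inter> space ?G = A" unfolding spG by auto
    then show "A \<in> sigma_sets (\<Omega> \<times> M) past_events" using measurable_sets[OF id A] setsG by simp
  qed
  show "sigma_sets (\<Omega> \<times> M) past_events \<subseteq> sets (\<F> \<Otimes>\<^sub>M \<B>)"
    using sets.sigma_sets_subset[OF past_events_sets] by (simp add: space_pair_measure)
qed

text \<open>A measurable map of \<open>\<Omega> \<times> M\<close> into itself that agrees with the skew product on the event of survival. It
reduces statements about preimages to measurability of an ordinary map.\<close>

definition skew_retract :: "'a \<Rightarrow> real \<Rightarrow> (real \<Rightarrow> 'x) \<times> 'a \<Rightarrow> (real \<Rightarrow> 'x) \<times> 'a" where
  "skew_retract x0 t z = (\<theta> t (fst z), retract x0 (\<phi> t (fst z) (Some (snd z))))"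

lemma skew_retract_past:
  assumes x0: "x0 \<in> M" and r: "r \<in> T" and t: "t \<in> T"
  shows "skew_retract x0 t \<in> \<P> (r + t) \<Otimes>\<^sub>M \<B> \<rightarrow>\<^sub>M \<P> r \<Otimes>\<^sub>M \<B>"
proof -
  have tr: "t \<le> r + t" using time_nonneg[OF r] by simp
  have 1: "(\<lambda>z. \<theta> t (fst z)) \<in> \<P> (r + t) \<Otimes>\<^sub>M \<B> \<rightarrow>\<^sub>M \<P> r"
    using measurable_compose[OF measurable_fst shift_measurable_past[OF r t]] .
  have "(\<lambda>z. (fst z, snd z)) \<in> \<P> (r + t) \<Otimes>\<^sub>M \<B> \<rightarrow>\<^sub>M \<P> t \<Otimes>\<^sub>M \<B>"
    using measurable_compose[OF measurable_fst id_past_past[OF tr]] by (intro measurable_Pair) auto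
  from measurable_compose[OF this flow_Some_measurable[OF t]]
  have "(\<lambda>z. \<phi> t (fst z) (Some (snd z))) \<in> \<P> (r + t) \<Otimes>\<^sub>M \<B> \<rightarrow>\<^sub>M \<E>" by simp
  from measurable_Pair[OF 1 measurable_compose[OF this retract_measurable[OF x0]]]
  show ?thesis by (simp add: skew_retract_def[abs_def])
qed

lemma skew_retract_full:
  assumes x0: "x0 \<in> M" and t: "t \<in> T"
  shows "skew_retract x0 t \<in> \<F> \<Otimes>\<^sub>M \<B> \<rightarrow>\<^sub>M \<F> \<Otimes>\<^sub>M \<B>"
proof -
  have 1: "(\<lambda>z. \<theta> t (fst z)) \<in> \<F> \<Otimes>\<^sub>M \<B> \<rightarrow>\<^sub>M \<F>"
    using measurable_compose[OF measurable_fst shift_measurable_full[OF t]] .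
  have "(\<lambda>z. \<phi> t (fst z) (Some (snd z))) \<in> \<F> \<Otimes>\<^sub>M \<B> \<rightarrow>\<^sub>M \<E>"
    using measurable_pair_past_full[OF flow_Some_measurable[OF t]] by (simp add: case_prod_beta')
  from measurable_Pair[OF 1 measurable_compose[OF this retract_measurable[OF x0]]]
  show ?thesis by (simp add: skew_retract_def[abs_def])
qed

lemma skew_preimage_iff:
  "(\<omega>, x) \<in> skew_preimage S t A \<longleftrightarrow> \<omega> \<in> \<Omega> \<and> x \<in> M \<and> (\<exists>y. \<phi> t \<omega> (Some x) = Some y \<and> (\<theta> t \<omega>, y) \<in> A)"
  by (auto simp: skew_preimage_def skew_product_def image_iff) force+

lemma skew_preimage_eq:
  assumes t: "t \<in> T"
  shows "skew_preimage S t A = skew_retract x0 t -` A \<inter> (\<Omega> \<times> M) \<inter> survival_event t"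
proof (intro set_eqI, safe)
qed (auto simp: skew_preimage_iff survival_event_iff[OF t] skew_retract_def retract_def)

lemma skew_preimage_past:
  assumes r: "r \<in> T" and t: "t \<in> T" and A: "A \<in> sets (\<P> r \<Otimes>\<^sub>M \<B>)"
  shows "skew_preimage S t A \<in> sets (\<P> (r + t) \<Otimes>\<^sub>M \<B>)"
proof (cases "M = {}")
  case True
  then have "skew_preimage S t A = {}" by (auto simp: skew_preimage_def)
  then show ?thesis by simp
next
  case False
  then obtain x0 where x0: "x0 \<in> M" by auto
  have "t \<le> r + t" using time_nonneg[OF r] by simp
  then have "survival_event t \<in> sets (\<P> (r + t) \<Otimes>\<^sub>M \<B>)"
    using survival_event_sets[OF t] past_events_mono by blast
  then show ?thesis
    using measurable_sets[OF skew_retract_past[OF x0 r t] A]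
    unfolding skew_preimage_eq[OF t, of A x0] by (auto simp: space_pair_measure)
qed

lemma skew_preimage_full:
  assumes t: "t \<in> T" and A: "A \<in> sets (\<F> \<Otimes>\<^sub>M \<B>)"
  shows "skew_preimage S t A \<in> sets (\<F> \<Otimes>\<^sub>M \<B>)"
proof (cases "M = {}")
  case True
  then have "skew_preimage S t A = {}" by (auto simp: skew_preimage_def)
  then show ?thesis by simp
next
  case False
  then obtain x0 where x0: "x0 \<in> M" by auto
  have "survival_event t \<in> sets (\<F> \<Otimes>\<^sub>M \<B>)"
    using survival_event_sets[OF t] pair_past_le_full by blast
  then show ?thesis
    using measurable_sets[OF skew_retract_full[OF x0 t] A]
    unfolding skew_preimage_eq[OF t, of A x0] by (auto simp: space_pair_measure)
qed

lemma skew_preimage_Un: "skew_preimage S t (A \<union> B) = skew_preimage S t A \<union> skew_preimage S t B"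
  and skew_preimage_disjoint: "A \<inter> B = {} \<Longrightarrow> skew_preimage S t A \<inter> skew_preimage S t B = {}"
  by (auto simp: skew_preimage_iff disjoint_iff)

end

section \<open>Invariance and mixing of the averaged Q-measure\<close>

locale Q_process = conditioned_rds d S \<mu> \<eta> \<beta>
  for d and S :: "('x::topological_space, 'a::euclidean_space) rds" and \<mu> \<eta> \<beta> +
  fixes Q :: "'a \<Rightarrow> ((real \<Rightarrow> 'x) \<times> 'a) measure"
  assumes Q: "\<And>x. x \<in> M \<Longrightarrow> Q_measure S x (Q x)"
begin

lemma prob_Q: "x \<in> M \<Longrightarrow> prob_space (Q x)" and sets_Q: "x \<in> M \<Longrightarrow> sets (Q x) = sets (\<F> \<Otimes>\<^sub>M \<B>)"
  using Q by (auto simp: Q_measure_def)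

text \<open>On events up to time \<open>s\<close> the \<open>Q\<close>-measure is Doob's \<open>\<eta>\<close>-transform of the law of the path: it has density
\<open>exp (\<beta> * s) * lift \<eta> (\<phi> s \<omega> (Some x)) / \<eta> x\<close>.\<close>

lemma Q_formula:
  assumes s: "s \<in> T" and x: "x \<in> M" and A: "A \<in> sets (\<P> s \<Otimes>\<^sub>M \<B>)"
  shows "\<eta> x * measure (Q x) A = exp (\<beta> * s) * (LINT \<omega>|P. indicator A (\<omega>, x) * lift \<eta> (\<phi> s \<omega> (Some x)))"
proof -
  have "(\<lambda>\<omega>. (\<omega>, x)) \<in> \<P> s \<rightarrow>\<^sub>M \<P> s \<Otimes>\<^sub>M \<B>" using measurable_Pair2'[of x \<B> "\<P> s"] x by simp
  from measurable_compose[OF this borel_measurable_indicator[OF A]]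
  have a: "(\<lambda>\<omega>. indicator A (\<omega>, x) :: real) \<in> borel_measurable (\<P> s)" .
  have lim: "((\<lambda>t. exp (\<beta> * t) * (LINT \<omega>|P. indicator A (\<omega>, x) * alive (\<phi> t \<omega> (Some x)))) \<longlongrightarrow>
    exp (\<beta> * s) * (LINT \<omega>|P. indicator A (\<omega>, x) * lift \<eta> (\<phi> s \<omega> (Some x)))) (time_at_top S)"
    by (rule weighted_survival_tendsto[OF s x a, of 1]) (simp add: indicator_def)
  have "((\<lambda>t. measure (survival_law S (start_law S x) t) A) \<longlongrightarrow> measure (Q x) A) (time_at_top S)"
    using Q[OF x] s A by (auto simp: Q_measure_def)
  then have lim2: "((\<lambda>t. exp (\<beta> * t) * transition t alive (Some x) * measure (survival_law S (start_law S x) t) A) \<longlongrightarrow> \<eta> x * measure (Q x) A) (time_at_top S)"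
    by (intro tendsto_mult survival_tendsto[OF x])
  have "\<forall>\<^sub>F t in time_at_top S. exp (\<beta> * t) * transition t alive (Some x) * measure (survival_law S (start_law S x) t) A
    = exp (\<beta> * t) * (LINT \<omega>|P. indicator A (\<omega>, x) * alive (\<phi> t \<omega> (Some x)))"
    using survival_pos[OF x]
  proof eventually_elim
    case (elim t)
    then have t: "t \<in> T" and pos: "0 < transition t alive (Some x)" by auto
    have "A \<in> sets (\<F> \<Otimes>\<^sub>M \<B>)" using A pair_past_le_full by blast
    from measure_survival_law[OF t x pos this] pos show ?case by simp
  qed
  from tendsto_cong[OF this] lim2
  have "((\<lambda>t. exp (\<beta> * t) * (LINT \<omega>|P. indicator A (\<omega>, x) * alive (\<phi> t \<omega> (Some x)))) \<longlongrightarrow> \<eta> x * measure (Q x) A) (time_at_top S)"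
    by (rule iffD1)
  from tendsto_unique[OF time_at_top_neq_bot this lim] show ?thesis .
qed

lemma Q_measurable: "Q \<in> \<B> \<rightarrow>\<^sub>M prob_algebra (\<F> \<Otimes>\<^sub>M \<B>)"
proof (rule measurable_prob_algebra_generated[OF sets_full_past_events Int_stable_past_events past_events_Pow])
  fix A assume "A \<in> past_events"
  then obtain s where s: "s \<in> T" and A: "A \<in> sets (\<P> s \<Otimes>\<^sub>M \<B>)" by (auto simp: past_events_def)
  note [measurable] = A flow_Some_measurable[OF s]
  have "(\<lambda>(\<omega>, x). indicator A (\<omega>, x) * lift \<eta> (\<phi> s \<omega> (Some x))) \<in> borel_measurable (\<P> s \<Otimes>\<^sub>M \<B>)"
    using borel_measurable_times[OF borel_measurable_indicator[OF A]
        measurable_compose[OF flow_Some_measurable[OF s] lift_eta_measurable]]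
    by (simp add: case_prod_beta')
  from noise_integral_measurable[OF this]
  have "(\<lambda>x. ennreal (exp (\<beta> * s) * (LINT \<omega>|P. indicator A (\<omega>, x) * lift \<eta> (\<phi> s \<omega> (Some x))) / \<eta> x)) \<in> borel_measurable \<B>"
    by measurable
  moreover have "emeasure (Q x) A = ennreal (exp (\<beta> * s) * (LINT \<omega>|P. indicator A (\<omega>, x) * lift \<eta> (\<phi> s \<omega> (Some x))) / \<eta> x)"
    if x: "x \<in> M" for x
  proof -
    interpret Qx: prob_space "Q x" by (rule prob_Q[OF x])
    have "measure (Q x) A = exp (\<beta> * s) * (LINT \<omega>|P. indicator A (\<omega>, x) * lift \<eta> (\<phi> s \<omega> (Some x))) / \<eta> x"
      using Q_formula[OF s x A] eta_pos[OF x] by (simp add: field_simps)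
    then show ?thesis by (simp add: Qx.emeasure_eq_measure)
  qed
  ultimately show "(\<lambda>x. emeasure (Q x) A) \<in> borel_measurable \<B>"
    by (subst measurable_cong) auto
qed (use prob_Q sets_Q in auto)

definition nu :: "'a measure" where
  "nu = density \<mu> (\<lambda>y. ennreal (\<eta> y))"

definition Q_nu :: "((real \<Rightarrow> 'x) \<times> 'a) measure" where
  "Q_nu = nu \<bind> Q"

lemma sets_nu: "sets nu = sets \<B>"
  by (simp add: nu_def sets_mu)

lemma integral_nu:
  fixes f :: "'a \<Rightarrow> real"
  assumes "f \<in> borel_measurable \<B>"
  shows "(LINT y|nu. f y) = (LINT y|\<mu>. \<eta> y * f y)"
  unfolding nu_def using assms eta_pos
  by (intro integral_real_density) (auto simp: measurable_mu intro!: AE_I2 less_imp_le)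

lemma prob_nu: "prob_space nu"
proof
  have "(\<integral>\<^sup>+ y. ennreal (\<eta> y) \<partial>\<mu>) = ennreal (LINT y|\<mu>. \<eta> y)"
    using eta_pos lift_eta_bound[of "Some _"]
    by (intro nn_integral_eq_integral mu.integrable_const_bound[of _ eta_sup] AE_I2)
      (auto simp: measurable_mu intro: less_imp_le)
  then have "(\<integral>\<^sup>+ y. ennreal (\<eta> y) \<partial>\<mu>) = 1" using integral_eta by simp
  moreover have "emeasure nu (space nu) = (\<integral>\<^sup>+ y. ennreal (\<eta> y) * indicator (space \<mu>) y \<partial>\<mu>)"
    unfolding nu_def using sets.top[of \<mu>] by (subst emeasure_density) (simp_all add: measurable_mu)
  moreover have "\<dots> = (\<integral>\<^sup>+ y. ennreal (\<eta> y) \<partial>\<mu>)" by (intro nn_integral_cong) simp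
  ultimately show "emeasure nu (space nu) = 1" by simp
qed

lemma nu_in_prob_algebra: "nu \<in> space (prob_algebra \<B>)"
  using prob_nu sets_nu by (simp add: space_prob_algebra)

lemma prob_Q_nu: "prob_space Q_nu"
  unfolding Q_nu_def by (rule prob_space_bind'[OF nu_in_prob_algebra Q_measurable])

lemma sets_Q_nu: "sets Q_nu = sets (\<F> \<Otimes>\<^sub>M \<B>)"
  unfolding Q_nu_def by (rule sets_bind'[OF nu_in_prob_algebra Q_measurable])

lemma space_Q_nu: "space Q_nu = \<Omega> \<times> M"
  using sets_eq_imp_space_eq[OF sets_Q_nu] by (simp add: space_pair_measure)

lemma measure_Q_measurable:
  assumes "A \<in> sets (\<F> \<Otimes>\<^sub>M \<B>)" shows "(\<lambda>x. measure (Q x) A) \<in> borel_measurable \<B>"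
  using measurable_compose[OF measurable_prob_algebraD[OF Q_measurable] measurable_measure_subprob_algebra[OF assms]] .

lemma measure_Q_nu:
  assumes A: "A \<in> sets (\<F> \<Otimes>\<^sub>M \<B>)"
  shows "measure Q_nu A = (LINT x|\<mu>. \<eta> x * measure (Q x) A)"
proof -
  interpret nu: prob_space nu by (rule prob_nu)
  have "Q \<in> nu \<rightarrow>\<^sub>M subprob_algebra (\<F> \<Otimes>\<^sub>M \<B>)"
    using measurable_prob_algebraD[OF Q_measurable] unfolding measurable_cong_sets[OF sets_nu refl] .
  then have "measure Q_nu A = (LINT x|nu. measure (Q x) A)"
    unfolding Q_nu_def using A by (rule nu.measure_bind)
  then show ?thesis using integral_nu[OF measure_Q_measurable[OF A]] by simp
qed

text \<open>The Markov property of the \<open>Q\<close>-process. Multiplied by \<open>\<eta> x\<close> it involves only the original semigroup, which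
is why \<open>\<eta> x * measure (Q x) A\<close> rather than \<open>measure (Q x) A\<close> is carried along.\<close>

lemma Q_markov:
  assumes r: "r \<in> T" and t: "t \<in> T" and x: "x \<in> M"
    and A: "A \<in> sets (\<P> t \<Otimes>\<^sub>M \<B>)" and B: "B \<in> sets (\<P> r \<Otimes>\<^sub>M \<B>)"
  shows "\<eta> x * measure (Q x) (A \<inter> skew_preimage S t B) =
    exp (\<beta> * t) * (LINT \<omega>|P. indicator A (\<omega>, x) * lift (\<lambda>y. \<eta> y * measure (Q y) B) (\<phi> t \<omega> (Some x)))"
proof -
  have y: "Some x \<in> ext_phase S" using x by simp
  have tr: "t \<le> r + t" using time_nonneg[OF r] by simp
  \<comment> \<open>the integrand of \<open>Q_formula\<close> for \<open>B\<close>, as a function of the future noise and the present position\<close>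
  define Y where "Y \<omega> z = case_option 0 (\<lambda>y. indicator B (\<omega>, y)) z * lift \<eta> (\<phi> r \<omega> z)" for \<omega> z
  have "(\<lambda>(\<omega>, z). case_option 0 (\<lambda>y. indicator B (\<omega>, y) :: real) z) \<in> borel_measurable (\<P> r \<Otimes>\<^sub>M \<E>)"
    by (rule ext_measurable_lift) (use B in \<open>simp add: case_prod_beta'\<close>)
  from borel_measurable_times[OF this flow_compose_measurable[OF r lift_eta_measurable]]
  have Y: "(\<lambda>(\<omega>, z). Y \<omega> z) \<in> borel_measurable (\<P> r \<Otimes>\<^sub>M \<E>)"
    by (simp add: Y_def case_prod_beta')
  have Yb: "\<bar>Y \<omega> z\<bar> \<le> eta_sup" if "\<omega> \<in> \<Omega>" "z \<in> ext_phase S" for \<omega> z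
  proof -
    have "\<bar>lift \<eta> (\<phi> r \<omega> z)\<bar> \<le> eta_sup" by (rule lift_eta_bound[OF flow_in_ext[OF r that]])
    moreover then have "0 \<le> eta_sup" by linarith
    ultimately show ?thesis by (auto simp: Y_def indicator_def split: option.splits)
  qed
  have YQ: "exp (\<beta> * r) * (LINT \<omega>'|P. Y \<omega>' z) = lift (\<lambda>y. \<eta> y * measure (Q y) B) z" if z: "z \<in> ext_phase S" for z
    using z Q_formula[OF r _ B] by (cases z) (auto simp: Y_def)
  have "(\<lambda>\<omega>. (\<omega>, x)) \<in> \<P> t \<rightarrow>\<^sub>M \<P> t \<Otimes>\<^sub>M \<B>" using measurable_Pair2'[of x \<B> "\<P> t"] x by simp
  from measurable_compose[OF this borel_measurable_indicator[OF A]]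
  have a: "(\<lambda>\<omega>. indicator A (\<omega>, x) :: real) \<in> borel_measurable (\<P> t)" .
  have AB: "A \<inter> skew_preimage S t B \<in> sets (\<P> (r + t) \<Otimes>\<^sub>M \<B>)"
    using A past_events_mono[OF tr] skew_preimage_past[OF r t B] by blast
  have "\<eta> x * measure (Q x) (A \<inter> skew_preimage S t B) =
    exp (\<beta> * (r + t)) * (LINT \<omega>|P. indicator (A \<inter> skew_preimage S t B) (\<omega>, x) * lift \<eta> (\<phi> (r + t) \<omega> (Some x)))"
    by (rule Q_formula[OF time_add[OF r t] x AB])
  also have "(LINT \<omega>|P. indicator (A \<inter> skew_preimage S t B) (\<omega>, x) * lift \<eta> (\<phi> (r + t) \<omega> (Some x))) =
    (LINT \<omega>|P. indicator A (\<omega>, x) * Y (\<theta> t \<omega>) (\<phi> t \<omega> (Some x)))"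
  proof (intro Bochner_Integration.integral_cong refl)
    fix \<omega> assume "\<omega> \<in> space P"
    then have \<omega>: "\<omega> \<in> \<Omega>" by simp
    have "indicator (skew_preimage S t B) (\<omega>, x) = (case_option 0 (\<lambda>y. indicator B (\<theta> t \<omega>, y)) (\<phi> t \<omega> (Some x)) :: real)"
      using \<omega> x by (auto simp: indicator_def skew_preimage_iff split: option.splits)
    then show "indicator (A \<inter> skew_preimage S t B) (\<omega>, x) * lift \<eta> (\<phi> (r + t) \<omega> (Some x)) =
      indicator A (\<omega>, x) * Y (\<theta> t \<omega>) (\<phi> t \<omega> (Some x))"
      by (simp only: Y_def indicator_inter_arith cocycle[OF t r \<omega> y] mult.assoc)
  qed
  also have "\<dots> = (LINT \<omega>|P. indicator A (\<omega>, x) * (LINT \<omega>'|P. Y \<omega>' (\<phi> t \<omega> (Some x))))"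
    by (rule markov_property[OF r t y a _ Y Yb, of 1]) (simp_all add: indicator_def)
  also have "exp (\<beta> * (r + t)) * \<dots> = exp (\<beta> * t) * (LINT \<omega>|P. exp (\<beta> * r) * (indicator A (\<omega>, x) * (LINT \<omega>'|P. Y \<omega>' (\<phi> t \<omega> (Some x)))))"
    by (simp add: distrib_left exp_add)
  also have "(LINT \<omega>|P. exp (\<beta> * r) * (indicator A (\<omega>, x) * (LINT \<omega>'|P. Y \<omega>' (\<phi> t \<omega> (Some x))))) =
    (LINT \<omega>|P. indicator A (\<omega>, x) * lift (\<lambda>y. \<eta> y * measure (Q y) B) (\<phi> t \<omega> (Some x)))"
    using flow_in_ext[OF t _ y] by (intro Bochner_Integration.integral_cong refl) (simp flip: YQ)
  finally show ?thesis .
qed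

lemma eta_Q_bounds:
  assumes "y \<in> M" shows "0 \<le> \<eta> y * measure (Q y) B" "\<eta> y * measure (Q y) B \<le> \<eta> y" "\<eta> y * measure (Q y) B \<le> eta_sup"
proof -
  interpret Qy: prob_space "Q y" by (rule prob_Q[OF assms])
  show "0 \<le> \<eta> y * measure (Q y) B" using eta_pos[OF assms] by simp
  show "\<eta> y * measure (Q y) B \<le> \<eta> y" using eta_pos[OF assms] by (intro mult_left_le) auto
  then show "\<eta> y * measure (Q y) B \<le> eta_sup" using eta_le[OF assms] by simp
qed

lemma eta_Q_measurable:
  "B \<in> sets (\<F> \<Otimes>\<^sub>M \<B>) \<Longrightarrow> (\<lambda>y. \<eta> y * measure (Q y) B) \<in> borel_measurable \<B>"
  using measure_Q_measurable by measurable

text \<open>Since \<open>\<nu> = \<eta> \<mu>\<close>, invariance under the \<open>Q\<close>-process is the eigenmeasure property of \<open>\<mu>\<close>.\<close>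

lemma Q_nu_preimage_past_event:
  assumes t: "t \<in> T" and B: "B \<in> past_events"
  shows "measure Q_nu (skew_preimage S t B) = measure Q_nu B"
proof -
  obtain r where r: "r \<in> T" and B': "B \<in> sets (\<P> r \<Otimes>\<^sub>M \<B>)" using B by (auto simp: past_events_def)
  have Bf: "B \<in> sets (\<F> \<Otimes>\<^sub>M \<B>)" using B past_events_sets by blast
  have "measure Q_nu (skew_preimage S t B) = (LINT x|\<mu>. \<eta> x * measure (Q x) (skew_preimage S t B))"
    by (rule measure_Q_nu[OF skew_preimage_full[OF t Bf]])
  also have "\<dots> = (LINT x|\<mu>. exp (\<beta> * t) * transition t (lift (\<lambda>y. \<eta> y * measure (Q y) B)) (Some x))"
  proof (intro Bochner_Integration.integral_cong refl)
    fix x assume "x \<in> space \<mu>"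
    then have x: "x \<in> M" by simp
    have "\<Omega> \<times> M \<in> sets (\<P> t \<Otimes>\<^sub>M \<B>)" using sets.top[of "\<P> t \<Otimes>\<^sub>M \<B>"] by (simp add: space_pair_measure)
    from Q_markov[OF r t x this B']
    have "\<eta> x * measure (Q x) (\<Omega> \<times> M \<inter> skew_preimage S t B) =
      exp (\<beta> * t) * (LINT \<omega>|P. indicator (\<Omega> \<times> M) (\<omega>, x) * lift (\<lambda>y. \<eta> y * measure (Q y) B) (\<phi> t \<omega> (Some x)))" .
    moreover have "\<Omega> \<times> M \<inter> skew_preimage S t B = skew_preimage S t B" by (auto simp: skew_preimage_iff)
    moreover have "(LINT \<omega>|P. indicator (\<Omega> \<times> M) (\<omega>, x) * lift (\<lambda>y. \<eta> y * measure (Q y) B) (\<phi> t \<omega> (Some x))) =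
      transition t (lift (\<lambda>y. \<eta> y * measure (Q y) B)) (Some x)"
      unfolding transition_def using x by (intro Bochner_Integration.integral_cong refl) simp
    ultimately show "\<eta> x * measure (Q x) (skew_preimage S t B) = exp (\<beta> * t) * transition t (lift (\<lambda>y. \<eta> y * measure (Q y) B)) (Some x)"
      by simp
  qed
  also have "\<dots> = (LINT y|\<mu>. \<eta> y * measure (Q y) B)"
    using mu_eigenmeasure[OF t eta_Q_measurable[OF Bf] eta_Q_bounds(1,3)] by simp
  also have "\<dots> = measure Q_nu B" by (rule measure_Q_nu[OF Bf, symmetric])
  finally show ?thesis .
qed

text \<open>The event of survival up to \<open>t\<close> is the preimage of the whole space, hence has full measure. So the skew
product may be replaced by the everywhere defined \<open>skew_retract\<close>, whose image measure is determined by its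
values on past events.\<close>

lemma Q_nu_preimage:
  assumes t: "t \<in> T" and A: "A \<in> sets (\<F> \<Otimes>\<^sub>M \<B>)"
  shows "measure Q_nu (skew_preimage S t A) = measure Q_nu A"
proof -
  interpret prob_space Q_nu by (rule prob_Q_nu)
  obtain x0 where x0: "x0 \<in> M" using phase_nonempty by auto
  let ?U = "skew_retract x0 t"
  have U: "?U \<in> Q_nu \<rightarrow>\<^sub>M \<F> \<Otimes>\<^sub>M \<B>"
    using skew_retract_full[OF x0 t] unfolding measurable_cong_sets[OF sets_Q_nu refl] .
  have D: "survival_event t \<in> sets Q_nu"
    using survival_event_sets[OF t] pair_past_le_full sets_Q_nu by blast
  have "skew_preimage S t (\<Omega> \<times> M) = survival_event t"
    unfolding skew_preimage_eq[OF t, of _ x0]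
    using measurable_space[OF skew_retract_full[OF x0 t]] by (auto simp: space_pair_measure survival_event_def)
  then have "measure Q_nu (survival_event t) = 1"
    using Q_nu_preimage_past_event[OF t space_past_events] prob_space by (simp add: space_Q_nu)
  then have AE: "AE z in Q_nu. z \<in> survival_event t" using D prob_eq_1 by blast
  have U_pre: "emeasure (distr Q_nu (\<F> \<Otimes>\<^sub>M \<B>) ?U) A = measure Q_nu (skew_preimage S t A)"
    if A: "A \<in> sets (\<F> \<Otimes>\<^sub>M \<B>)" for A
  proof -
    have "emeasure Q_nu (?U -` A \<inter> space Q_nu) = emeasure Q_nu (skew_preimage S t A)"
      using AE measurable_sets[OF U A] skew_preimage_full[OF t A] sets_Q_nu
      by (intro emeasure_eq_AE) (auto simp: skew_preimage_eq[OF t, of A x0] space_Q_nu)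
    then show ?thesis using A U by (simp add: emeasure_distr emeasure_eq_measure)
  qed
  have "distr Q_nu (\<F> \<Otimes>\<^sub>M \<B>) ?U = Q_nu"
  proof (rule measure_eqI_generator_eq[OF Int_stable_past_events past_events_Pow])
    show "sets (distr Q_nu (\<F> \<Otimes>\<^sub>M \<B>) ?U) = sigma_sets (\<Omega> \<times> M) past_events"
      "sets Q_nu = sigma_sets (\<Omega> \<times> M) past_events"
      using sets_full_past_events sets_Q_nu by simp_all
    show "emeasure (distr Q_nu (\<F> \<Otimes>\<^sub>M \<B>) ?U) X = emeasure Q_nu X" if "X \<in> past_events" for X
      using U_pre[of X] Q_nu_preimage_past_event[OF t that] past_events_sets that
      by (auto simp: emeasure_eq_measure)
    show "range (\<lambda>_::nat. \<Omega> \<times> M) \<subseteq> past_events" using space_past_events by auto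
    show "emeasure (distr Q_nu (\<F> \<Otimes>\<^sub>M \<B>) ?U) (\<Omega> \<times> M) \<noteq> \<infinity>" for i :: nat
      using U_pre[of "\<Omega> \<times> M"] past_events_sets space_past_events by auto
  qed auto
  then show ?thesis using U_pre[OF A] by (simp add: emeasure_eq_measure)
qed

text \<open>Let \<open>A\<close> be decided by time \<open>s\<close>. By the Markov property the correlation at time \<open>u + s\<close> is an integral over
\<open>A\<close> of the rescaled semigroup at time \<open>u\<close>, applied to \<open>f = (\<lambda>y. \<eta> y * measure (Q y) B)\<close> and evaluated at
the position at time \<open>s\<close>. It converges to \<open>\<eta>\<close> times the constant \<open>measure Q_nu B\<close>, which decouples \<open>B\<close> from
\<open>A\<close>. Domination, for the integrals over the noise and over \<open>x\<close>, comes from \<open>f \<le> \<eta>\<close> and the invariance of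
\<open>\<eta>\<close> under the rescaled semigroup.\<close>

lemma mixing_past_events:
  assumes A: "A \<in> past_events" and B: "B \<in> past_events"
  shows "((\<lambda>t. measure Q_nu (A \<inter> skew_preimage S t B)) \<longlongrightarrow> measure Q_nu B * measure Q_nu A) (time_at_top S)"
proof -
  obtain s where s: "s \<in> T" and A': "A \<in> sets (\<P> s \<Otimes>\<^sub>M \<B>)" using A by (auto simp: past_events_def)
  obtain r where r: "r \<in> T" and B': "B \<in> sets (\<P> r \<Otimes>\<^sub>M \<B>)" using B by (auto simp: past_events_def)
  have Af: "A \<in> sets (\<F> \<Otimes>\<^sub>M \<B>)" and Bf: "B \<in> sets (\<F> \<Otimes>\<^sub>M \<B>)" using A B past_events_sets by auto
  define f where "f y = \<eta> y * measure (Q y) B" for y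
  have f_eq: "f = (\<lambda>y. \<eta> y * measure (Q y) B)" by (simp add: fun_eq_iff f_def)
  have f: "f \<in> borel_measurable \<B>" unfolding f_def by (rule eta_Q_measurable[OF Bf])
  have fb: "0 \<le> f y" "f y \<le> \<eta> y" "f y \<le> eta_sup" if "y \<in> M" for y
    unfolding f_def using eta_Q_bounds[OF that] by auto
  have lf: "lift f \<in> borel_measurable \<E>" by (rule ext_measurable_lift1[OF f])
  have lfle: "0 \<le> lift f y \<and> lift f y \<le> lift \<eta> y" if "y \<in> ext_phase S" for y
    using fb that by (cases y) auto
  have lfb: "\<bar>lift f y\<bar> \<le> eta_sup" if "y \<in> ext_phase S" for y
    using lfle[OF that] lift_eta_bound[OF that] by linarith
  have m: "(LINT y|\<mu>. f y) = measure Q_nu B" unfolding f_def by (rule measure_Q_nu[OF Bf, symmetric])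
  have u_lim: "((\<lambda>u. exp (\<beta> * u) * transition u (lift f) z) \<longlongrightarrow> lift \<eta> z * measure Q_nu B) (time_at_top S)"
    if z: "z \<in> ext_phase S" for z
  proof (cases z)
    case None
    have "\<forall>\<^sub>F u in time_at_top S. exp (\<beta> * u) * transition u (lift f) z = 0"
      using eventually_in_time by eventually_elim (simp add: None transition_None)
    then show ?thesis using None by (simp add: tendsto_eventually)
  next
    case (Some y)
    then have "y \<in> M" using z by simp
    from transition_tendsto[OF this f fb(1) fb(3)] show ?thesis by (simp add: Some m)
  qed
  have u_bound: "0 \<le> exp (\<beta> * u) * transition u (lift f) z \<and> exp (\<beta> * u) * transition u (lift f) z \<le> lift \<eta> z"
    if u: "u \<in> T" and z: "z \<in> ext_phase S" for u z
  proof
    have "0 \<le> transition u (lift f) z"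
      unfolding transition_def using lfle flow_in_ext[OF u _ z] by (intro integral_nonneg_AE AE_I2) auto
    then show "0 \<le> exp (\<beta> * u) * transition u (lift f) z" by simp
    have "transition u (lift f) z \<le> transition u (lift \<eta>) z"
      by (rule transition_mono[OF u z lf lfb lift_eta_measurable lift_eta_bound]) (use lfle in auto)
    then have "exp (\<beta> * u) * transition u (lift f) z \<le> exp (\<beta> * u) * transition u (lift \<eta>) z" by simp
    then show "exp (\<beta> * u) * transition u (lift f) z \<le> lift \<eta> z"
      using eta_eigenfunction_ext[OF u z] by simp
  qed
  have Q_lim: "((\<lambda>u. \<eta> x * measure (Q x) (A \<inter> skew_preimage S (u + s) B)) \<longlongrightarrow> measure Q_nu B * (\<eta> x * measure (Q x) A)) (time_at_top S)"
    if x: "x \<in> M" for x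
  proof -
    have y: "Some x \<in> ext_phase S" using x by simp
    have "(\<lambda>\<omega>. (\<omega>, x)) \<in> \<P> s \<rightarrow>\<^sub>M \<P> s \<Otimes>\<^sub>M \<B>" using measurable_Pair2'[of x \<B> "\<P> s"] x by simp
    from measurable_compose[OF this borel_measurable_indicator[OF A']]
    have a: "(\<lambda>\<omega>. indicator A (\<omega>, x) :: real) \<in> borel_measurable (\<P> s)" .
    then have aP: "(\<lambda>\<omega>. indicator A (\<omega>, x) :: real) \<in> borel_measurable P"
      unfolding measurable_noise by (rule measurable_past_full)
    have flP: "(\<lambda>\<omega>. g (\<phi> s \<omega> (Some x))) \<in> borel_measurable P" if "g \<in> borel_measurable \<E>" for g :: "'a option \<Rightarrow> real"
      unfolding measurable_noise by (rule measurable_past_full) (rule measurable_compose[OF flow_measurable_at[OF s y] that])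
    have "((\<lambda>u. LINT \<omega>|P. indicator A (\<omega>, x) * (exp (\<beta> * u) * transition u (lift f) (\<phi> s \<omega> (Some x)))) \<longlongrightarrow>
      (LINT \<omega>|P. indicator A (\<omega>, x) * (lift \<eta> (\<phi> s \<omega> (Some x)) * measure Q_nu B))) (time_at_top S)"
    proof (rule tendsto_integral_dominated_time[OF prob_noise, where B = eta_sup])
      show "(\<lambda>\<omega>. indicator A (\<omega>, x) * (exp (\<beta> * u) * transition u (lift f) (\<phi> s \<omega> (Some x)))) \<in> borel_measurable P"
        if "u \<in> T" for u
        using aP flP[OF transition_measurable[OF that lf]] by measurable
      show "(\<lambda>\<omega>. indicator A (\<omega>, x) * (lift \<eta> (\<phi> s \<omega> (Some x)) * measure Q_nu B)) \<in> borel_measurable P"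
        using aP flP[OF lift_eta_measurable] by measurable
      show "((\<lambda>u. indicator A (\<omega>, x) * (exp (\<beta> * u) * transition u (lift f) (\<phi> s \<omega> (Some x)))) \<longlongrightarrow>
        indicator A (\<omega>, x) * (lift \<eta> (\<phi> s \<omega> (Some x)) * measure Q_nu B)) (time_at_top S)"
        if "\<omega> \<in> space P" for \<omega>
        using that by (intro tendsto_mult tendsto_const u_lim flow_in_ext[OF s _ y]) auto
      show "\<bar>indicator A (\<omega>, x) * (exp (\<beta> * u) * transition u (lift f) (\<phi> s \<omega> (Some x)))\<bar> \<le> eta_sup"
        if "u \<in> T" "\<omega> \<in> space P" for u \<omega>
      proof -
        have z: "\<phi> s \<omega> (Some x) \<in> ext_phase S" using that flow_in_ext[OF s _ y] by simp
        have "\<bar>exp (\<beta> * u) * transition u (lift f) (\<phi> s \<omega> (Some x))\<bar> \<le> eta_sup"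
          using u_bound[OF that(1) z] lift_eta_bound[OF z] by linarith
        moreover then have "0 \<le> eta_sup" by linarith
        ultimately show ?thesis by (simp add: indicator_def)
      qed
    qed
    then have "((\<lambda>u. exp (\<beta> * s) * (LINT \<omega>|P. indicator A (\<omega>, x) * (exp (\<beta> * u) * transition u (lift f) (\<phi> s \<omega> (Some x))))) \<longlongrightarrow>
      exp (\<beta> * s) * (LINT \<omega>|P. indicator A (\<omega>, x) * (lift \<eta> (\<phi> s \<omega> (Some x)) * measure Q_nu B))) (time_at_top S)"
      by (intro tendsto_mult tendsto_const)
    moreover have "exp (\<beta> * s) * (LINT \<omega>|P. indicator A (\<omega>, x) * (lift \<eta> (\<phi> s \<omega> (Some x)) * measure Q_nu B)) =
      measure Q_nu B * (\<eta> x * measure (Q x) A)"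
      unfolding Q_formula[OF s x A'] by (simp flip: mult.assoc)
    ultimately have lim: "((\<lambda>u. exp (\<beta> * s) * (LINT \<omega>|P. indicator A (\<omega>, x) * (exp (\<beta> * u) * transition u (lift f) (\<phi> s \<omega> (Some x))))) \<longlongrightarrow>
      measure Q_nu B * (\<eta> x * measure (Q x) A)) (time_at_top S)" by simp
    have "\<forall>\<^sub>F u in time_at_top S. exp (\<beta> * s) * (LINT \<omega>|P. indicator A (\<omega>, x) * (exp (\<beta> * u) * transition u (lift f) (\<phi> s \<omega> (Some x)))) =
      \<eta> x * measure (Q x) (A \<inter> skew_preimage S (u + s) B)"
      using eventually_in_time
    proof eventually_elim
      case (elim u)
      have us: "s \<le> u + s" using time_nonneg[OF elim] by simp
      have "A \<in> sets (\<P> (u + s) \<Otimes>\<^sub>M \<B>)" using A' past_events_mono[OF us] by blast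
      then have "\<eta> x * measure (Q x) (A \<inter> skew_preimage S (u + s) B) =
        exp (\<beta> * (u + s)) * (LINT \<omega>|P. indicator A (\<omega>, x) * lift f (\<phi> (u + s) \<omega> (Some x)))"
        unfolding f_eq by (rule Q_markov[OF r time_add[OF elim s] x _ B'])
      also have "(LINT \<omega>|P. indicator A (\<omega>, x) * lift f (\<phi> (u + s) \<omega> (Some x))) =
        (LINT \<omega>|P. indicator A (\<omega>, x) * transition u (lift f) (\<phi> s \<omega> (Some x)))"
        by (rule weighted_markov[OF elim s y a, of 1, OF _ lf lfb]) (simp_all add: indicator_def)
      finally show ?case by (simp add: distrib_left exp_add mult.left_commute)
    qed
    from tendsto_cong[OF this] lim show ?thesis by (rule iffD1)
  qed
  have "((\<lambda>u. LINT x|\<mu>. \<eta> x * measure (Q x) (A \<inter> skew_preimage S (u + s) B)) \<longlongrightarrow>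
    (LINT x|\<mu>. measure Q_nu B * (\<eta> x * measure (Q x) A))) (time_at_top S)"
  proof (rule tendsto_integral_dominated_time[OF prob_mu, where B = eta_sup])
    show "(\<lambda>x. \<eta> x * measure (Q x) (A \<inter> skew_preimage S (u + s) B)) \<in> borel_measurable \<mu>" if "u \<in> T" for u
      unfolding measurable_mu
      by (intro eta_Q_measurable sets.Int Af skew_preimage_full Bf time_add that s)
    show "(\<lambda>x. measure Q_nu B * (\<eta> x * measure (Q x) A)) \<in> borel_measurable \<mu>"
      unfolding measurable_mu using eta_Q_measurable[OF Af] by measurable
    show "\<bar>\<eta> x * measure (Q x) (A \<inter> skew_preimage S (u + s) B)\<bar> \<le> eta_sup" if "x \<in> space \<mu>" for u x
      using eta_Q_bounds[of x] that by (auto simp: abs_of_nonneg)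
  qed (use Q_lim in auto)
  then have lim: "((\<lambda>u. LINT x|\<mu>. \<eta> x * measure (Q x) (A \<inter> skew_preimage S (u + s) B)) \<longlongrightarrow>
    measure Q_nu B * measure Q_nu A) (time_at_top S)"
    by (simp add: measure_Q_nu[OF Af])
  have "\<forall>\<^sub>F u in time_at_top S. (LINT x|\<mu>. \<eta> x * measure (Q x) (A \<inter> skew_preimage S (u + s) B)) =
    measure Q_nu (A \<inter> skew_preimage S (u + s) B)"
    using eventually_in_time
    by eventually_elim (intro measure_Q_nu[symmetric] sets.Int Af skew_preimage_full Bf time_add s)
  from tendsto_cong[OF this] lim have "((\<lambda>u. measure Q_nu (A \<inter> skew_preimage S (u + s) B)) \<longlongrightarrow> measure Q_nu B * measure Q_nu A) (time_at_top S)"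
    by (rule iffD1)
  then show ?thesis by (rule tendsto_time_shiftD[OF s])
qed

text \<open>Past events are replaced by arbitrary ones, in one argument after the other. The set functions are dominated by
\<open>Q_nu\<close>, in the first argument by monotonicity and in the second by invariance.\<close>

lemma mixing:
  assumes A: "A \<in> sets (\<F> \<Otimes>\<^sub>M \<B>)" and B: "B \<in> sets (\<F> \<Otimes>\<^sub>M \<B>)"
  shows "((\<lambda>t. measure Q_nu (A \<inter> skew_preimage S t B)) \<longlongrightarrow> measure Q_nu A * measure Q_nu B) (time_at_top S)"
proof -
  interpret prob_space Q_nu by (rule prob_Q_nu)
  have gen: "sets Q_nu = sigma_sets (\<Omega> \<times> M) past_events" using sets_full_past_events sets_Q_nu by simp
  note Dynkin = dominated_setwise_limit[OF finite_measure_axioms gen Int_stable_past_events past_events_Pow space_past_events]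
  have half: "((\<lambda>t. measure Q_nu (A \<inter> skew_preimage S t B)) \<longlongrightarrow> measure Q_nu B * measure Q_nu A) (time_at_top S)"
    if A: "A \<in> sets (\<F> \<Otimes>\<^sub>M \<B>)" and B: "B \<in> past_events" for A B
  proof (rule Dynkin[where n = "\<lambda>t A. measure Q_nu (A \<inter> skew_preimage S t B)"])
    have Bf: "B \<in> sets (\<F> \<Otimes>\<^sub>M \<B>)" using B past_events_sets by auto
    show "\<forall>\<^sub>F t in time_at_top S. \<forall>A\<in>events. \<forall>A'\<in>events. A \<inter> A' = {} \<longrightarrow>
      measure Q_nu ((A \<union> A') \<inter> skew_preimage S t B) = measure Q_nu (A \<inter> skew_preimage S t B) + measure Q_nu (A' \<inter> skew_preimage S t B)"
      using eventually_in_time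
    proof eventually_elim
      case (elim t)
      then have "skew_preimage S t B \<in> events" using skew_preimage_full[OF _ Bf] sets_Q_nu by auto
      then show ?case
        by (auto simp: Int_Un_distrib2 intro!: finite_measure_Union)
    qed
    show "\<forall>\<^sub>F t in time_at_top S. \<forall>A\<in>events. 0 \<le> measure Q_nu (A \<inter> skew_preimage S t B) \<and> measure Q_nu (A \<inter> skew_preimage S t B) \<le> measure Q_nu A"
      by (intro always_eventually allI ballI conjI finite_measure_mono) auto
  qed (use A B mixing_past_events sets_Q_nu in auto)
  have "((\<lambda>t. measure Q_nu (A \<inter> skew_preimage S t B)) \<longlongrightarrow> measure Q_nu A * measure Q_nu B) (time_at_top S)"
  proof (rule Dynkin[where n = "\<lambda>t B. measure Q_nu (A \<inter> skew_preimage S t B)"])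
    show "\<forall>\<^sub>F t in time_at_top S. \<forall>B\<in>events. \<forall>B'\<in>events. B \<inter> B' = {} \<longrightarrow>
      measure Q_nu (A \<inter> skew_preimage S t (B \<union> B')) = measure Q_nu (A \<inter> skew_preimage S t B) + measure Q_nu (A \<inter> skew_preimage S t B')"
      using eventually_in_time
    proof eventually_elim
      case (elim t)
      have pre: "skew_preimage S t B \<in> events" if "B \<in> events" for B
        using skew_preimage_full[OF elim] that sets_Q_nu by auto
      show ?case
      proof (intro ballI impI)
        fix B B' assume B: "B \<in> events" "B' \<in> events" "B \<inter> B' = {}"
        have "A \<inter> skew_preimage S t B \<inter> (A \<inter> skew_preimage S t B') = {}"
          using skew_preimage_disjoint[OF B(3), of t] by auto
        then show "measure Q_nu (A \<inter> skew_preimage S t (B \<union> B')) = measure Q_nu (A \<inter> skew_preimage S t B) + measure Q_nu (A \<inter> skew_preimage S t B')"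
          unfolding skew_preimage_Un Int_Un_distrib
          using A pre B sets_Q_nu by (intro finite_measure_Union) auto
      qed
    qed
    show "\<forall>\<^sub>F t in time_at_top S. \<forall>B\<in>events. 0 \<le> measure Q_nu (A \<inter> skew_preimage S t B) \<and> measure Q_nu (A \<inter> skew_preimage S t B) \<le> measure Q_nu B"
      using eventually_in_time
    proof eventually_elim
      case (elim t)
      show ?case
      proof (intro ballI conjI)
        fix B assume B: "B \<in> events"
        have "measure Q_nu (A \<inter> skew_preimage S t B) \<le> measure Q_nu (skew_preimage S t B)"
          using skew_preimage_full[OF elim, of B] B sets_Q_nu by (intro finite_measure_mono) auto
        then show "measure Q_nu (A \<inter> skew_preimage S t B) \<le> measure Q_nu B"
          using Q_nu_preimage[OF elim, of B] B sets_Q_nu by simp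
      qed simp
    qed
    show "((\<lambda>t. measure Q_nu (A \<inter> skew_preimage S t B)) \<longlongrightarrow> measure Q_nu A * measure Q_nu B) (time_at_top S)"
      if "B \<in> past_events" for B
      using half[OF A that] by (simp add: mult.commute)
  qed (use B sets_Q_nu in auto)
  then show ?thesis .
qed

lemma invariant_Q_nu: "skew_invariant S Q_nu"
proof -
  interpret prob_space Q_nu by (rule prob_Q_nu)
  show ?thesis
    unfolding skew_invariant_def sets_Q_nu
    using skew_preimage_full Q_nu_preimage by (auto simp: emeasure_eq_measure)
qed

lemma strongly_mixing_Q_nu: "skew_strongly_mixing S Q_nu"
  unfolding skew_strongly_mixing_def sets_Q_nu using mixing by blast

lemma ergodic_Q_nu: "skew_ergodic S Q_nu"
  unfolding skew_ergodic_def
proof (intro ballI impI)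
  interpret prob_space Q_nu by (rule prob_Q_nu)
  fix A assume A: "A \<in> sets Q_nu" and inv: "\<forall>t\<in>T. emeasure Q_nu (sym_diff (skew_preimage S t A) A) = 0"
  have Af: "A \<in> sets (\<F> \<Otimes>\<^sub>M \<B>)" using A sets_Q_nu by simp
  have "\<forall>\<^sub>F t in time_at_top S. measure Q_nu (A \<inter> skew_preimage S t A) = measure Q_nu A"
    using eventually_in_time
  proof eventually_elim
    case (elim t)
    have pre: "skew_preimage S t A \<in> sets Q_nu" using skew_preimage_full[OF elim Af] sets_Q_nu by simp
    have "sym_diff (skew_preimage S t A) A \<in> null_sets Q_nu"
      using inv elim pre A by (intro null_setsI) auto
    then have "AE z in Q_nu. z \<notin> sym_diff (skew_preimage S t A) A" by (rule AE_not_in)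
    then have "AE z in Q_nu. z \<in> A \<inter> skew_preimage S t A \<longleftrightarrow> z \<in> A" by eventually_elim auto
    then show ?case using A pre by (intro finite_measure_eq_AE) auto
  qed
  from tendsto_cong[OF this] mixing[OF Af Af]
  have "((\<lambda>t. measure Q_nu A) \<longlongrightarrow> measure Q_nu A * measure Q_nu A) (time_at_top S)" by (rule iffD1)
  from tendsto_unique[OF time_at_top_neq_bot tendsto_const this]
  show "measure Q_nu A = 0 \<or> measure Q_nu A = 1" by simp
qed

end

text \<open>The total variation distance bounds the difference on each event, being the supremum of a bounded set by
\<open>measure_survival_law_le_1\<close>; so its decay gives setwise convergence.\<close>

lemma hypothesis_H_conditioned_rds:
  assumes rds: "timed_rds d S" and H: "hypothesis_H S"
  shows "\<exists>\<mu> \<eta> \<beta>. conditioned_rds d S \<mu> \<eta> \<beta>"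
proof -
  interpret timed_rds d S by (rule rds)
  obtain \<mu> \<alpha> where mu: "\<forall>\<mu>'. quasi_stationary S \<mu>' \<longleftrightarrow> \<mu>' = \<mu>" and \<alpha>: "\<alpha> > 0"
    and tv: "\<forall>x\<in>M. \<exists>C::real. \<forall>t\<in>T. tv_dist (sets \<B>)
            (\<lambda>A. measure (survival_law S (start_law S x) t) (position_event S t A)) (measure \<mu>) \<le> C * exp (- \<alpha> * t)"
    using H unfolding hypothesis_H_def by blast
  obtain \<eta> \<beta> where eta: "\<forall>x\<in>M. 0 < \<eta> x" "bounded (\<eta> ` M)"
    "((\<lambda>t. SUP x\<in>M. \<bar>exp (\<beta> * t) * measure (start_law S x)
            {(\<omega>, y) \<in> \<Omega> \<times> M. ereal t < absorption_time S \<omega> (Some y)} - \<eta> x\<bar>) \<longlongrightarrow> 0) (time_at_top S)"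
    using H unfolding hypothesis_H_def by blast
  have qs: "quasi_stationary S \<mu>" using mu by blast
  then interpret mu: prob_space \<mu> by (simp add: quasi_stationary_def)
  have exp_lim: "((\<lambda>t. C * exp (- \<alpha> * t)) \<longlongrightarrow> 0) (time_at_top S)" for C :: real
  proof -
    have "((\<lambda>t. C * exp (- \<alpha> * t)) \<longlongrightarrow> 0) at_top"
      using \<alpha> by (intro tendsto_mult_right_zero filterlim_compose[OF exp_at_bot]
          filterlim_tendsto_neg_mult_at_bot[OF tendsto_const _ filterlim_ident]) simp
    then show ?thesis unfolding time_at_top_def by (rule filterlim_mono) auto
  qed
  have "conditioned_rds d S \<mu> \<eta> \<beta>"
  proof (intro conditioned_rds.intro conditioned_rds_axioms.intro rds)
    show "prob_space \<mu>" "sets \<mu> = sets \<B>" using qs by (auto simp: quasi_stationary_def)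
    fix x A assume x: "x \<in> M" and A: "A \<in> sets \<B>"
    obtain C :: real where C: "\<And>t. t \<in> T \<Longrightarrow> tv_dist (sets \<B>)
            (\<lambda>A. measure (survival_law S (start_law S x) t) (position_event S t A)) (measure \<mu>) \<le> C * exp (- \<alpha> * t)"
      using tv x by blast
    show "((\<lambda>t. measure (survival_law S (start_law S x) t) (position_event S t A)) \<longlongrightarrow> measure \<mu> A) (time_at_top S)"
    proof (rule Lim_transform[OF tendsto_const Lim_null_comparison[OF _ exp_lim[of C]]])
      show "\<forall>\<^sub>F t in time_at_top S. norm (measure (survival_law S (start_law S x) t) (position_event S t A) - measure \<mu> A) \<le> C * exp (- \<alpha> * t)"
        using eventually_in_time
      proof eventually_elim
        case (elim t)
        let ?p = "\<lambda>A. measure (survival_law S (start_law S x) t) (position_event S t A)"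
        have p: "?p B \<le> 1" if "B \<in> sets \<B>" for B
          by (rule measure_survival_law_le_1[OF elim x position_event_sets[OF elim that]])
        have "\<bar>?p B - measure \<mu> B\<bar> \<le> 1" if "B \<in> sets \<B>" for B
          using p[OF that] measure_nonneg[of "survival_law S (start_law S x) t" "position_event S t B"]
            measure_nonneg[of \<mu> B] mu.prob_le_1[of B] by linarith
        then have "bdd_above ((\<lambda>B. \<bar>?p B - measure \<mu> B\<bar>) ` sets \<B>)" by (intro bdd_aboveI2)
        from cSUP_upper[OF A this] C[OF elim] show ?case by (simp add: tv_dist_def)
      qed
    qed
  qed (use eta in auto)
  then show ?thesis by blast
qed

lemma skew_product_strongly_mixing:
  fixes S :: "('x::topological_space, 'a::euclidean_space) rds"
  assumes "absorbed_rds d S" "time S = \<nat> \<or> time S = {0..}" "hypothesis_H S" "quasi_ergodic S \<nu>"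
    and "\<forall>x\<in>phase S. Q_measure S x (Q x)"
  shows "Q \<in> \<nu> \<rightarrow>\<^sub>M prob_algebra (full_algebra S \<Otimes>\<^sub>M phase_borel S) \<and>
          prob_space (\<nu> \<bind> Q) \<and> sets (\<nu> \<bind> Q) = sets (full_algebra S \<Otimes>\<^sub>M phase_borel S) \<and>
          skew_invariant S (\<nu> \<bind> Q) \<and> skew_ergodic S (\<nu> \<bind> Q) \<and>
          skew_strongly_mixing S (\<nu> \<bind> Q)"
proof -
  have "timed_rds d S" using assms by (intro timed_rds.intro timed_rds_axioms.intro)
  then obtain \<mu> \<eta> \<beta> where "conditioned_rds d S \<mu> \<eta> \<beta>"
    using hypothesis_H_conditioned_rds assms by blast
  then interpret Q_process d S \<mu> \<eta> \<beta> Q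
    using assms by (intro Q_process.intro Q_process_axioms.intro) auto
  have nu: "\<nu> = nu" unfolding nu_def by (rule quasi_ergodic_eq) fact
  have "Q \<in> nu \<rightarrow>\<^sub>M prob_algebra (full_algebra S \<Otimes>\<^sub>M phase_borel S)"
    using Q_measurable unfolding measurable_cong_sets[OF sets_nu refl] .
  then show ?thesis
    unfolding nu Q_nu_def[symmetric]
    using prob_Q_nu sets_Q_nu invariant_Q_nu ergodic_Q_nu strongly_mixing_Q_nu by blast
qed

theorem theorem1:
  shows
    "(\<forall>d (S :: ('x::polish_space, real^'n) rds) \<nu> Q.
        absorbed_rds d S \<and> discrete_noise S \<and> hypothesis_H S \<and> quasi_ergodic S \<nu> \<and>
        (\<forall>x\<in>phase S. Q_measure S x (Q x)) \<longrightarrow>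
          Q \<in> \<nu> \<rightarrow>\<^sub>M prob_algebra (full_algebra S \<Otimes>\<^sub>M phase_borel S) \<and>
          prob_space (\<nu> \<bind> Q) \<and> sets (\<nu> \<bind> Q) = sets (full_algebra S \<Otimes>\<^sub>M phase_borel S) \<and>
          skew_invariant S (\<nu> \<bind> Q) \<and> skew_ergodic S (\<nu> \<bind> Q) \<and>
          skew_strongly_mixing S (\<nu> \<bind> Q)) \<and>
     (\<forall>d (S :: (real^'m, real^'n) rds) \<nu> Q.
        absorbed_rds d S \<and> continuous_noise S \<and> hypothesis_H S \<and> quasi_ergodic S \<nu> \<and>
        (\<forall>x\<in>phase S. Q_measure S x (Q x)) \<longrightarrow>
          Q \<in> \<nu> \<rightarrow>\<^sub>M prob_algebra (full_algebra S \<Otimes>\<^sub>M phase_borel S) \<and>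
          prob_space (\<nu> \<bind> Q) \<and> sets (\<nu> \<bind> Q) = sets (full_algebra S \<Otimes>\<^sub>M phase_borel S) \<and>
          skew_invariant S (\<nu> \<bind> Q) \<and> skew_ergodic S (\<nu> \<bind> Q) \<and>
          skew_strongly_mixing S (\<nu> \<bind> Q))"
proof (rule conjI; intro allI impI; elim conjE)
  fix d and S :: "('x, real^'n) rds" and \<nu> Q
  assume "absorbed_rds d S" "discrete_noise S" "hypothesis_H S" "quasi_ergodic S \<nu>"
    "\<forall>x\<in>phase S. Q_measure S x (Q x)"
  then show "Q \<in> \<nu> \<rightarrow>\<^sub>M prob_algebra (full_algebra S \<Otimes>\<^sub>M phase_borel S) \<and>
          prob_space (\<nu> \<bind> Q) \<and> sets (\<nu> \<bind> Q) = sets (full_algebra S \<Otimes>\<^sub>M phase_borel S) \<and>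
          skew_invariant S (\<nu> \<bind> Q) \<and> skew_ergodic S (\<nu> \<bind> Q) \<and>
          skew_strongly_mixing S (\<nu> \<bind> Q)"
    by (intro skew_product_strongly_mixing) (auto simp: discrete_noise_def)
next
  fix d and S :: "(real^'m, real^'n) rds" and \<nu> Q
  assume "absorbed_rds d S" "continuous_noise S" "hypothesis_H S" "quasi_ergodic S \<nu>"
    "\<forall>x\<in>phase S. Q_measure S x (Q x)"
  then show "Q \<in> \<nu> \<rightarrow>\<^sub>M prob_algebra (full_algebra S \<Otimes>\<^sub>M phase_borel S) \<and>
          prob_space (\<nu> \<bind> Q) \<and> sets (\<nu> \<bind> Q) = sets (full_algebra S \<Otimes>\<^sub>M phase_borel S) \<and>
          skew_invariant S (\<nu> \<bind> Q) \<and> skew_ergodic S (\<nu> \<bind> Q) \<and>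
          skew_strongly_mixing S (\<nu> \<bind> Q)"
    by (intro skew_product_strongly_mixing) (auto simp: continuous_noise_def)
qed

end
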